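(* Consider a discrete memoryless channel described by two transition probabilities $p(y_1|x_1)$ and $p(y_2|x_1,x_2)$ satisfying Conditions 1 and 2 (stated in the context), with $\tau$ and $p^*(x_2)$ as in Condition 2. The capacity region of the corresponding Z-channel with degraded message sets is the set of nonnegative rate triplets $(R_{1c},R_{1p},R_2)$ satisfying \begin{align*} R_{1p} &\le I(X_1;Y_1|W)+\gamma,\\ R_{1c}+R_{1p} &\le I(X_1;Y_1),\\ R_{1c} &\le I(W;Y_2|X_2)-\gamma,\\ R_2+R_{1c} &\le \tau-H(Y_2|W,X_2)-\gamma, \end{align*} for some $p(w)p(x_1|w)$ and some $\gamma\ge0$, where the mutual informations and entropies are evaluated using $$p(w,x_1,x_2,y_1,y_2)=p(w)\,p(x_1|w)\,p^*(x_2)\,p(y_1|x_1)\,p(y_2|x_1,x_2),$$ with $W$ on a finite alphabet.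
   Context: Channel: finite input alphabets $\mathcal{X}_1,\mathcal{X}_2$ and finite output alphabets $\mathcal{Y}_1,\mathcal{Y}_2$; $n$ uses of the channel are governed by product laws, e.g. $p(y_2^n|x_1^n,x_2^n)=\prod_{i=1}^n p(y_{2,i}|x_{1,i},x_{2,i})$. Logarithms are base 2. Notation: $A^n=(A_1,\dots,A_n)$. Condition 1: for every positive integer $n$ and every distribution $p(x_1^n)$ on $\mathcal{X}_1^n$, the entropy $H(Y_2^n|X_2^n=x_2^n)$, evaluated with the distribution $\sum_{x_1^n}p(x_1^n)p(y_2^n|x_1^n,x_2^n)$ of $Y_2^n$, does not depend on $x_2^n\in\mathcal{X}_2^n$. Condition 2: let $\tau=\max_{p(x_1)p(x_2)}H(Y_2)$. There exists a distribution $p^*(x_2)$ on $\mathcal{X}_2$ such that $H(Y_2)$, evaluated with the distribution $\sum_{x_1,x_2}p(x_1)p^*(x_2)p(y_2|x_1,x_2)$, equals $\tau$ for every $p(x_1)$. Z-channel with degraded message sets: there are three independent uniform messages $W_{1c}\in\{1,\dots,2^{nR_{1c}}\}$, $W_{1p}\in\{1,\dots,2^{nR_{1p}}\}$, $W_2\in\{1,\dots,2^{nR_2}\}$. Transmitter 1 maps $(W_{1c},W_{1p})$ to $X_1^n\in\mathcal{X}_1^n$; Transmitter 2 maps $W_2$ to $X_2^n\in\mathcal{X}_2^n$. Receiver 1 observes $Y_1^n$ and must decode $(W_{1c},W_{1p})$; Receiver 2 observes $Y_2^n$ and must decode $(W_{1c},W_2)$. A rate triplet $(R_{1c},R_{1p},R_2)$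 is achievable if there is a sequence of such length-$n$ codes for which the probability that some receiver errs tends to $0$ as $n\to\infty$; the capacity region is the closure of the set of achievable triplets. *)

theory Defs
  imports "HOL-Probability.Probability" "HOL-Library.Monad_Syntax"
begin

section \<open>Information measures of random variables on a discrete probability space\<close>

text \<open>
  These are the library's information measures in base 2, for random variables on the probability
  space of a \<^typ>\<open>'o pmf\<close>, with the counting measure on the alphabets.  All alphabets used below
  are countable types, and all distributions used below have finite support.
\<close>

definition ent :: "'o pmf \<Rightarrow> ('o \<Rightarrow> 'a) \<Rightarrow> real" where
  "ent P X = prob_space.entropy (measure_pmf P) 2 (count_space UNIV) X"

definition cond_ent :: "'o pmf \<Rightarrow> ('o \<Rightarrow> 'a) \<Rightarrow> ('o \<Rightarrow> 'b) \<Rightarrow> real" where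
  "cond_ent P X Y =
     prob_space.conditional_entropy (measure_pmf P) 2 (count_space UNIV) (count_space UNIV) X Y"

definition mut_info :: "'o pmf \<Rightarrow> ('o \<Rightarrow> 'a) \<Rightarrow> ('o \<Rightarrow> 'b) \<Rightarrow> real" where
  "mut_info P X Y =
     prob_space.mutual_information (measure_pmf P) 2 (count_space UNIV) (count_space UNIV) X Y"

definition cond_mut_info ::
  "'o pmf \<Rightarrow> ('o \<Rightarrow> 'a) \<Rightarrow> ('o \<Rightarrow> 'b) \<Rightarrow> ('o \<Rightarrow> 'c) \<Rightarrow> real" where
  "cond_mut_info P X Y Z =
     prob_space.conditional_mutual_information (measure_pmf P) 2
       (count_space UNIV) (count_space UNIV) (count_space UNIV) X Y Z"


section \<open>Memoryless channels\<close>

text \<open>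
  Sequences of length $n$ over an alphabet are lists of length $n$.  The output distribution of $n$
  uses of a channel \<open>K\<close> is the product law, see \<open>pmf_dmc\<close>.
\<close>

primrec dmc :: "('a \<Rightarrow> 'b pmf) \<Rightarrow> 'a list \<Rightarrow> 'b list pmf" where
  "dmc K [] = return_pmf []"
| "dmc K (x # xs) = map_pmf (\<lambda>(y, ys). y # ys) (pair_pmf (K x) (dmc K xs))"

lemma pmf_dmc:
  fixes K :: "'a \<Rightarrow> 'b pmf"
  shows "pmf (dmc K xs) ys =
     (if length ys = length xs then \<Prod>i<length xs. pmf (K (xs ! i)) (ys ! i) else 0)"
proof (induction xs arbitrary: ys)
  case Nil
  then show ?case by (cases ys) auto
next
  case (Cons x xs)
  have inj: "inj (\<lambda>(y, ys). (y :: 'b) # ys)"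
    by (auto simp: inj_def)
  show ?case
  proof (cases ys)
    case Nil
    have "ys \<notin> set_pmf (dmc K (x # xs))"
      using Nil by auto
    then have "pmf (dmc K (x # xs)) ys = 0"
      unfolding set_pmf_iff by blast
    then show ?thesis
      using Nil by simp
  next
    case (Cons z zs)
    have "pmf (dmc K (x # xs)) ys = pmf (K x) z * pmf (dmc K xs) zs"
      using pmf_map_inj'[OF inj, of "pair_pmf (K x) (dmc K xs)" "(z, zs)"] Cons
      by (simp add: pmf_pair)
    then show ?thesis
      using Cons Cons.IH[of zs] by (simp del: prod.lessThan_Suc add: prod.lessThan_Suc_shift)
  qed
qed

definition dmc2 :: "('a \<Rightarrow> 'b \<Rightarrow> 'c pmf) \<Rightarrow> 'a list \<Rightarrow> 'b list \<Rightarrow> 'c list pmf" where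
  "dmc2 K xs xs' = dmc (case_prod K) (zip xs xs')"


section \<open>The two conditions on the channel to Receiver 2\<close>

definition condition1 :: "('x1::finite \<Rightarrow> 'x2::finite \<Rightarrow> 'y2::finite pmf) \<Rightarrow> bool" where
  "condition1 p2 \<longleftrightarrow>
     (\<forall>n>0. \<forall>p. set_pmf p \<subseteq> {x1. length x1 = n} \<longrightarrow>
       (\<forall>x2 x2'. length x2 = n \<longrightarrow> length x2' = n \<longrightarrow>
          ent (p \<bind> (\<lambda>x1. dmc2 p2 x1 x2)) id = ent (p \<bind> (\<lambda>x1. dmc2 p2 x1 x2')) id))"

definition output2 ::
  "('x1::finite \<Rightarrow> 'x2::finite \<Rightarrow> 'y2::finite pmf) \<Rightarrow> 'x1 pmf \<Rightarrow> 'x2 pmf \<Rightarrow> 'y2 pmf" where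
  "output2 p2 q1 q2 = do {x1 \<leftarrow> q1; x2 \<leftarrow> q2; p2 x1 x2}"

definition is_tau :: "('x1::finite \<Rightarrow> 'x2::finite \<Rightarrow> 'y2::finite pmf) \<Rightarrow> real \<Rightarrow> bool" where
  "is_tau p2 \<tau> \<longleftrightarrow>
     (\<exists>q1 q2. ent (output2 p2 q1 q2) id = \<tau>) \<and> (\<forall>q1 q2. ent (output2 p2 q1 q2) id \<le> \<tau>)"

text \<open>Condition 2 asserts that some \<open>pstar\<close> with the following property exists.\<close>

definition condition2 ::
  "('x1::finite \<Rightarrow> 'x2::finite \<Rightarrow> 'y2::finite pmf) \<Rightarrow> real \<Rightarrow> 'x2 pmf \<Rightarrow> bool" where
  "condition2 p2 \<tau> pstar \<longleftrightarrow> is_tau p2 \<tau> \<and> (\<forall>q1. ent (output2 p2 q1 pstar) id = \<tau>)"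


section \<open>The Z-channel with degraded message sets\<close>

text \<open>The positive integers up to $2^{nR}$, where $2^{nR}$ need not be an integer.\<close>

definition messages :: "nat \<Rightarrow> real \<Rightarrow> nat set" where
  "messages n R = {m. 1 \<le> m \<and> real m \<le> 2 powr (real n * R)}"

text \<open>
  Joint distribution of the messages and of the channel outputs; the outputs are conditionally
  independent given the channel inputs.
\<close>

definition transmission ::
  "('x1::finite \<Rightarrow> 'y1::finite pmf) \<Rightarrow> ('x1 \<Rightarrow> 'x2::finite \<Rightarrow> 'y2::finite pmf) \<Rightarrow>
   nat \<Rightarrow> real \<Rightarrow> real \<Rightarrow> real \<Rightarrow> (nat \<Rightarrow> nat \<Rightarrow> 'x1 list) \<Rightarrow> (nat \<Rightarrow> 'x2 list) \<Rightarrow>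
   (nat \<times> nat \<times> nat \<times> 'y1 list \<times> 'y2 list) pmf" where
  "transmission p1 p2 n R1c R1p R2 enc1 enc2 = do {
     w1c \<leftarrow> pmf_of_set (messages n R1c);
     w1p \<leftarrow> pmf_of_set (messages n R1p);
     w2 \<leftarrow> pmf_of_set (messages n R2);
     y1 \<leftarrow> dmc p1 (enc1 w1c w1p);
     y2 \<leftarrow> dmc2 p2 (enc1 w1c w1p) (enc2 w2);
     return_pmf (w1c, w1p, w2, y1, y2)
   }"

definition error_prob ::
  "('x1::finite \<Rightarrow> 'y1::finite pmf) \<Rightarrow> ('x1 \<Rightarrow> 'x2::finite \<Rightarrow> 'y2::finite pmf) \<Rightarrow>
   nat \<Rightarrow> real \<Rightarrow> real \<Rightarrow> real \<Rightarrow> (nat \<Rightarrow> nat \<Rightarrow> 'x1 list) \<Rightarrow> (nat \<Rightarrow> 'x2 list) \<Rightarrow>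
   ('y1 list \<Rightarrow> nat \<times> nat) \<Rightarrow> ('y2 list \<Rightarrow> nat \<times> nat) \<Rightarrow> real" where
  "error_prob p1 p2 n R1c R1p R2 enc1 enc2 dec1 dec2 =
     measure_pmf.prob (transmission p1 p2 n R1c R1p R2 enc1 enc2)
       {(w1c, w1p, w2, y1, y2). dec1 y1 \<noteq> (w1c, w1p) \<or> dec2 y2 \<noteq> (w1c, w2)}"

definition valid_encoders ::
  "nat \<Rightarrow> real \<Rightarrow> real \<Rightarrow> real \<Rightarrow> (nat \<Rightarrow> nat \<Rightarrow> 'x1 list) \<Rightarrow> (nat \<Rightarrow> 'x2 list) \<Rightarrow> bool" where
  "valid_encoders n R1c R1p R2 enc1 enc2 \<longleftrightarrow>
     (\<forall>w1c\<in>messages n R1c. \<forall>w1p\<in>messages n R1p. length (enc1 w1c w1p) = n) \<and>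
     (\<forall>w2\<in>messages n R2. length (enc2 w2) = n)"

definition achievable ::
  "('x1::finite \<Rightarrow> 'y1::finite pmf) \<Rightarrow> ('x1 \<Rightarrow> 'x2::finite \<Rightarrow> 'y2::finite pmf) \<Rightarrow>
   (real \<times> real \<times> real) set" where
  "achievable p1 p2 = {(R1c, R1p, R2). 0 \<le> R1c \<and> 0 \<le> R1p \<and> 0 \<le> R2 \<and>
     (\<exists>enc1 enc2 dec1 dec2.
        (\<forall>n. valid_encoders n R1c R1p R2 (enc1 n) (enc2 n)) \<and>
        (\<lambda>n. error_prob p1 p2 n R1c R1p R2 (enc1 n) (enc2 n) (dec1 n) (dec2 n))
          \<longlonglongrightarrow> 0)}"

definition capacity_region ::
  "('x1::finite \<Rightarrow> 'y1::finite pmf) \<Rightarrow> ('x1 \<Rightarrow> 'x2::finite \<Rightarrow> 'y2::finite pmf) \<Rightarrow>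
   (real \<times> real \<times> real) set" where
  "capacity_region p1 p2 = closure (achievable p1 p2)"


section \<open>The single-letter distribution\<close>

text \<open>
  The law $p(w)p(x_1|w)p^*(x_2)p(y_1|x_1)p(y_2|x_1,x_2)$.  A finite alphabet for $W$ is represented
  by natural numbers: \<open>pW\<close> is required to have finite support wherever this is used.
\<close>

definition joint_law ::
  "nat pmf \<Rightarrow> (nat \<Rightarrow> 'x1::finite pmf) \<Rightarrow> 'x2::finite pmf \<Rightarrow>
   ('x1 \<Rightarrow> 'y1::finite pmf) \<Rightarrow> ('x1 \<Rightarrow> 'x2 \<Rightarrow> 'y2::finite pmf) \<Rightarrow>
   (nat \<times> 'x1 \<times> 'x2 \<times> 'y1 \<times> 'y2) pmf" where
  "joint_law pW pX1 pX2 p1 p2 = do {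
     w \<leftarrow> pW;
     x1 \<leftarrow> pX1 w;
     x2 \<leftarrow> pX2;
     y1 \<leftarrow> p1 x1;
     y2 \<leftarrow> p2 x1 x2;
     return_pmf (w, x1, x2, y1, y2)
   }"

end

theory Submission
  imports Defs "HOL-Real_Asymp.Real_Asymp"
begin

text \<open>
  By Condition 1 all entropies of $Y_2$ given $X_2$ may be evaluated at one fixed letter of $X_2$, so
  the region only involves the two channels \<open>p1\<close> and $L(x) = p_2(\cdot|x, v)$.  It depends on
  $p(w)p(x_1|w)$ only through the mean of the points (law of $X_1$, $H(Y_1)$, $H(Y_2|X_2)$), that
  is, through a point of the convex hull of a compact set.  This hull is compact, so the region is
  closed, without any bound on the alphabet of $W$.

  Converse: Fano's inequality bounds the rates by block entropies.  Given the common message, an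
  induction in the style of the Csiszar sum identity writes both $H(Y_1^n)$ and $H(Y_2^n)$
  as $n$ times the coordinates of a point of the hull plus one common slack, which becomes
  $n\gamma$.

  Achievability: superposition coding, where the cloud centre carries the common message and a part
  of rate $\gamma$ of the private message.  Receiver 2 decodes the cloud centre and $W_2$; each of the
  five kinds of wrong codeword is rejected by a likelihood ratio test.  Condition 2 turns
  $I(X_2; Y_2|W)$ and $I(W, X_2; Y_2)$ into $\tau - H(Y_2|W, X_2)$.
\<close>

section \<open>Expectations and entropy of finitely supported distributions\<close>

text \<open>In the converse the auxiliary variable gathers the common message, past outputs of one
  channel and future outputs of the other, so its alphabet grows with n; only the hull point that it
  induces is kept, and limits are taken there. The slack \<gamma> is the one parameter outside a
  compact set, and the last inequality bounds it. Condition 1 is used for whole blocks: given the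
  common message the law of X1^n is arbitrary, and the actual word X2^n is exchanged for a constant
  one, so that the outputs at Receiver 2 come from n uses of one channel \<open>L\<close>. Random
  coding wants strict inequalities, but a bound may read 0 = 0 at every candidate point, for
  instance for a useless channel. Rates are therefore scaled by s < 1, which gives strictness
  exactly for the rate sums that are positive; the other error kinds have no wrong codeword at all.
  Moreover \<gamma> may exceed R1p, and then the whole private message goes into the cloud and each
  cloud has one satellite.\<close>

abbreviation E :: "'a pmf \<Rightarrow> ('a \<Rightarrow> real) \<Rightarrow> real" where
  "E p f \<equiv> measure_pmf.expectation p f"

abbreviation fin :: "'a pmf \<Rightarrow> bool" where
  "fin p \<equiv> finite (set_pmf p)"

lemma E_eq_sum: "fin p \<Longrightarrow> E p f = (\<Sum>x\<in>set_pmf p. pmf p x * f x)"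
  by (subst integral_measure_pmf[of "set_pmf p"]) auto

lemma E_cong: "(\<And>x. x \<in> set_pmf p \<Longrightarrow> f x = g x) \<Longrightarrow> E p f = E p g"
  by (intro integral_cong_AE) (auto simp: AE_measure_pmf_iff)

lemma E_mono: "fin p \<Longrightarrow> (\<And>x. x \<in> set_pmf p \<Longrightarrow> f x \<le> g x) \<Longrightarrow> E p f \<le> E p g"
  by (intro integral_mono_AE integrable_measure_pmf_finite) (auto simp: AE_measure_pmf_iff)

lemma E_add: "fin p \<Longrightarrow> E p (\<lambda>x. f x + g x) = E p f + E p g"
  by (intro Bochner_Integration.integral_add integrable_measure_pmf_finite)

lemma E_diff: "fin p \<Longrightarrow> E p (\<lambda>x. f x - g x) = E p f - E p g"
  by (intro Bochner_Integration.integral_diff integrable_measure_pmf_finite)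

lemma E_sum: "fin p \<Longrightarrow> E p (\<lambda>x. \<Sum>i\<in>I. f i x) = (\<Sum>i\<in>I. E p (f i))"
  by (intro Bochner_Integration.integral_sum integrable_measure_pmf_finite)

lemma E_bind:
  assumes "fin p" "\<And>x. x \<in> set_pmf p \<Longrightarrow> fin (K x)"
  shows "E (p \<bind> K) f = E p (\<lambda>x. E (K x) f)"
  using assms by (subst pmf_expectation_bind[of "set_pmf p"]) (auto simp: E_eq_sum)

lemma E_swap:
  assumes "fin p" "fin q"
  shows "E p (\<lambda>x. E q (f x)) = E q (\<lambda>y. E p (\<lambda>x. f x y))"
  using assms by (simp add: E_eq_sum sum_distrib_left mult_ac sum.swap[of _ "set_pmf q"])

lemma prob_bind: "measure_pmf.prob (p \<bind> K) A = E p (\<lambda>x. measure_pmf.prob (K x) A)"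
proof -
  have "ennreal (measure_pmf.prob (p \<bind> K) A) = (\<integral>\<^sup>+x. measure_pmf.prob (K x) A \<partial>p)"
    by (simp add: measure_pmf.emeasure_eq_measure[symmetric])
  also have "\<dots> = ennreal (E p (\<lambda>x. measure_pmf.prob (K x) A))"
    by (intro nn_integral_eq_integral measure_pmf.integrable_const_bound[where B=1]) auto
  finally show ?thesis by (simp add: integral_nonneg_AE)
qed

section \<open>Entropy of laws: chain rule, Gibbs' inequality and its consequences\<close>

definition H :: "'a pmf \<Rightarrow> real" where
  "H p = E p (\<lambda>x. - log 2 (pmf p x))"

text \<open>The law of an input together with the output of the channel \<open>K\<close>. Entropy
  identities below come from writing one law as a \<open>joint\<close> in two ways and applying the
  chain rule to each.\<close>

definition joint :: "'a pmf \<Rightarrow> ('a \<Rightarrow> 'b pmf) \<Rightarrow> ('a \<times> 'b) pmf" where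
  "joint p K = p \<bind> (\<lambda>x. map_pmf (Pair x) (K x))"

lemma set_joint: "set_pmf (joint p K) = (SIGMA x:set_pmf p. set_pmf (K x))"
  by (auto simp: joint_def)

lemma pmf_map_Pair: "pmf (map_pmf (Pair x) q) (a, b) = (if x = a then pmf q b else 0)"
proof (cases "x = a")
  case True
  then show ?thesis using pmf_map_inj'[of "Pair x" q b] by (simp add: inj_def)
next
  case False
  then show ?thesis by (auto intro!: pmf_map_outside)
qed

lemma pmf_joint: "pmf (joint p K) (a, b) = pmf p a * pmf (K a) b"
proof -
  have "pmf (joint p K) (a, b) = E p (\<lambda>x. if x = a then pmf (K x) b else 0)"
    unfolding joint_def by (simp add: pmf_bind pmf_map_Pair)
  also have "\<dots> = pmf p a * pmf (K a) b"
    by (subst integral_measure_pmf[of "{a}"]) (auto split: if_splits)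
  finally show ?thesis .
qed

lemma map_fst_joint: "map_pmf fst (joint p K) = p"
  by (simp add: joint_def map_bind_pmf map_pmf_comp bind_return_pmf')

lemma map_snd_joint: "map_pmf snd (joint p K) = p \<bind> K"
  by (simp add: joint_def map_bind_pmf map_pmf_comp)

lemma fin_joint: "fin p \<Longrightarrow> (\<And>x. x \<in> set_pmf p \<Longrightarrow> fin (K x)) \<Longrightarrow> fin (joint p K)"
  by (auto simp: set_joint)

lemma E_joint:
  assumes "fin p" "\<And>x. x \<in> set_pmf p \<Longrightarrow> fin (K x)"
  shows "E (joint p K) f = E p (\<lambda>x. E (K x) (\<lambda>y. f (x, y)))"
  using assms unfolding joint_def by (subst E_bind) auto

text \<open>Conditional laws, obtained by conditioning on the event that the first component equals
  x. Off the support of the first marginal that event is null and the kernel is junk, so claims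
  about \<open>K x\<close> are restricted to the support. The support clause carries finiteness and
  the length of words over from \<open>q\<close> to the kernel.\<close>

lemma ex_disintegration: "\<exists>K. q = joint (map_pmf fst q) K \<and> (\<forall>x\<in>set_pmf (map_pmf fst q).
    set_pmf (K x) \<subseteq> snd ` set_pmf q)"
proof (intro exI conjI ballI)
  define K where "K = (\<lambda>x. map_pmf snd (cond_pmf q {z. x = fst z}))"
  have ne: "set_pmf q \<inter> {z. x = fst z} \<noteq> {}" if "x \<in> set_pmf (map_pmf fst q)" for x
    using that by auto
  have "q = map_pmf fst q \<bind> (\<lambda>x. cond_pmf q {z. x = fst z})"
  proof (rule bind_cond_pmf_cancel[symmetric])
    fix x :: 'a and y :: "'a \<times> 'b" assume "x = fst y"
    then show "measure_pmf.prob q {z. x = fst z} = measure_pmf.prob (map_pmf fst q) {x. x = fst y}"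
      by (auto simp: vimage_def intro!: arg_cong[where f="measure_pmf.prob q"])
  qed (use ne in auto)
  also have "\<dots> = joint (map_pmf fst q) K"
    unfolding joint_def
  proof (rule bind_pmf_cong[OF refl])
    fix x assume x: "x \<in> set_pmf (map_pmf fst q)"
    have "map_pmf (Pair x) (K x) = map_pmf (\<lambda>z. (x, snd z)) (cond_pmf q {z. x = fst z})"
      by (simp add: K_def map_pmf_comp)
    also have "\<dots> = map_pmf id (cond_pmf q {z. x = fst z})"
      by (rule map_pmf_cong) (use ne[OF x] in auto)
    finally show "cond_pmf q {z. x = fst z} = map_pmf (Pair x) (K x)" by simp
  qed
  finally show "q = joint (map_pmf fst q) K" .
  fix x assume "x \<in> set_pmf (map_pmf fst q)"
  with ne[of x] show "set_pmf (K x) \<subseteq> snd ` set_pmf q"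
    by (auto simp: K_def)
qed

lemma H_map_inj: "inj_on f (set_pmf p) \<Longrightarrow> H (map_pmf f p) = H p"
  unfolding H_def by (simp, intro E_cong) (simp add: pmf_map_inj)

lemma H_return [simp]: "H (return_pmf x) = 0"
  by (simp add: H_def)

text \<open>The chain rule H(X,Y) = H(X) + H(Y|X): the logarithm of the product pmf splits on the
  support.\<close>

lemma H_joint:
  assumes "fin p" "\<And>x. x \<in> set_pmf p \<Longrightarrow> fin (K x)"
  shows "H (joint p K) = H p + E p (\<lambda>x. H (K x))"
proof -
  have "H (joint p K) = E p (\<lambda>x. E (K x) (\<lambda>y. - log 2 (pmf p x * pmf (K x) y)))"
    unfolding H_def using assms by (simp add: E_joint pmf_joint)
  also have "\<dots> = E p (\<lambda>x. E (K x) (\<lambda>y. - log 2 (pmf p x) + - log 2 (pmf (K x) y)))"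
    by (intro E_cong) (simp add: log_mult_pos pmf_positive)
  also have "\<dots> = E p (\<lambda>x. - log 2 (pmf p x) + H (K x))"
    unfolding H_def by (intro E_cong, subst E_add) (use assms in auto)
  also have "\<dots> = H p + E p (\<lambda>x. H (K x))"
    using assms(1) by (subst E_add) (simp_all add: H_def)
  finally show ?thesis .
qed

text \<open>The bound ln t \<le> t - 1 at t = r/p, averaged under \<open>p\<close>. The guess
  \<open>r\<close> is a weight of total mass at most 1 rather than a law, which is the form that
  Fano's inequality uses.\<close>

lemma gibbs:
  assumes "fin p" and pos: "\<And>x. x \<in> set_pmf p \<Longrightarrow> 0 < r x" and "(\<Sum>x\<in>set_pmf p. r x) \<le> 1"
  shows "H p \<le> E p (\<lambda>x. - log 2 (r x))"
proof -
  have "H p - E p (\<lambda>x. - log 2 (r x)) = E p (\<lambda>x. log 2 (r x / pmf p x))"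
    unfolding H_def using assms(1)
    by (subst E_diff[symmetric], simp, intro E_cong) (auto simp: log_divide_pos pmf_positive pos)
  also have "\<dots> \<le> E p (\<lambda>x. (r x / pmf p x - 1) / ln 2)"
    using assms(1)
  proof (rule E_mono)
    fix x assume x: "x \<in> set_pmf p"
    then show "log 2 (r x / pmf p x) \<le> (r x / pmf p x - 1) / ln 2"
      unfolding log_def by (intro divide_right_mono ln_le_minus_one) (auto simp: pos pmf_positive)
  qed
  also have "\<dots> = ((\<Sum>x\<in>set_pmf p. r x) - 1) / ln 2"
    using assms(1) sum_pmf_eq_1[of "set_pmf p" p]
    by (simp add: E_eq_sum sum_divide_distrib[symmetric] right_diff_distrib sum_subtractf
        pmf_positive[THEN less_imp_neq, THEN not_sym])
  also have "\<dots> \<le> 0"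
    using assms(3) by (simp add: divide_nonpos_pos)
  finally show ?thesis by simp
qed

lemma gibbs_pmf:
  assumes "fin p" "set_pmf p \<subseteq> set_pmf q"
  shows "H p \<le> E p (\<lambda>x. - log 2 (pmf q x))"
proof (rule gibbs)
  show "(\<Sum>x\<in>set_pmf p. pmf q x) \<le> 1"
    using assms by (simp add: measure_measure_pmf_finite[symmetric])
qed (use assms in \<open>auto simp: pmf_positive\<close>)

text \<open>Gibbs' inequality for each component with the mixture as the guess; the averaged
  right-hand sides give the entropy of the mixture.\<close>

lemma H_concave:
  assumes "fin p" "\<And>x. x \<in> set_pmf p \<Longrightarrow> fin (K x)"
  shows "E p (\<lambda>x. H (K x)) \<le> H (p \<bind> K)"
proof -
  have "E p (\<lambda>x. H (K x)) \<le> E p (\<lambda>x. E (K x) (\<lambda>y. - log 2 (pmf (p \<bind> K) y)))"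
    using assms by (intro E_mono gibbs_pmf) auto
  then show ?thesis
    unfolding H_def[of "p \<bind> K"] using assms by (simp add: E_bind)
qed

text \<open>Gibbs' inequality with the product of the marginals as the guess.\<close>

lemma H_subadditive:
  assumes "fin q"
  shows "H q \<le> H (map_pmf fst q) + H (map_pmf snd q)"
proof -
  let ?r = "pair_pmf (map_pmf fst q) (map_pmf snd q)"
  have "H q \<le> E q (\<lambda>z. - log 2 (pmf ?r z))"
    using assms by (intro gibbs_pmf) (force+)
  also have "\<dots> = E q (\<lambda>z. - log 2 (pmf (map_pmf fst q) (fst z)) + - log 2 (pmf (map_pmf snd q) (snd z)))"
  proof (rule E_cong)
    fix z assume z: "z \<in> set_pmf q"
    have "pmf ?r z = pmf (map_pmf fst q) (fst z) * pmf (map_pmf snd q) (snd z)"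
      by (cases z) (simp add: pmf_pair)
    moreover have "0 < pmf (map_pmf fst q) (fst z)" "0 < pmf (map_pmf snd q) (snd z)"
      using z by (auto intro!: pmf_positive)
    ultimately show "- log 2 (pmf ?r z) = - log 2 (pmf (map_pmf fst q) (fst z)) + - log 2 (pmf (map_pmf snd q) (snd z))"
      by (simp add: log_mult_pos)
  qed
  also have "\<dots> = H (map_pmf fst q) + H (map_pmf snd q)"
    unfolding H_def using assms by (subst E_add) auto
  finally show ?thesis .
qed

text \<open>
  Gibbs' inequality for the guess that puts weight $1/2$ on the decoded message and spreads the
  other half uniformly over all messages.
\<close>

lemma fano:
  fixes d :: "'b \<Rightarrow> 'a"
  assumes "finite M" "M \<noteq> {}" and fin: "\<And>m. m \<in> M \<Longrightarrow> fin (Q m)"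
  defines "\<epsilon> \<equiv> E (pmf_of_set M) (\<lambda>m. measure_pmf.prob (Q m) {y. d y \<noteq> m})"
  shows "(1 - \<epsilon>) * log 2 (card M) - 1
     \<le> H (pmf_of_set M \<bind> Q) - E (pmf_of_set M) (\<lambda>m. H (Q m))"
proof -
  define U where "U = pmf_of_set M"
  define r :: "'a \<Rightarrow> 'b \<Rightarrow> real" where "r = (\<lambda>m y. if d y = m then 1 / 2 else 1 / (2 * card M))"
  define N where "N = card M"
  have N: "N > 0" using assms by (simp add: N_def card_gt_0_iff)
  have [simp]: "set_pmf U = M" "fin U" using assms by (auto simp: U_def)
  have rpos: "r m y > 0" for m y using N by (simp add: r_def N_def)
  let ?q = "U \<bind> Q"
  have finq: "fin ?q" using fin assms(1) by simp
  have finj: "fin (joint U Q)" by (rule fin_joint) (simp_all add: fin assms(1))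
  have "H (joint U Q) \<le> E (joint U Q) (\<lambda>(m, y). - log 2 (pmf ?q y * r m y))"
  proof -
    have "H (joint U Q) \<le> E (joint U Q) (\<lambda>z. - log 2 (case z of (m, y) \<Rightarrow> pmf ?q y * r m y))"
    proof (rule gibbs)
      \<comment> \<open>Enlarging the support to a full rectangle lets the sum over messages be done
        first for each fixed output.\<close>
      have "(\<Sum>z\<in>set_pmf (joint U Q). case z of (m, y) \<Rightarrow> pmf ?q y * r m y) \<le>
          (\<Sum>z\<in>M \<times> set_pmf ?q. case z of (m, y) \<Rightarrow> pmf ?q y * r m y)"
        using finq assms(1) rpos by (intro sum_mono2) (auto simp: set_joint less_imp_le)
      also have "\<dots> = (\<Sum>y\<in>set_pmf ?q. pmf ?q y * (\<Sum>m\<in>M. r m y))"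
        by (simp add: sum.cartesian_product[symmetric] sum_distrib_left sum.swap[of _ M])
      also have "\<dots> \<le> (\<Sum>y\<in>set_pmf ?q. pmf ?q y * 1)"
      proof (intro sum_mono mult_left_mono)
        fix y
        \<comment> \<open>The decoded value \<open>d y\<close> may lie outside \<open>M\<close>, so
          its weight 1/2 is only an upper bound.\<close>
        have "(\<Sum>m\<in>M. r m y) \<le> (\<Sum>m\<in>M. (if m = d y then 1 / 2 else 0) + 1 / (2 * card M))"
          by (intro sum_mono) (auto simp: r_def)
        also have "\<dots> \<le> 1 / 2 + 1 / 2"
          unfolding sum.distrib using assms(1) N by (intro add_mono) (auto simp: N_def sum.delta')
        finally show "(\<Sum>m\<in>M. r m y) \<le> 1" by simp
      qed auto
      also have "\<dots> = 1" using finq by (simp add: sum_pmf_eq_1)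
      finally show "(\<Sum>z\<in>set_pmf (joint U Q). case z of (m, y) \<Rightarrow> pmf ?q y * r m y) \<le> 1" .
    next
      fix z assume "z \<in> set_pmf (joint U Q)"
      then show "0 < (case z of (m, y) \<Rightarrow> pmf ?q y * r m y)"
        using rpos by (auto simp: set_joint split: prod.splits intro!: mult_pos_pos pmf_positive)
    qed (rule finj)
    then show ?thesis by (simp add: case_prod_unfold)
  qed
  also have "\<dots> = E U (\<lambda>m. E (Q m) (\<lambda>y. - log 2 (pmf ?q y * r m y)))"
    using fin assms(1) by (subst E_joint) auto
  also have "\<dots> = E U (\<lambda>m. E (Q m) (\<lambda>y. - log 2 (pmf ?q y) + (1 + indicator {y. d y \<noteq> m} y * log 2 N)))"
  proof (intro E_cong)
    fix m y assume "m \<in> set_pmf U" "y \<in> set_pmf (Q m)"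
    then have "0 < pmf ?q y" by (intro pmf_positive) auto
    then have "- log 2 (pmf ?q y * r m y) = - log 2 (pmf ?q y) + - log 2 (r m y)"
      using rpos[of m y] by (simp add: log_mult_pos)
    \<comment> \<open>A correct guess costs one bit and a wrong one 1 + log N bits. The constant 1
      thus takes the place of the binary entropy of \<epsilon> in the usual form of the
      inequality.\<close>
    moreover have "- log 2 (r m y) = 1 + indicator {y. d y \<noteq> m} y * log 2 N"
      using N by (simp add: r_def N_def log_divide_pos log_mult_pos)
    ultimately show "- log 2 (pmf ?q y * r m y) = - log 2 (pmf ?q y) + (1 + indicator {y. d y \<noteq> m} y * log 2 N)"
      by simp
  qed
  also have "\<dots> = E U (\<lambda>m. E (Q m) (\<lambda>y. - log 2 (pmf ?q y)) + (1 + measure_pmf.prob (Q m) {y. d y \<noteq> m} * log 2 N))"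
    using fin assms(1) by (intro E_cong) (simp add: E_add E_diff)
  also have "\<dots> = H ?q + (1 + \<epsilon> * log 2 N)"
  proof -
    have "H ?q = E U (\<lambda>m. E (Q m) (\<lambda>y. - log 2 (pmf ?q y)))"
      unfolding H_def[of ?q] using fin assms(1) by (subst E_bind) auto
    then show ?thesis
      using assms(1) by (subst E_add, simp, subst E_add, simp) (simp add: \<epsilon>_def U_def)
  qed
  finally have "H (joint U Q) \<le> H ?q + (1 + \<epsilon> * log 2 N)" .
  moreover have "H (joint U Q) = log 2 N + E U (\<lambda>m. H (Q m))"
  proof -
    have "H U = E U (\<lambda>_. log 2 N)"
      unfolding H_def using N assms by (intro E_cong) (simp add: U_def N_def log_divide_pos)
    then show ?thesis using fin assms(1) by (subst H_joint) simp_all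
  qed
  ultimately show ?thesis by (simp add: U_def N_def algebra_simps)
qed

section \<open>Memoryless channels and product laws\<close>

lemma dmc_Cons: "dmc K (x # xs) = K x \<bind> (\<lambda>y. map_pmf (Cons y) (dmc K xs))"
  by (simp add: pair_pmf_def map_pmf_def bind_assoc_pmf bind_return_pmf)

declare dmc.simps(2) [simp del]

lemma length_dmc: "ys \<in> set_pmf (dmc K xs) \<Longrightarrow> length ys = length xs"
  by (induction xs arbitrary: ys) (auto simp: dmc_Cons)

lemma fin_dmc: "(\<And>x. x \<in> set xs \<Longrightarrow> fin (K x)) \<Longrightarrow> fin (dmc K xs)"
  by (induction xs) (auto simp: dmc_Cons)

lemma dmc_map: "dmc K (map f xs) = dmc (\<lambda>x. K (f x)) xs"
  by (induction xs) (simp_all add: dmc_Cons)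

text \<open>Given \<open>us\<close> the letters \<open>ys\<close> are independent, so drawing the
  first output of \<open>L\<close> commutes with drawing the remaining letters. The word
  \<open>xs\<close> is side information that stays fixed: a word of the other transmitter, or a
  codeword under test.\<close>

lemma dmc_bind_zip:
  "length us = length xs \<Longrightarrow>
     dmc K us \<bind> (\<lambda>ys. dmc L (zip ys xs)) = dmc (\<lambda>(u, x). K u \<bind> (\<lambda>y. L (y, x))) (zip us xs)"
proof (induction us xs rule: list_induct2)
  case (Cons u us x xs)
  have "dmc K (u # us) \<bind> (\<lambda>ys. dmc L (zip ys (x # xs))) =
     K u \<bind> (\<lambda>y. dmc K us \<bind> (\<lambda>ys. L (y, x) \<bind> (\<lambda>z. map_pmf (Cons z) (dmc L (zip ys xs)))))"
    by (simp add: dmc_Cons bind_assoc_pmf bind_map_pmf)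
  also have "\<dots> = K u \<bind> (\<lambda>y. L (y, x) \<bind> (\<lambda>z. map_pmf (Cons z) (dmc K us \<bind> (\<lambda>ys. dmc L (zip ys xs)))))"
    by (subst bind_commute_pmf) (simp add: map_bind_pmf)
  finally show ?case
    by (simp add: Cons.IH dmc_Cons bind_assoc_pmf)
qed (simp add: bind_return_pmf)

lemma dmc_bind: "dmc K us \<bind> dmc L = dmc (\<lambda>u. K u \<bind> L) us"
proof -
  have "dmc K us \<bind> (\<lambda>ys. dmc L ys) = dmc K us \<bind> (\<lambda>ys. dmc (\<lambda>(y, x). L y) (zip ys us))"
    by (intro bind_pmf_cong refl)
       (simp add: length_dmc dmc_map[of L fst, symmetric] case_prod_unfold)
  also have "\<dots> = dmc (\<lambda>u. K u \<bind> L) us"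
    by (subst dmc_bind_zip) (simp_all add: dmc_map[of "\<lambda>u. K u \<bind> L" fst, symmetric] case_prod_unfold)
  finally show ?thesis .
qed

text \<open>Input word and output word read letter by letter again come from a memoryless channel.
  This turns statements about pairs of words into statements about independent letters.\<close>

lemma map_zip_jp_dmc: "map_pmf (\<lambda>(ys, zs). zip ys zs) (joint (dmc K us) (dmc L)) = dmc (\<lambda>u. joint (K u) L) us"
proof (induction us)
  case (Cons u us)
  have "map_pmf (\<lambda>(ys, zs). zip ys zs) (joint (dmc K (u # us)) (dmc L)) =
     K u \<bind> (\<lambda>y. dmc K us \<bind> (\<lambda>ys. L y \<bind> (\<lambda>z. map_pmf (\<lambda>zs. (y, z) # zip ys zs) (dmc L ys))))"
    by (simp add: joint_def dmc_Cons map_bind_pmf bind_assoc_pmf bind_map_pmf map_pmf_comp)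
  also have "\<dots> = K u \<bind> (\<lambda>y. L y \<bind> (\<lambda>z. map_pmf (Cons (y, z)) (map_pmf (\<lambda>(ys, zs). zip ys zs) (joint (dmc K us) (dmc L)))))"
    by (subst bind_commute_pmf) (simp add: map_bind_pmf joint_def map_pmf_comp)
  finally show ?case
    unfolding Cons.IH by (simp add: dmc_Cons joint_def bind_assoc_pmf bind_map_pmf)
qed (simp add: joint_def bind_return_pmf)

lemma E_sum_dmc:
  assumes "\<And>x. x \<in> set xs \<Longrightarrow> fin (K x)"
  shows "E (dmc K xs) (\<lambda>ys. \<Sum>y\<leftarrow>ys. f y) = (\<Sum>x\<leftarrow>xs. E (K x) f)"
  using assms by (induction xs) (simp_all add: dmc_Cons E_bind fin_dmc E_add)

lemma H_dmc:
  assumes "\<And>x. x \<in> set xs \<Longrightarrow> fin (K x)"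
  shows "H (dmc K xs) = (\<Sum>x\<leftarrow>xs. H (K x))"
  using assms
proof (induction xs)
  case (Cons x xs)
  have "dmc K (x # xs) = map_pmf (\<lambda>(y, ys). y # ys) (joint (K x) (\<lambda>_. dmc K xs))"
    by (simp add: dmc_Cons joint_def map_bind_pmf map_pmf_comp)
  moreover have "H (map_pmf (\<lambda>(y, ys). y # ys) (joint (K x) (\<lambda>_. dmc K xs))) = H (joint (K x) (\<lambda>_. dmc K xs))"
    by (rule H_map_inj) (auto simp: inj_on_def)
  ultimately show ?case using Cons by (simp add: H_joint fin_dmc)
qed simp

lemma map_nth_dmc: "i < length xs \<Longrightarrow> map_pmf (\<lambda>ys. ys ! i) (dmc K xs) = K (xs ! i)"
proof (induction xs arbitrary: i)
  case (Cons x xs)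
  then show ?case
    by (cases i) (simp_all add: dmc_Cons map_bind_pmf map_pmf_comp bind_return_pmf')
qed simp

lemma H_list_subadditive:
  assumes "fin p" "set_pmf p \<subseteq> {ys. length ys = n}"
  shows "H p \<le> (\<Sum>i<n. H (map_pmf (\<lambda>ys. ys ! i) p))"
  using assms
proof (induction n arbitrary: p)
  case 0
  then have "set_pmf p \<subseteq> {[]}" by auto
  then have "p = return_pmf []" by (simp add: set_pmf_subset_singleton)
  then show ?case by simp
next
  case (Suc n)
  let ?q = "map_pmf (\<lambda>ys. (hd ys, tl ys)) p"
  have ne: "length ys = Suc n" if "ys \<in> set_pmf p" for ys using Suc.prems that by auto
  have "H p = H ?q"
    by (intro H_map_inj[symmetric] inj_onI) (metis Pair_inject ne list.expand list.size(3) nat.distinct(1))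
  also have "\<dots> \<le> H (map_pmf hd p) + H (map_pmf tl p)"
    using H_subadditive[of ?q] Suc.prems by (simp add: map_pmf_comp)
  also have "map_pmf hd p = map_pmf (\<lambda>ys. ys ! 0) p"
    using ne by (intro map_pmf_cong refl hd_conv_nth) fastforce
  also have "H (map_pmf tl p) \<le> (\<Sum>i<n. H (map_pmf (\<lambda>ys. ys ! i) (map_pmf tl p)))"
    using Suc.prems ne by (intro Suc.IH) auto
  also have "\<dots> = (\<Sum>i<n. H (map_pmf (\<lambda>ys. ys ! Suc i) p))"
    unfolding map_pmf_comp using ne
    by (intro sum.cong refl arg_cong[where f=H] map_pmf_cong) (auto simp: nth_tl)
  finally show ?case
    by (simp add: sum.lessThan_Suc_shift del: sum.lessThan_Suc)
qed

section \<open>Single-letterization\<close>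

definition pvec :: "'x::finite pmf \<Rightarrow> real ^ 'x" where
  "pvec q = (\<chi> x. pmf q x)"

text \<open>The input law is kept as a coordinate because H(Y1), H(Y1|X1) and H(Y2|X2) are functions
  of the mean input law alone; only H(Y1|W) and H(Y2|W,X2) feel the mixture.\<close>

definition ent_point ::
  "('x::finite \<Rightarrow> 'y::finite pmf) \<Rightarrow> ('x \<Rightarrow> 'z::finite pmf) \<Rightarrow> 'x pmf \<Rightarrow> (real ^ 'x) \<times> real \<times> real" where
  "ent_point K L q = (pvec q, H (q \<bind> K), H (q \<bind> L))"

definition ent_hull ::
  "('x::finite \<Rightarrow> 'y::finite pmf) \<Rightarrow> ('x \<Rightarrow> 'z::finite pmf) \<Rightarrow> ((real ^ 'x) \<times> real \<times> real) set" where
  "ent_hull K L = convex hull (range (ent_point K L))"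

lemma ent_point_in_hull: "ent_point K L q \<in> ent_hull K L"
  unfolding ent_hull_def by (intro hull_inc) simp

lemma mixture_in_hull:
  assumes "fin p" "\<And>u. u \<in> set_pmf p \<Longrightarrow> z u \<in> ent_hull K L"
  shows "(\<Sum>u\<in>set_pmf p. pmf p u *\<^sub>R z u) \<in> ent_hull K L"
  using assms unfolding ent_hull_def
  by (intro convex_sum) (auto simp: sum_pmf_eq_1)

text \<open>
  With \<open>Y\<close> and \<open>Z\<close> the outputs of \<open>K\<close> and \<open>L\<close>, the first input letter gets the auxiliary variable
  \<open>Z\<^sub>2\<dots>Z\<^sub>n\<close>, whereas the induction hypothesis is applied conditionally on \<open>Y\<^sub>1\<close>.  The same
  mutual information $I(Y_1; Z_2 \dots Z_n)$ is lost in both entropies, because the entropy of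
  $(Y_1, Z_2, \dots, Z_n)$ can be expanded in either order.
\<close>

lemma single_letter_pair:
  fixes K :: "'x::finite \<Rightarrow> 'y::finite pmf" and L :: "'x \<Rightarrow> 'z::finite pmf"
  assumes "fin p" "set_pmf p \<subseteq> {xs. length xs = n}"
  shows "\<exists>g\<ge>0. \<exists>z\<in>ent_hull K L. real n *\<^sub>R z =
    ((\<chi> x. E p (\<lambda>xs. real (count_list xs x))), H (p \<bind> dmc K) - g, H (p \<bind> dmc L) - g)"
  using assms
proof (induction n arbitrary: p)
  case 0
  then have "set_pmf p \<subseteq> {[]}" by auto
  then have "p = return_pmf []" by (simp add: set_pmf_subset_singleton)
  then show ?case
    \<comment> \<open>The factor n = 0 makes any point of the hull a witness.\<close>
    by (intro exI[of _ 0] conjI bexI[OF _ ent_point_in_hull[of K L "return_pmf undefined"]])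
      (auto simp: bind_return_pmf zero_prod_def vec_eq_iff)
next
  case (Suc n)
  define J where "J = map_pmf (\<lambda>xs. (hd xs, tl xs)) p"
  have ne: "length xs = Suc n" if "xs \<in> set_pmf p" for xs using Suc.prems that by auto
  have p: "p = map_pmf (\<lambda>(x, xs). x # xs) J"
    unfolding J_def map_pmf_comp using ne
    by (subst map_pmf_idI) (simp_all, fastforce simp: length_Suc_conv)
  have finJ: "fin J" using Suc.prems by (simp add: J_def)
  have lenJ: "length xs = n" if "(x, xs) \<in> set_pmf J" for x xs
    using that ne by (auto simp: J_def)
  \<comment> \<open>\<open>L1\<close> is the law of (Y_1, X_2 ... X_n) and \<open>L2\<close> that of
    (Z_2 ... Z_n, X_1). Hence \<open>\<rho> y\<close> is the law of the remaining inputs given Y_1 =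
    y, and \<open>\<sigma> t\<close> the law of the first input given Z_2 ... Z_n = t.\<close>
  define L1 where "L1 = J \<bind> (\<lambda>(x, xs). map_pmf (\<lambda>y. (y, xs)) (K x))"
  define L2 where "L2 = J \<bind> (\<lambda>(x, xs). map_pmf (\<lambda>t. (t, x)) (dmc L xs))"
  define \<pi>1 where "\<pi>1 = map_pmf fst L1"
  define \<pi>2 where "\<pi>2 = map_pmf fst L2"
  obtain \<rho> where \<rho>: "L1 = joint \<pi>1 \<rho>" "\<And>y. y \<in> set_pmf \<pi>1 \<Longrightarrow> set_pmf (\<rho> y) \<subseteq> snd ` set_pmf L1"
    using ex_disintegration[of L1] unfolding \<pi>1_def by blast
  obtain \<sigma> where \<sigma>: "L2 = joint \<pi>2 \<sigma>"
    using ex_disintegration[of L2] unfolding \<pi>2_def by blast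
  have finL: "fin L1" "fin L2"
    using finJ by (auto simp: L1_def L2_def fin_dmc)
  then have fin\<pi>: "fin \<pi>2" by (simp add: \<pi>2_def)
  have fin\<rho>: "fin (\<rho> y)" if "y \<in> set_pmf \<pi>1" for y
    using \<rho>(2)[OF that] finL by (meson finite_imageI finite_subset)
  have len\<rho>: "set_pmf (\<rho> y) \<subseteq> {xs. length xs = n}" if "y \<in> set_pmf \<pi>1" for y
  proof -
    have "snd ` set_pmf L1 \<subseteq> {xs. length xs = n}" using lenJ by (auto simp: L1_def)
    then show ?thesis using \<rho>(2)[OF that] by blast
  qed
  have fin_out: "fin (\<rho> y \<bind> dmc K)" "fin (\<rho> y \<bind> dmc L)" if "y \<in> set_pmf \<pi>1" for y
    using fin\<rho>[OF that] by (simp_all add: fin_dmc)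

  have outK: "p \<bind> dmc K = map_pmf (\<lambda>(y, ys). y # ys) (joint \<pi>1 (\<lambda>y. \<rho> y \<bind> dmc K))"
  proof -
    have "p \<bind> dmc K = L1 \<bind> (\<lambda>(y, xs). map_pmf (Cons y) (dmc K xs))"
      by (simp add: p L1_def bind_map_pmf bind_assoc_pmf case_prod_unfold dmc_Cons)
    also have "\<dots> = map_pmf (\<lambda>(y, ys). y # ys) (joint \<pi>1 (\<lambda>y. \<rho> y \<bind> dmc K))"
      unfolding \<rho>(1) by (simp add: joint_def bind_map_pmf bind_assoc_pmf map_bind_pmf map_pmf_comp)
    finally show ?thesis .
  qed
  have outL: "p \<bind> dmc L = map_pmf (\<lambda>(t, y). y # t) (joint \<pi>2 (\<lambda>t. \<sigma> t \<bind> L))"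
  proof -
    have "p \<bind> dmc L = J \<bind> (\<lambda>(x, xs). L x \<bind> (\<lambda>y. dmc L xs \<bind> (\<lambda>ys. return_pmf (y # ys))))"
      by (simp add: p bind_map_pmf case_prod_unfold dmc_Cons) (simp add: map_pmf_def)
    also have "\<dots> = L2 \<bind> (\<lambda>(t, x). map_pmf (\<lambda>y. y # t) (L x))"
      by (subst bind_commute_pmf) (simp add: L2_def bind_map_pmf bind_assoc_pmf bind_return_pmf case_prod_unfold map_pmf_def)
    also have "\<dots> = map_pmf (\<lambda>(t, y). y # t) (joint \<pi>2 (\<lambda>t. \<sigma> t \<bind> L))"
      unfolding \<sigma> by (simp add: joint_def bind_map_pmf bind_assoc_pmf map_bind_pmf map_pmf_comp)
    finally show ?thesis .
  qed
  \<comment> \<open>Y_1 and Z_2 ... Z_n come from different channel uses, so their joint law is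
    determined although nothing fixes how the two outputs of one use depend on each other.\<close>
  have mixed: "map_pmf prod.swap (joint \<pi>1 (\<lambda>y. \<rho> y \<bind> dmc L)) = joint \<pi>2 (\<lambda>t. \<sigma> t \<bind> K)"
  proof -
    have "map_pmf prod.swap (joint \<pi>1 (\<lambda>y. \<rho> y \<bind> dmc L)) = L1 \<bind> (\<lambda>(y, xs). map_pmf (\<lambda>t. (t, y)) (dmc L xs))"
      unfolding \<rho>(1) by (simp add: joint_def bind_map_pmf bind_assoc_pmf map_bind_pmf map_pmf_comp)
    also have "\<dots> = J \<bind> (\<lambda>(x, xs). K x \<bind> (\<lambda>y. dmc L xs \<bind> (\<lambda>t. return_pmf (t, y))))"
      by (simp add: L1_def bind_map_pmf bind_assoc_pmf bind_return_pmf case_prod_unfold map_pmf_def)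
    also have "\<dots> = L2 \<bind> (\<lambda>(t, x). map_pmf (Pair t) (K x))"
      by (subst bind_commute_pmf) (simp add: L2_def bind_map_pmf bind_assoc_pmf bind_return_pmf case_prod_unfold map_pmf_def)
    also have "\<dots> = joint \<pi>2 (\<lambda>t. \<sigma> t \<bind> K)"
      unfolding \<sigma> by (simp add: joint_def bind_map_pmf bind_assoc_pmf map_bind_pmf map_pmf_comp)
    finally show ?thesis .
  qed
  have \<pi>1: "\<pi>1 = \<pi>2 \<bind> (\<lambda>t. \<sigma> t \<bind> K)"
    using arg_cong[OF mixed, of "map_pmf snd"] by (simp add: map_pmf_comp map_fst_joint map_snd_joint)

  have HK: "H (p \<bind> dmc K) = H \<pi>1 + E \<pi>1 (\<lambda>y. H (\<rho> y \<bind> dmc K))"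
    unfolding outK by (subst H_map_inj, force simp: inj_on_def, intro H_joint) (simp, rule fin_out(1))
  have HL: "H (p \<bind> dmc L) = H \<pi>2 + E \<pi>2 (\<lambda>t. H (\<sigma> t \<bind> L))"
    unfolding outL using fin\<pi> by (subst H_map_inj) (auto simp: inj_on_def H_joint)
  have HD: "H \<pi>1 + E \<pi>1 (\<lambda>y. H (\<rho> y \<bind> dmc L)) = H \<pi>2 + E \<pi>2 (\<lambda>t. H (\<sigma> t \<bind> K))"
  proof -
    have "H (map_pmf prod.swap (joint \<pi>1 (\<lambda>y. \<rho> y \<bind> dmc L))) = H (joint \<pi>1 (\<lambda>y. \<rho> y \<bind> dmc L))"
      by (rule H_map_inj) (auto simp: inj_on_def)
    then show ?thesis unfolding mixed using fin\<pi> fin_out(2) by (simp add: H_joint del: set_bind_pmf)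
  qed
  \<comment> \<open>This is I(Y_1; Z_2 ... Z_n), nonnegative by concavity because \<pi>1 is the
    mixture of the laws of Y_1 given t.\<close>
  define i where "i = H \<pi>1 - E \<pi>2 (\<lambda>t. H (\<sigma> t \<bind> K))"
  have "i \<ge> 0"
    unfolding i_def \<pi>1 using H_concave[OF fin\<pi>, of "\<lambda>t. \<sigma> t \<bind> K"] by simp

  have "\<forall>y\<in>set_pmf \<pi>1. \<exists>g z. g \<ge> 0 \<and> z \<in> ent_hull K L \<and> real n *\<^sub>R z =
    ((\<chi> x. E (\<rho> y) (\<lambda>xs. real (count_list xs x))), H (\<rho> y \<bind> dmc K) - g, H (\<rho> y \<bind> dmc L) - g)"
    using Suc.IH fin\<rho> len\<rho> by meson
  then obtain g z where g: "\<And>y. y \<in> set_pmf \<pi>1 \<Longrightarrow> g y \<ge> 0"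
    and z: "\<And>y. y \<in> set_pmf \<pi>1 \<Longrightarrow> z y \<in> ent_hull K L"
    and nz: "\<And>y. y \<in> set_pmf \<pi>1 \<Longrightarrow> real n *\<^sub>R z y =
    ((\<chi> x. E (\<rho> y) (\<lambda>xs. real (count_list xs x))), H (\<rho> y \<bind> dmc K) - g y, H (\<rho> y \<bind> dmc L) - g y)"
    by metis
  \<comment> \<open>\<open>z1\<close> averages the points of the induction hypothesis over Y_1;
    \<open>z2\<close> is the point of the first letter with auxiliary variable Z_2 ... Z_n. The
    weights in \<open>z'\<close> make (n+1) z' equal to n z1 + z2, and the accumulated slack is the
    mean of \<open>g\<close> plus \<open>i\<close>.\<close>
  define z1 where "z1 = (\<Sum>y\<in>set_pmf \<pi>1. pmf \<pi>1 y *\<^sub>R z y)"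
  define z2 where "z2 = (\<Sum>t\<in>set_pmf \<pi>2. pmf \<pi>2 t *\<^sub>R ent_point K L (\<sigma> t))"
  define z' where "z' = (real n / real (Suc n)) *\<^sub>R z1 + (1 / real (Suc n)) *\<^sub>R z2"
  have "z1 \<in> ent_hull K L" "z2 \<in> ent_hull K L"
    unfolding z1_def z2_def using z fin\<pi> by (auto intro!: mixture_in_hull ent_point_in_hull)
  then have z'_hull: "z' \<in> ent_hull K L"
    unfolding z'_def ent_hull_def by (intro convexD[OF convex_convex_hull]) (auto simp: field_simps)
  have z': "real (Suc n) *\<^sub>R z' = real n *\<^sub>R z1 + z2"
    by (simp add: z'_def scaleR_add_right del: of_nat_Suc)
  have nz1: "real n *\<^sub>R z1 = (\<Sum>y\<in>set_pmf \<pi>1. pmf \<pi>1 y *\<^sub>R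
      ((\<chi> x. E (\<rho> y) (\<lambda>xs. real (count_list xs x))), H (\<rho> y \<bind> dmc K) - g y, H (\<rho> y \<bind> dmc L) - g y))"
    unfolding z1_def scaleR_sum_right by (intro sum.cong refl) (simp add: nz[symmetric])
  have z1c: "fst (real n *\<^sub>R z1) $ x = E (map_pmf snd J) (\<lambda>xs. real (count_list xs x))" for x
  proof -
    have "fst (real n *\<^sub>R z1) $ x = E \<pi>1 (\<lambda>y. E (\<rho> y) (\<lambda>xs. real (count_list xs x)))"
      unfolding nz1 by (simp add: fst_sum sum_component E_eq_sum)
    also have "\<dots> = E (\<pi>1 \<bind> \<rho>) (\<lambda>xs. real (count_list xs x))"
      using fin\<rho> by (simp add: E_bind)
    also have "\<pi>1 \<bind> \<rho> = map_pmf snd L1" unfolding \<rho>(1) by (simp add: map_snd_joint)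
    also have "\<dots> = map_pmf snd J"
      by (simp add: L1_def map_bind_pmf map_pmf_comp case_prod_unfold) (simp add: map_pmf_def)
    finally show ?thesis .
  qed
  have z1a: "fst (snd (real n *\<^sub>R z1)) = E \<pi>1 (\<lambda>y. H (\<rho> y \<bind> dmc K)) - E \<pi>1 g"
    unfolding nz1 by (simp add: fst_sum snd_sum E_eq_sum sum_subtractf right_diff_distrib)
  have z1b: "snd (snd (real n *\<^sub>R z1)) = E \<pi>1 (\<lambda>y. H (\<rho> y \<bind> dmc L)) - E \<pi>1 g"
    unfolding nz1 by (simp add: fst_sum snd_sum E_eq_sum sum_subtractf right_diff_distrib)
  have z2c: "fst z2 $ x = pmf (map_pmf fst J) x" for x
  proof -
    have "fst z2 $ x = pmf (\<pi>2 \<bind> \<sigma>) x"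
      using fin\<pi> by (simp add: z2_def ent_point_def pvec_def fst_sum sum_component E_eq_sum pmf_bind)
    also have "\<pi>2 \<bind> \<sigma> = map_pmf snd L2" unfolding \<sigma> by (simp add: map_snd_joint)
    also have "\<dots> = map_pmf fst J"
      by (simp add: L2_def map_bind_pmf map_pmf_comp case_prod_unfold) (simp add: map_pmf_def)
    finally show ?thesis .
  qed
  have z2a: "fst (snd z2) = E \<pi>2 (\<lambda>t. H (\<sigma> t \<bind> K))"
    using fin\<pi> by (simp add: z2_def ent_point_def fst_sum snd_sum E_eq_sum)
  have z2b: "snd (snd z2) = E \<pi>2 (\<lambda>t. H (\<sigma> t \<bind> L))"
    using fin\<pi> by (simp add: z2_def ent_point_def fst_sum snd_sum E_eq_sum)
  have cnt: "E p (\<lambda>xs. real (count_list xs x)) =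
      E (map_pmf snd J) (\<lambda>xs. real (count_list xs x)) + pmf (map_pmf fst J) x" for x
  proof -
    have "E p (\<lambda>xs. real (count_list xs x)) =
        E J (\<lambda>z. real (count_list (snd z) x) + indicator (fst -` {x}) z)"
      unfolding p by (simp add: case_prod_unfold) (intro E_cong, auto)
    then show ?thesis using finJ by (simp add: E_add pmf_map)
  qed
  have "real (Suc n) *\<^sub>R z' = ((\<chi> x. E p (\<lambda>xs. real (count_list xs x))),
      H (p \<bind> dmc K) - (E \<pi>1 g + i), H (p \<bind> dmc L) - (E \<pi>1 g + i))"
    unfolding z'
  proof (intro prod_eqI)
    show "fst (real n *\<^sub>R z1 + z2) = fst ((\<chi> x. E p (\<lambda>xs. real (count_list xs x))),
      H (p \<bind> dmc K) - (E \<pi>1 g + i), H (p \<bind> dmc L) - (E \<pi>1 g + i))"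
      unfolding vec_eq_iff fst_add vector_add_component z1c z2c by (simp add: cnt)
  next
    show "fst (snd (real n *\<^sub>R z1 + z2)) = fst (snd ((\<chi> x. E p (\<lambda>xs. real (count_list xs x))),
      H (p \<bind> dmc K) - (E \<pi>1 g + i), H (p \<bind> dmc L) - (E \<pi>1 g + i)))"
      unfolding fst_add snd_add z1a z2a by (simp add: HK i_def)
  next
    show "snd (snd (real n *\<^sub>R z1 + z2)) = snd (snd ((\<chi> x. E p (\<lambda>xs. real (count_list xs x))),
      H (p \<bind> dmc K) - (E \<pi>1 g + i), H (p \<bind> dmc L) - (E \<pi>1 g + i)))"
      unfolding snd_add z1b z2b using HD by (simp add: HL i_def)
  qed
  moreover have "E \<pi>1 g + i \<ge> 0"
    using g \<open>i \<ge> 0\<close> by (intro add_nonneg_nonneg integral_nonneg_AE) (auto simp: AE_measure_pmf_iff)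
  ultimately show ?case using z'_hull by blast
qed

section \<open>The single-letter region is closed\<close>

text \<open>Stated on the whole line so that composition with linear forms of a vector carries no
  sign condition. With ln (-t) = ln t the function is odd, so the limit at 0 from the left follows
  from the one from the right.\<close>

lemma continuous_xlogx: "continuous_on UNIV (\<lambda>t::real. t * log 2 t)"
proof -
  have "isCont (\<lambda>t::real. t * ln t) t" for t
  proof (cases "t = 0")
    case True
    have right: "((\<lambda>t::real. t * ln t) \<longlongrightarrow> 0) (at_right 0)"
      by real_asymp
    then have "((\<lambda>t::real. - (t * ln t)) \<longlongrightarrow> - 0) (at_right 0)"
      by (rule tendsto_minus)
    then have "((\<lambda>t::real. t * ln t) \<longlongrightarrow> 0) (at_left 0)"
      by (simp add: filterlim_at_left_to_right[of _ _ 0] ln_minus)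
    with right have "((\<lambda>t::real. t * ln t) \<longlongrightarrow> 0) (at 0)"
      by (simp add: filterlim_split_at)
    with True show ?thesis by (simp add: isCont_def)
  qed (intro continuous_intros; simp)
  then have "isCont (\<lambda>t::real. t * ln t / ln 2) t" for t
    by (intro isCont_divide) auto
  then show ?thesis
    by (simp add: log_def continuous_on_eq_continuous_at)
qed

text \<open>The output entropy as a function of an arbitrary vector, not only of a probability
  vector: closed sets can then be described in the whole space.\<close>

definition out_ent :: "('x::finite \<Rightarrow> 'y::finite pmf) \<Rightarrow> real ^ 'x \<Rightarrow> real" where
  "out_ent K v = - (\<Sum>y\<in>UNIV. (\<Sum>x\<in>UNIV. v $ x * pmf (K x) y) * log 2 (\<Sum>x\<in>UNIV. v $ x * pmf (K x) y))"

definition noise_ent :: "('x::finite \<Rightarrow> 'y::finite pmf) \<Rightarrow> real ^ 'x \<Rightarrow> real" where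
  "noise_ent K v = (\<Sum>x\<in>UNIV. v $ x * H (K x))"

lemma E_finite_type: "E (q :: 'x::finite pmf) f = (\<Sum>x\<in>UNIV. pmf q x * f x)"
  by (subst integral_measure_pmf[of UNIV]) auto

lemma H_finite_type: "H (q :: 'x::finite pmf) = - (\<Sum>x\<in>UNIV. pmf q x * log 2 (pmf q x))"
  by (simp add: H_def E_finite_type sum_negf)

lemma out_ent_pvec: "out_ent K (pvec q) = H (q \<bind> K)"
  by (simp add: out_ent_def H_finite_type pmf_bind E_finite_type pvec_def)

lemma noise_ent_pvec: "noise_ent K (pvec q) = E q (\<lambda>x. H (K x))"
  by (simp add: noise_ent_def E_finite_type pvec_def)

lemma continuous_out_ent: "continuous_on S (out_ent K)"
proof -
  have "continuous_on S ((\<lambda>t. t * log 2 t) \<circ> (\<lambda>v. \<Sum>x\<in>UNIV. v $ x * pmf (K x) y))" for y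
    by (intro continuous_on_compose continuous_intros continuous_on_subset[OF continuous_xlogx]) auto
  then have "continuous_on S (\<lambda>v. - (\<Sum>y\<in>UNIV. ((\<lambda>t. t * log 2 t) \<circ> (\<lambda>v. \<Sum>x\<in>UNIV. v $ x * pmf (K x) y)) v))"
    by (intro continuous_on_minus continuous_on_sum)
  then show ?thesis by (simp add: out_ent_def[abs_def])
qed

lemma continuous_noise_ent: "continuous_on S (noise_ent K)"
  unfolding noise_ent_def[abs_def] by (intro continuous_intros)

lemma range_pvec: "range (pvec :: 'x::finite pmf \<Rightarrow> real ^ 'x) = {v. (\<forall>x. 0 \<le> v $ x) \<and> (\<Sum>x\<in>UNIV. v $ x) = 1}"
proof (intro equalityI subsetI)
  fix v :: "real ^ 'x" assume "v \<in> {v. (\<forall>x. 0 \<le> v $ x) \<and> (\<Sum>x\<in>UNIV. v $ x) = 1}"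
  then have v: "\<And>x. 0 \<le> v $ x" "(\<Sum>x\<in>UNIV. v $ x) = 1" by auto
  have "pmf (embed_pmf (\<lambda>x. v $ x)) x = v $ x" for x
  proof (rule pmf_embed_pmf)
    have "(\<Sum>x\<in>UNIV. ennreal (v $ x)) = ennreal (\<Sum>x\<in>UNIV. v $ x)"
      using v by (intro sum_ennreal) auto
    then show "(\<integral>\<^sup>+x. ennreal (v $ x) \<partial>count_space UNIV) = 1"
      using v by (simp add: nn_integral_count_space_finite)
  qed (use v in auto)
  then have "v = pvec (embed_pmf (\<lambda>x. v $ x))" by (simp add: pvec_def vec_eq_iff)
  then show "v \<in> range pvec" by blast
qed (auto simp: pvec_def sum_pmf_eq_1)

lemma compact_range_pvec: "compact (range (pvec :: 'x::finite pmf \<Rightarrow> real ^ 'x))"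
proof -
  have "closed {v :: real ^ 'x. (\<forall>x. 0 \<le> v $ x) \<and> (\<Sum>x\<in>UNIV. v $ x) = 1}"
    by (intro closed_Collect_conj closed_Collect_all closed_Collect_le closed_Collect_eq continuous_intros)
  moreover have "bounded (range (pvec :: 'x pmf \<Rightarrow> real ^ 'x))"
    unfolding bounded_iff
  proof (intro exI ballI)
    fix v :: "real ^ 'x" assume "v \<in> range pvec"
    then have v: "\<And>x. 0 \<le> v $ x" "(\<Sum>x\<in>UNIV. v $ x) = 1" unfolding range_pvec by auto
    have "norm v \<le> (\<Sum>x\<in>UNIV. \<bar>v $ x\<bar>)" by (rule norm_le_l1_cart)
    then show "norm v \<le> 1" using v by simp
  qed
  ultimately show ?thesis by (simp add: compact_eq_bounded_closed range_pvec)
qed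

text \<open>The generating points form the graph of a continuous map over the simplex, and convex
  hulls of compact sets are compact in finite dimension.\<close>

lemma compact_ent_hull: "compact (ent_hull K L)"
proof -
  have "range (ent_point K L) = (\<lambda>v. (v, out_ent K v, out_ent L v)) ` range pvec"
    by (auto simp: ent_point_def out_ent_pvec image_iff)
  moreover have "compact \<dots>"
    by (intro compact_continuous_image compact_range_pvec continuous_intros continuous_out_ent)
  ultimately show ?thesis
    unfolding ent_hull_def by (intro compact_convex_hull) simp
qed

text \<open>The four inequalities of the theorem, with v the law of X1, a = H(Y1|W) and b =
  H(Y2|W,X2). The conditional entropy H(Y1|X1) is \<open>noise_ent\<close>, linear in v.\<close>

definition feasible ::
  "('x::finite \<Rightarrow> 'y::finite pmf) \<Rightarrow> ('x \<Rightarrow> 'z::finite pmf) \<Rightarrow> real \<Rightarrow> real \<times> real \<times> real \<Rightarrow>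
   ((real ^ 'x) \<times> real \<times> real) \<Rightarrow> real \<Rightarrow> bool" where
  "feasible K L \<tau> = (\<lambda>(R1c, R1p, R2) (v, a, b) \<gamma>.
     R1p \<le> a - noise_ent K v + \<gamma> \<and>
     R1c + R1p \<le> out_ent K v - noise_ent K v \<and>
     R1c \<le> out_ent L v - b - \<gamma> \<and>
     R2 + R1c \<le> \<tau> - b - \<gamma>)"

text \<open>The signs of the rates are left free: the converse first places rates diminished by 3/n
  here, and these can be negative. Nonnegativity is intersected at the end.\<close>

definition region ::
  "('x::finite \<Rightarrow> 'y::finite pmf) \<Rightarrow> ('x \<Rightarrow> 'z::finite pmf) \<Rightarrow> real \<Rightarrow> (real \<times> real \<times> real) set" where
  "region K L \<tau> = {R. \<exists>z\<in>ent_hull K L. \<exists>\<gamma>\<ge>0. feasible K L \<tau> R z \<gamma>}"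

lemma closed_feasible: "closed {(R, z, \<gamma>). feasible K L \<tau> R z \<gamma>}"
proof -
  have cont: "continuous_on UNIV (\<lambda>w. out_ent M (fst (fst (snd w))))"
    "continuous_on UNIV (\<lambda>w. noise_ent M (fst (fst (snd w))))" for M :: "'x::finite \<Rightarrow> 'y::finite pmf"
    by (intro continuous_on_compose2[OF continuous_out_ent[of UNIV]]
        continuous_on_compose2[OF continuous_noise_ent[of UNIV]] continuous_intros; simp)+
  have eq: "{(R, z, \<gamma>). feasible K L \<tau> R z \<gamma>} = {w.
      fst (snd (fst w)) \<le> fst (snd (fst (snd w))) - noise_ent K (fst (fst (snd w))) + snd (snd w) \<and>
      fst (fst w) + fst (snd (fst w)) \<le> out_ent K (fst (fst (snd w))) - noise_ent K (fst (fst (snd w))) \<and>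
      fst (fst w) \<le> out_ent L (fst (fst (snd w))) - snd (snd (fst (snd w))) - snd (snd w) \<and>
      snd (snd (fst w)) + fst (fst w) \<le> \<tau> - snd (snd (fst (snd w))) - snd (snd w)}"
    by (auto simp: feasible_def)
  show ?thesis
    unfolding eq
    by (intro closed_Collect_conj closed_Collect_le continuous_intros cont
        continuous_on_compose2[OF continuous_out_ent[of UNIV]]
        continuous_on_compose2[OF continuous_noise_ent[of UNIV]]) auto
qed

lemma closed_region: "closed (region K L \<tau>)"
  unfolding closed_sequential_limits
proof (intro allI impI, elim conjE)
  fix R l assume R: "\<forall>k. R k \<in> region K L \<tau>" and l: "R \<longlonglongrightarrow> l"
  then obtain z \<gamma> where zg: "\<And>k. z k \<in> ent_hull K L" "\<And>k. \<gamma> k \<ge> 0" "\<And>k. feasible K L \<tau> (R k) (z k) (\<gamma> k)"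
    unfolding region_def mem_Collect_eq by metis
  obtain B1 where B1: "\<And>k. norm (R k) \<le> B1"
    using convergent_imp_bounded[OF l] by (auto simp: bounded_iff)
  obtain B2 where B2: "\<And>k. norm (z k) \<le> B2"
    using compact_imp_bounded[OF compact_ent_hull[of K L]] zg(1) by (auto simp: bounded_iff)
  \<comment> \<open>The hull is compact, so only \<gamma> could escape. Along a convergent sequence
    of rates the fourth inequality bounds it, since b is bounded on the hull.\<close>
  have "\<gamma> k \<in> {0..\<tau> + 2 * B1 + B2}" for k
  proof -
    have 1: "\<bar>fst (R k)\<bar> \<le> B1" "\<bar>snd (snd (R k))\<bar> \<le> B1"
      using norm_fst_le[of "fst (R k)" "snd (R k)"] norm_snd_le[of "snd (R k)" "fst (R k)"]
        norm_snd_le[of "snd (snd (R k))" "fst (snd (R k))"] B1[of k] by simp_all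
    have 2: "\<bar>snd (snd (z k))\<bar> \<le> B2"
      using norm_snd_le[of "snd (z k)" "fst (z k)"]
        norm_snd_le[of "snd (snd (z k))" "fst (snd (z k))"] B2[of k] by simp
    have "\<gamma> k \<le> \<tau> - snd (snd (z k)) - (snd (snd (R k)) + fst (R k))"
      using zg(3)[of k] by (auto simp: feasible_def split: prod.splits)
    with 1 2 zg(2)[of k] show ?thesis by auto
  qed
  then have mem: "\<forall>k. (z k, \<gamma> k) \<in> ent_hull K L \<times> {0..\<tau> + 2 * B1 + B2}"
    using zg(1) by auto
  have "seq_compact (ent_hull K L \<times> {0..\<tau> + 2 * B1 + B2})"
    by (intro compact_imp_seq_compact compact_Times compact_ent_hull compact_Icc)
  from this mem obtain w r where w: "w \<in> ent_hull K L \<times> {0..\<tau> + 2 * B1 + B2}"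
    and r: "strict_mono r" "((\<lambda>k. (z k, \<gamma> k)) \<circ> r) \<longlonglongrightarrow> w"
    by (rule seq_compactE)
  have "(\<lambda>k. (R (r k), (z (r k), \<gamma> (r k)))) \<longlonglongrightarrow> (l, w)"
    using tendsto_Pair[OF LIMSEQ_subseq_LIMSEQ[OF l r(1)] r(2)] by (simp add: o_def)
  then have "(l, w) \<in> {(R, z, \<gamma>). feasible K L \<tau> R z \<gamma>}"
    by (rule closed_sequentially[OF closed_feasible, rotated]) (simp add: zg(3))
  then show "l \<in> region K L \<tau>"
    using w unfolding region_def by (cases w) auto
qed

section \<open>Information measures as differences of entropies\<close>

context
  fixes P :: "'o pmf"
begin

interpretation information_space "measure_pmf P" 2
  by standard simp_all

lemma distributed_pmf: "distributed (measure_pmf P) (count_space UNIV) X (\<lambda>x. ennreal (pmf (map_pmf X P) x))"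
  unfolding distributed_def
  by (simp add: map_pmf_rep_eq[symmetric]) (rule measure_pmf_eq_density)

lemma ent_eq_H: "ent P X = H (map_pmf X P)"
  unfolding ent_def H_def
  by (subst entropy_distr[OF distributed_pmf]) (simp_all add: measure_pmf_eq_density integral_density)

lemma finite_entropy_pmf:
  assumes "fin (map_pmf X P)"
  shows "finite_entropy (count_space UNIV) X (pmf (map_pmf X P))"
  unfolding finite_entropy_def
proof (intro conjI ballI distributed_pmf)
  have "integrable (measure_pmf (map_pmf X P)) (\<lambda>x. log 2 (pmf (map_pmf X P) x))"
    using assms by (intro integrable_measure_pmf_finite)
  then show "integrable (count_space UNIV) (\<lambda>x. pmf (map_pmf X P) x * log 2 (pmf (map_pmf X P) x))"
    unfolding measure_pmf_eq_density[of "map_pmf X P"] by (subst (asm) integrable_density) simp_all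
qed simp_all

text \<open>Every subset of a countable product is a countable union of rectangles, so the product
  sigma-algebra is discrete. The types are countable rather than finite because W takes values in
  \<open>nat\<close>.\<close>

lemma pair_count_space_UNIV:
  "count_space (UNIV :: 'a::countable set) \<Otimes>\<^sub>M count_space (UNIV :: 'b::countable set) = count_space UNIV"
  by (subst pair_measure_countable) auto

lemma mut_info_eq_H:
  fixes X :: "'o \<Rightarrow> 'a::countable" and Y :: "'o \<Rightarrow> 'b::countable"
  assumes "fin (map_pmf (\<lambda>\<omega>. (X \<omega>, Y \<omega>)) P)"
  shows "mut_info P X Y = H (map_pmf X P) + H (map_pmf Y P) - H (map_pmf (\<lambda>\<omega>. (X \<omega>, Y \<omega>)) P)"
proof -
  let ?q = "map_pmf (\<lambda>\<omega>. (X \<omega>, Y \<omega>)) P"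
  have X: "map_pmf X P = map_pmf fst ?q" and Y: "map_pmf Y P = map_pmf snd ?q"
    by (simp_all add: map_pmf_comp)
  have fin: "fin (map_pmf X P)" "fin (map_pmf Y P)"
    unfolding X Y set_map_pmf[of _ ?q] using assms by blast+
  have "mut_info P X Y = (\<integral>x. pmf ?q x * log 2 (pmf ?q x / (pmf (map_pmf X P) (fst x) * pmf (map_pmf Y P) (snd x)))
      \<partial>count_space UNIV)"
    unfolding mut_info_def pair_count_space_UNIV[symmetric]
    using fin assms
    by (intro mutual_information_distr' finite_entropy_pmf sigma_finite_measure_count_space)
       (simp_all add: pair_count_space_UNIV finite_entropy_pmf)
  also have "\<dots> = E ?q (\<lambda>x. log 2 (pmf ?q x / (pmf (map_pmf X P) (fst x) * pmf (map_pmf Y P) (snd x))))"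
    by (simp add: measure_pmf_eq_density[of ?q] integral_density)
  also have "\<dots> = E ?q (\<lambda>x. - log 2 (pmf (map_pmf X P) (fst x)) + - log 2 (pmf (map_pmf Y P) (snd x)) - - log 2 (pmf ?q x))"
  proof (rule E_cong)
    fix z assume z: "z \<in> set_pmf ?q"
    have "0 < pmf (map_pmf X P) (fst z)" "0 < pmf (map_pmf Y P) (snd z)" "0 < pmf ?q z"
      using z unfolding X Y by (intro pmf_positive; force)+
    then show "log 2 (pmf ?q z / (pmf (map_pmf X P) (fst z) * pmf (map_pmf Y P) (snd z))) =
      - log 2 (pmf (map_pmf X P) (fst z)) + - log 2 (pmf (map_pmf Y P) (snd z)) - - log 2 (pmf ?q z)"
      by (simp add: log_divide_pos log_mult_pos)
  qed
  also have "\<dots> = E ?q (\<lambda>x. - log 2 (pmf (map_pmf X P) (fst x))) + E ?q (\<lambda>x. - log 2 (pmf (map_pmf Y P) (snd x))) - H ?q"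
    unfolding H_def[of ?q] using assms by (subst E_diff, simp, subst E_add, simp) simp
  also have "\<dots> = H (map_pmf X P) + H (map_pmf Y P) - H ?q"
    by (simp add: H_def[of "map_pmf X P"] H_def[of "map_pmf Y P"])
  finally show ?thesis .
qed

lemma cond_mut_info_eq_mut_info:
  fixes X :: "'o \<Rightarrow> 'a::countable" and Y :: "'o \<Rightarrow> 'b::countable" and Z :: "'o \<Rightarrow> 'c::countable"
  shows "cond_mut_info P X Y Z = mut_info P X (\<lambda>\<omega>. (Y \<omega>, Z \<omega>)) - mut_info P X Z"
  unfolding cond_mut_info_def mut_info_def prob_space.conditional_mutual_information_def[OF prob_space_measure_pmf] pair_count_space_UNIV ..

lemma cond_ent_eq_H:
  fixes X :: "'o \<Rightarrow> 'a::countable" and Y :: "'o \<Rightarrow> 'b::countable"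
  assumes "fin (map_pmf (\<lambda>\<omega>. (X \<omega>, Y \<omega>)) P)"
  shows "cond_ent P X Y = H (map_pmf (\<lambda>\<omega>. (X \<omega>, Y \<omega>)) P) - H (map_pmf Y P)"
proof -
  let ?q = "map_pmf (\<lambda>\<omega>. (X \<omega>, Y \<omega>)) P"
  have Y: "map_pmf Y P = map_pmf snd ?q"
    by (simp add: map_pmf_comp)
  have "cond_ent P X Y = - (\<integral>x. pmf ?q x * log 2 (pmf ?q x / pmf (map_pmf Y P) (snd x)) \<partial>count_space UNIV)"
    unfolding cond_ent_def
    by (subst conditional_entropy_generic_eq[where Pxy = "pmf ?q" and Py = "pmf (map_pmf Y P)"])
       (simp_all add: sigma_finite_measure_count_space distributed_pmf pair_count_space_UNIV case_prod_unfold)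
  also have "\<dots> = - E ?q (\<lambda>x. log 2 (pmf ?q x / pmf (map_pmf Y P) (snd x)))"
    by (simp add: measure_pmf_eq_density[of ?q] integral_density)
  also have "E ?q (\<lambda>x. log 2 (pmf ?q x / pmf (map_pmf Y P) (snd x))) =
      E ?q (\<lambda>x. - log 2 (pmf (map_pmf Y P) (snd x)) - - log 2 (pmf ?q x))"
  proof (rule E_cong)
    fix z assume z: "z \<in> set_pmf ?q"
    have "0 < pmf (map_pmf Y P) (snd z)" "0 < pmf ?q z"
      using z unfolding Y by (intro pmf_positive; force)+
    then show "log 2 (pmf ?q z / pmf (map_pmf Y P) (snd z)) =
      - log 2 (pmf (map_pmf Y P) (snd z)) - - log 2 (pmf ?q z)"
      by (simp add: log_divide_pos)
  qed
  also have "\<dots> = E ?q (\<lambda>x. - log 2 (pmf (map_pmf Y P) (snd x))) - H ?q"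
    unfolding H_def[of ?q] using assms by (subst E_diff) simp_all
  also have "\<dots> = H (map_pmf Y P) - H ?q"
    by (simp add: H_def[of "map_pmf Y P"])
  finally show ?thesis by simp
qed

end

section \<open>The single-letter expressions\<close>

text \<open>A convex combination of k points is an auxiliary variable on {1..k} with the weights as
  p(w), each point supplying p(x1|w). This is the passage between the geometric and the
  probabilistic description of the region.\<close>

lemma ent_hull_iff_mixture:
  "z \<in> ent_hull K L \<longleftrightarrow> (\<exists>(pW :: nat pmf) pX. fin pW \<and>
     z = (pvec (pW \<bind> pX), E pW (\<lambda>w. H (pX w \<bind> K)), E pW (\<lambda>w. H (pX w \<bind> L))))"
proof -
  have mix: "(\<Sum>w\<in>set_pmf pW. pmf pW w *\<^sub>R ent_point K L (pX w)) =
     (pvec (pW \<bind> pX), E pW (\<lambda>w. H (pX w \<bind> K)), E pW (\<lambda>w. H (pX w \<bind> L)))"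
    if "fin pW" for pW :: "nat pmf" and pX
    using that
    by (intro prod_eqI)
       (simp_all add: ent_point_def fst_sum snd_sum E_eq_sum vec_eq_iff pvec_def sum_component pmf_bind)
  show ?thesis
  proof
    assume "z \<in> ent_hull K L"
    then obtain k :: nat and u x where u: "\<And>i. i \<in> {1..k} \<Longrightarrow> 0 \<le> u i" "sum u {1..k} = 1"
      and x: "\<And>i. i \<in> {1..k} \<Longrightarrow> x i \<in> range (ent_point K L)" and z: "(\<Sum>i = 1..k. u i *\<^sub>R x i) = z"
      unfolding ent_hull_def convex_hull_indexed by blast
    \<comment> \<open>A law on all of \<open>nat\<close> is wanted, so the weights are continued by
      0.\<close>
    define f where "f i = (if i \<in> {1..k} then u i else 0)" for i
    define pW where "pW = embed_pmf f"
    have pW: "pmf pW i = f i" for i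
      unfolding pW_def
    proof (rule pmf_embed_pmf)
      have "(\<integral>\<^sup>+i. ennreal (f i) \<partial>count_space UNIV) = (\<Sum>i\<in>{1..k}. ennreal (f i))"
        by (rule nn_integral_count_space'[of "{1..k}"]) (auto simp: f_def)
      also have "\<dots> = ennreal (\<Sum>i\<in>{1..k}. f i)"
        using u by (intro sum_ennreal) (auto simp: f_def)
      also have "(\<Sum>i\<in>{1..k}. f i) = sum u {1..k}" by (intro sum.cong) (auto simp: f_def)
      finally show "(\<integral>\<^sup>+i. ennreal (f i) \<partial>count_space UNIV) = 1" using u(2) by simp
    qed (use u in \<open>auto simp: f_def\<close>)
    have set: "set_pmf pW \<subseteq> {1..k}"
      unfolding set_pmf_eq pW by (auto simp: f_def split: if_splits)
    then have fin: "fin pW" using finite_subset by blast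
    have "\<forall>i\<in>{1..k}. \<exists>q. x i = ent_point K L q" using x by blast
    then obtain pX where pX: "\<And>i. i \<in> {1..k} \<Longrightarrow> x i = ent_point K L (pX i)" by metis
    have "z = (\<Sum>i\<in>{1..k}. pmf pW i *\<^sub>R ent_point K L (pX i))"
      unfolding z[symmetric] by (intro sum.cong refl) (simp add: pW f_def pX)
    also have "\<dots> = (\<Sum>i\<in>set_pmf pW. pmf pW i *\<^sub>R ent_point K L (pX i))"
      using set by (intro sum.mono_neutral_right) (auto simp: set_pmf_iff)
    finally show "\<exists>(pW :: nat pmf) pX. fin pW \<and>
      z = (pvec (pW \<bind> pX), E pW (\<lambda>w. H (pX w \<bind> K)), E pW (\<lambda>w. H (pX w \<bind> L)))"
      unfolding mix[OF fin] using fin by blast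
  next
    assume "\<exists>(pW :: nat pmf) pX. fin pW \<and>
      z = (pvec (pW \<bind> pX), E pW (\<lambda>w. H (pX w \<bind> K)), E pW (\<lambda>w. H (pX w \<bind> L)))"
    then obtain pW :: "nat pmf" and pX where fin: "fin pW"
      and z: "z = (pvec (pW \<bind> pX), E pW (\<lambda>w. H (pX w \<bind> K)), E pW (\<lambda>w. H (pX w \<bind> L)))"
      by blast
    show "z \<in> ent_hull K L"
      unfolding z mix[OF fin, symmetric] using fin by (intro mixture_in_hull ent_point_in_hull)
  qed
qed

lemma fin_length: "set_pmf p \<subseteq> {xs :: 'a::finite list. length xs = n} \<Longrightarrow> fin p"
  using finite_subset[of "set_pmf p" "{xs. length xs = n}"] finite_lists_length_eq[of "UNIV :: 'a set" n]
  by simp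

lemma condition1_H:
  fixes p2 :: "'x1::finite \<Rightarrow> 'x2::finite \<Rightarrow> 'y2::finite pmf"
  assumes "condition1 p2" "n > 0" "set_pmf p \<subseteq> {xs. length xs = n}" "length vs = n" "length vs' = n"
  shows "H (p \<bind> (\<lambda>xs. dmc2 p2 xs vs)) = H (p \<bind> (\<lambda>xs. dmc2 p2 xs vs'))"
proof -
  have "ent (p \<bind> (\<lambda>xs. dmc2 p2 xs vs)) id = ent (p \<bind> (\<lambda>xs. dmc2 p2 xs vs')) id"
    using assms unfolding condition1_def by blast
  then show ?thesis by (simp add: ent_eq_H)
qed

text \<open>With a constant word of Transmitter 2 every use sees the same channel, so the lemmas on
  memoryless channels apply to the input of Transmitter 1 alone. Condition 1 allows the passage from
  an arbitrary word to this one.\<close>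

lemma dmc2_replicate:
  "length xs = n \<Longrightarrow> dmc2 p2 xs (replicate n v) = dmc (\<lambda>x. p2 x v) xs"
proof -
  assume "length xs = n"
  then have "zip xs (replicate n v) = map (\<lambda>x. (x, v)) xs"
    by (simp add: zip_replicate2)
  then show ?thesis by (simp add: dmc2_def dmc_map)
qed

text \<open>Condition 1 for n = 1; wrapping letters into one-letter words is injective and leaves
  entropies unchanged.\<close>

lemma condition1_single:
  fixes p2 :: "'x1::finite \<Rightarrow> 'x2::finite \<Rightarrow> 'y2::finite pmf"
  assumes "condition1 p2"
  shows "H (q \<bind> (\<lambda>x. p2 x v)) = H (q \<bind> (\<lambda>x. p2 x v'))"
proof -
  have "H (map_pmf (\<lambda>x. [x]) q \<bind> (\<lambda>xs. dmc2 p2 xs [v])) = H (q \<bind> (\<lambda>x. p2 x v))" for v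
  proof -
    have "map_pmf (\<lambda>x. [x]) q \<bind> (\<lambda>xs. dmc2 p2 xs [v]) = map_pmf (\<lambda>y. [y]) (q \<bind> (\<lambda>x. p2 x v))"
      by (simp add: bind_map_pmf map_bind_pmf dmc2_def dmc_Cons map_pmf_def[symmetric])
    then show ?thesis by (simp add: H_map_inj inj_on_def)
  qed
  moreover have "H (map_pmf (\<lambda>x. [x]) q \<bind> (\<lambda>xs. dmc2 p2 xs [v])) = H (map_pmf (\<lambda>x. [x]) q \<bind> (\<lambda>xs. dmc2 p2 xs [v']))"
    by (rule condition1_H[OF assms, of 1]) auto
  ultimately show ?thesis by metis
qed

text \<open>Each marginal of the joint law is rewritten as a \<open>joint\<close> along the order of
  generation, and the chain rule is applied. The entropies of W, X2 and of the pair cancel in the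
  differences.\<close>

lemma joint_law_info:
  fixes p1 :: "'x1::finite \<Rightarrow> 'y1::finite pmf"
    and p2 :: "'x1 \<Rightarrow> 'x2::finite \<Rightarrow> 'y2::finite pmf"
    and pW :: "nat pmf" and pX :: "nat \<Rightarrow> 'x1 pmf" and pV :: "'x2 pmf" and v :: 'x2
  assumes c1: "condition1 p2" and fin: "fin pW"
  defines "P \<equiv> joint_law pW pX pV p1 p2"
    and "W \<equiv> (\<lambda>(w, x1, x2, y1, y2). w)"
    and "X1 \<equiv> (\<lambda>(w, x1, x2, y1, y2). x1)"
    and "X2 \<equiv> (\<lambda>(w, x1, x2, y1, y2). x2)"
    and "Y1 \<equiv> (\<lambda>(w, x1, x2, y1, y2). y1)"
    and "Y2 \<equiv> (\<lambda>(w, x1, x2, y1, y2). y2)"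
    and "L \<equiv> (\<lambda>x. p2 x v)"
  shows "cond_mut_info P X1 Y1 W = E pW (\<lambda>w. H (pX w \<bind> p1)) - E (pW \<bind> pX) (\<lambda>x. H (p1 x))"
    and "mut_info P X1 Y1 = H (pW \<bind> pX \<bind> p1) - E (pW \<bind> pX) (\<lambda>x. H (p1 x))"
    and "cond_mut_info P W Y2 X2 = H (pW \<bind> pX \<bind> L) - E pW (\<lambda>w. H (pX w \<bind> L))"
    and "cond_ent P Y2 (\<lambda>\<omega>. (W \<omega>, X2 \<omega>)) = E pW (\<lambda>w. H (pX w \<bind> L))"
proof -
  have finP: "fin P" using fin by (simp add: P_def joint_law_def)
  then have finm: "fin (map_pmf f P)" for f :: "_ \<Rightarrow> 'c" by simp
  \<comment> \<open>The entropy of Y2 given X2 = u is the same for every u, so averages over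
    \<open>pV\<close> collapse to the fixed letter \<open>v\<close>.\<close>
  have L: "H (q \<bind> (\<lambda>x. p2 x u)) = H (q \<bind> L)" for q u
    unfolding L_def by (rule condition1_single[OF c1])
  note laws = P_def joint_law_def map_bind_pmf joint_def W_def X1_def X2_def Y1_def Y2_def bind_assoc_pmf bind_map_pmf
  note swapH = H_map_inj[of prod.swap, simplified]
  have X1: "map_pmf X1 P = pW \<bind> pX"
    by (simp add: laws bind_return_pmf')
  have W: "map_pmf W P = pW"
    by (simp add: laws bind_return_pmf')
  have X2: "map_pmf X2 P = pV"
    by (simp add: laws bind_return_pmf')
  have Y1: "map_pmf Y1 P = pW \<bind> pX \<bind> p1"
    by (simp add: laws bind_return_pmf')
  have X1Y1: "map_pmf (\<lambda>\<omega>. (X1 \<omega>, Y1 \<omega>)) P = joint (pW \<bind> pX) p1"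
    by (simp add: laws) (simp add: map_pmf_def)
  have X1W: "map_pmf (\<lambda>\<omega>. (X1 \<omega>, W \<omega>)) P = map_pmf prod.swap (joint pW pX)"
    by (simp add: laws map_pmf_comp) (simp add: map_pmf_def)
  have Y1W: "map_pmf (\<lambda>\<omega>. (Y1 \<omega>, W \<omega>)) P = map_pmf prod.swap (joint pW (\<lambda>w. pX w \<bind> p1))"
    by (simp add: laws map_pmf_comp) (simp add: map_pmf_def)
  \<comment> \<open>The Markov chain W - X1 - Y1 enters here: given (w, x) the output law is
    \<open>p1 x\<close>.\<close>
  have X1Y1W: "map_pmf (\<lambda>\<omega>. (X1 \<omega>, Y1 \<omega>, W \<omega>)) P = map_pmf (\<lambda>((w, x), y). (x, y, w)) (joint (joint pW pX) (\<lambda>(w, x). p1 x))"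
    by (simp add: laws map_pmf_comp) (simp add: map_pmf_def)
  have WX2: "map_pmf (\<lambda>\<omega>. (W \<omega>, X2 \<omega>)) P = joint pW (\<lambda>_. pV)"
    by (simp add: laws map_pmf_comp) (simp add: map_pmf_def)
  have Y2X2: "map_pmf (\<lambda>\<omega>. (Y2 \<omega>, X2 \<omega>)) P = map_pmf prod.swap (joint pV (\<lambda>v. pW \<bind> pX \<bind> (\<lambda>x. p2 x v)))"
  proof -
    have "map_pmf (\<lambda>\<omega>. (Y2 \<omega>, X2 \<omega>)) P = (pW \<bind> pX) \<bind> (\<lambda>x. pV \<bind> (\<lambda>v. map_pmf (\<lambda>y. (y, v)) (p2 x v)))"
      by (simp add: laws map_pmf_comp) (simp add: map_pmf_def)
    also have "\<dots> = map_pmf prod.swap (joint pV (\<lambda>v. pW \<bind> pX \<bind> (\<lambda>x. p2 x v)))"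
      by (subst bind_commute_pmf) (simp add: laws map_pmf_comp)
    finally show ?thesis .
  qed
  have WX2Y2: "map_pmf (\<lambda>\<omega>. ((W \<omega>, X2 \<omega>), Y2 \<omega>)) P = joint (joint pW (\<lambda>_. pV)) (\<lambda>(w, v). pX w \<bind> (\<lambda>x. p2 x v))"
  proof -
    have "map_pmf (\<lambda>\<omega>. ((W \<omega>, X2 \<omega>), Y2 \<omega>)) P = pW \<bind> (\<lambda>w. pX w \<bind> (\<lambda>x. pV \<bind> (\<lambda>v. map_pmf (\<lambda>y. ((w, v), y)) (p2 x v))))"
      by (simp add: laws map_pmf_comp) (simp add: map_pmf_def)
    also have "\<dots> = joint (joint pW (\<lambda>_. pV)) (\<lambda>(w, v). pX w \<bind> (\<lambda>x. p2 x v))"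
      by (subst bind_commute_pmf) (simp add: laws map_pmf_comp)
    finally show ?thesis .
  qed
  have WYX: "H (map_pmf (\<lambda>\<omega>. (W \<omega>, Y2 \<omega>, X2 \<omega>)) P) = H (map_pmf (\<lambda>\<omega>. ((W \<omega>, X2 \<omega>), Y2 \<omega>)) P)"
    using H_map_inj[of "\<lambda>((w, v), y). (w, y, v)" "map_pmf (\<lambda>\<omega>. ((W \<omega>, X2 \<omega>), Y2 \<omega>)) P"]
    by (simp add: inj_on_def map_pmf_comp split_beta)
  have YWX: "H (map_pmf (\<lambda>\<omega>. (Y2 \<omega>, W \<omega>, X2 \<omega>)) P) = H (map_pmf (\<lambda>\<omega>. ((W \<omega>, X2 \<omega>), Y2 \<omega>)) P)"
    using H_map_inj[of prod.swap "map_pmf (\<lambda>\<omega>. ((W \<omega>, X2 \<omega>), Y2 \<omega>)) P"]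
    by (simp add: map_pmf_comp)
  have HWX2Y2: "H (map_pmf (\<lambda>\<omega>. ((W \<omega>, X2 \<omega>), Y2 \<omega>)) P) = H (joint pW (\<lambda>_. pV)) + E pW (\<lambda>w. H (pX w \<bind> L))"
    unfolding WX2Y2 using fin by (subst H_joint) (auto simp: fin_joint E_joint L)
  have HX1Y1W: "H (map_pmf (\<lambda>\<omega>. (X1 \<omega>, Y1 \<omega>, W \<omega>)) P) = H (joint pW pX) + E (pW \<bind> pX) (\<lambda>x. H (p1 x))"
    unfolding X1Y1W using fin
    by (subst H_map_inj, force simp: inj_on_def) (simp add: H_joint fin_joint E_joint E_bind case_prod_unfold)
  show "cond_mut_info P X1 Y1 W = E pW (\<lambda>w. H (pX w \<bind> p1)) - E (pW \<bind> pX) (\<lambda>x. H (p1 x))"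
    unfolding cond_mut_info_eq_mut_info mut_info_eq_H[OF finm] HX1Y1W X1 Y1W W X1W
    using fin by (simp add: H_map_inj H_joint)
  show "mut_info P X1 Y1 = H (pW \<bind> pX \<bind> p1) - E (pW \<bind> pX) (\<lambda>x. H (p1 x))"
    unfolding mut_info_eq_H[OF finm] X1 Y1 X1Y1 by (simp add: H_joint)
  show "cond_mut_info P W Y2 X2 = H (pW \<bind> pX \<bind> L) - E pW (\<lambda>w. H (pX w \<bind> L))"
    unfolding cond_mut_info_eq_mut_info mut_info_eq_H[OF finm] WYX HWX2Y2 Y2X2 WX2 X2 W
    by (simp add: H_map_inj H_joint L)
  show "cond_ent P Y2 (\<lambda>\<omega>. (W \<omega>, X2 \<omega>)) = E pW (\<lambda>w. H (pX w \<bind> L))"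
    unfolding cond_ent_eq_H[OF finm] YWX HWX2Y2 WX2 by simp
qed

section \<open>Converse\<close>

lemma count_list_eq_sum: "real (count_list xs x) = (\<Sum>i<length xs. indicator {x} (xs ! i))"
  by (induction xs) (auto simp: sum.lessThan_Suc_shift simp del: sum.lessThan_Suc)

lemma sum_list_eq_count: "(\<Sum>x\<leftarrow>xs. f x) = (\<Sum>x\<in>UNIV. real (count_list xs x) * f (x :: 'x::finite) :: real)"
proof (induction xs)
  case (Cons y ys)
  have "(\<Sum>x\<in>UNIV. real (count_list (y # ys) x) * f x) =
      (\<Sum>x\<in>UNIV. (if x = y then f y else 0) + real (count_list ys x) * f x)"
    by (intro sum.cong) (auto simp: algebra_simps)
  then show ?case using Cons by (simp add: sum.distrib)
qed simp

text \<open>Subadditivity over the positions, followed by concavity for a position drawn uniformly: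
  \<open>q\<close> is the law of the input letter at that position, and the expected letter counts
  divided by n are its probabilities.\<close>

lemma block_entropy_le:
  fixes K :: "'x::finite \<Rightarrow> 'y::finite pmf"
  assumes "n > 0" and p: "set_pmf p \<subseteq> {xs. length xs = n}"
    and v: "real n *\<^sub>R v = (\<chi> x. E p (\<lambda>xs. real (count_list xs x)))"
  shows "H (p \<bind> dmc K) \<le> real n * out_ent K v"
proof -
  have fin: "fin p" using p by (rule fin_length)
  define U where "U = pmf_of_set {..<n}"
  define q where "q = U \<bind> (\<lambda>i. map_pmf (\<lambda>xs. xs ! i) p)"
  have U: "set_pmf U = {..<n}" "E U f = (\<Sum>i<n. f i) / real n" for f
  proof -
    have ne: "{..<n} \<noteq> {}" using \<open>n > 0\<close> by auto
    show "set_pmf U = {..<n}" "E U f = (\<Sum>i<n. f i) / real n"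
      using ne by (simp_all add: U_def integral_pmf_of_set)
  qed
  have "v = pvec q"
  proof (rule iffD2[OF vec_eq_iff], intro allI)
    fix x
    have "real n * v $ x = E p (\<lambda>xs. real (count_list xs x))"
      using arg_cong[OF v, of "\<lambda>w. w $ x"] by simp
    also have "\<dots> = E p (\<lambda>xs. \<Sum>i<n. indicator {x} (xs ! i))"
      using p by (intro E_cong) (auto simp: count_list_eq_sum)
    also have "\<dots> = (\<Sum>i<n. pmf (map_pmf (\<lambda>xs. xs ! i) p) x)"
    proof (subst E_sum[OF fin], intro sum.cong refl)
      fix i
      have "E (map_pmf (\<lambda>xs. xs ! i) p) (indicator {x}) = pmf (map_pmf (\<lambda>xs. xs ! i) p) x"
        by (simp add: measure_pmf_single del: integral_map_pmf measure_map_pmf)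
      then show "E p (\<lambda>xs. indicator {x} (xs ! i)) = pmf (map_pmf (\<lambda>xs. xs ! i) p) x"
        by (simp only: integral_map_pmf)
    qed
    also have "\<dots> = real n * pmf q x"
      using \<open>n > 0\<close> by (simp add: q_def pmf_bind U(2))
    finally show "v $ x = pvec q $ x" using \<open>n > 0\<close> by (simp add: pvec_def)
  qed
  have "H (p \<bind> dmc K) \<le> (\<Sum>i<n. H (map_pmf (\<lambda>ys. ys ! i) (p \<bind> dmc K)))"
    using p fin by (intro H_list_subadditive) (auto simp: fin_dmc dest: length_dmc)
  also have "\<dots> = (\<Sum>i<n. H (map_pmf (\<lambda>xs. xs ! i) p \<bind> K))"
    unfolding map_bind_pmf bind_map_pmf using p
    by (intro sum.cong refl arg_cong[where f=H] bind_pmf_cong map_nth_dmc) auto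
  also have "\<dots> = real n * E U (\<lambda>i. H (map_pmf (\<lambda>xs. xs ! i) p \<bind> K))"
    using \<open>n > 0\<close> by (simp add: U(2))
  also have "\<dots> \<le> real n * H (U \<bind> (\<lambda>i. map_pmf (\<lambda>xs. xs ! i) p \<bind> K))"
    by (intro mult_left_mono H_concave) (auto simp: U(1))
  also have "U \<bind> (\<lambda>i. map_pmf (\<lambda>xs. xs ! i) p \<bind> K) = q \<bind> K"
    by (simp add: q_def bind_assoc_pmf)
  finally show ?thesis by (simp add: \<open>v = pvec q\<close> out_ent_pvec)
qed

text \<open>The two input words are independent, hence so are their letters at each position, and
  \<tau> is the maximum over exactly such product inputs.\<close>

lemma block_entropy_le_tau:
  assumes "is_tau p2 \<tau>" "set_pmf p \<subseteq> {xs. length xs = n}" "set_pmf q \<subseteq> {vs. length vs = n}"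
  shows "H (p \<bind> (\<lambda>xs. q \<bind> (\<lambda>vs. dmc2 p2 xs vs))) \<le> real n * \<tau>"
proof -
  let ?p = "p \<bind> (\<lambda>xs. q \<bind> (\<lambda>vs. dmc2 p2 xs vs))"
  have "H ?p \<le> (\<Sum>i<n. H (map_pmf (\<lambda>ys. ys ! i) ?p))"
  proof (rule H_list_subadditive)
    show "set_pmf ?p \<subseteq> {ys. length ys = n}"
      using assms by (auto simp: dmc2_def subset_eq dest!: length_dmc)
    then show "fin ?p" by (rule fin_length)
  qed
  also have "\<dots> \<le> (\<Sum>i<n. \<tau>)"
  proof (rule sum_mono)
    fix i assume i: "i \<in> {..<n}"
    have "map_pmf (\<lambda>ys. ys ! i) ?p = output2 p2 (map_pmf (\<lambda>xs. xs ! i) p) (map_pmf (\<lambda>vs. vs ! i) q)"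
      unfolding output2_def map_bind_pmf bind_map_pmf
    proof (intro bind_pmf_cong refl)
      fix xs vs assume "xs \<in> set_pmf p" "vs \<in> set_pmf q"
      then have l: "length xs = n" "length vs = n" using assms by auto
      with i show "map_pmf (\<lambda>ys. ys ! i) (dmc2 p2 xs vs) = p2 (xs ! i) (vs ! i)"
        unfolding dmc2_def by (subst map_nth_dmc) simp_all
    qed
    then show "H (map_pmf (\<lambda>ys. ys ! i) ?p) \<le> \<tau>"
      using assms(1) by (simp add: is_tau_def ent_eq_H)
  qed
  finally show ?thesis by simp
qed

section \<open>Sizes of the message sets\<close>

lemma messages_eq: "messages n R = {1..nat \<lfloor>2 powr (real n * R)\<rfloor>}"
  unfolding messages_def by (auto simp: le_nat_floor) linarith+

lemma finite_messages [simp]: "finite (messages n R)"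
  by (simp add: messages_eq)

lemma card_messages_bounds:
  assumes "R \<ge> 0"
  shows "messages n R \<noteq> {}" "real (card (messages n R)) \<le> 2 powr (real n * R)"
    "real n * R - 1 \<le> log 2 (real (card (messages n R)))"
proof -
  let ?t = "2 powr (real n * R)"
  have t: "?t \<ge> 1" using assms by (simp add: ge_one_powr_ge_zero)
  then have fl: "\<lfloor>?t\<rfloor> \<ge> 1" by simp
  then have card: "real (card (messages n R)) = of_int \<lfloor>?t\<rfloor>"
    by (simp add: messages_eq)
  have "1 \<le> nat \<lfloor>?t\<rfloor>" using fl by linarith
  then show "messages n R \<noteq> {}" by (simp add: messages_eq)
  show "real (card (messages n R)) \<le> ?t" unfolding card by simp
  \<comment> \<open>Rounding down a number that is at least 1 at most halves it, which costs at most
    one bit.\<close>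
  have "?t / 2 \<le> of_int \<lfloor>?t\<rfloor>"
    using fl by linarith
  then have "log 2 (?t / 2) \<le> log 2 (of_int \<lfloor>?t\<rfloor>)"
    using t fl by (subst log_le_cancel_iff) auto
  also have "log 2 (?t / 2) = real n * R - 1"
    by (simp add: log_divide_pos)
  finally show "real n * R - 1 \<le> log 2 (real (card (messages n R)))" unfolding card .
qed

lemma pmf_of_set_Times:
  assumes "finite A" "finite B" "A \<noteq> {}" "B \<noteq> {}"
  shows "pmf_of_set (A \<times> B) = pair_pmf (pmf_of_set A) (pmf_of_set B)"
proof (rule pmf_eqI)
  fix z :: "'a \<times> 'b"
  show "pmf (pmf_of_set (A \<times> B)) z = pmf (pair_pmf (pmf_of_set A) (pmf_of_set B)) z"
    using assms by (cases z) (simp add: pmf_pair indicator_def card_cartesian_product)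
qed

text \<open>
  The loss $3/n$ absorbs the constant in \<open>fano\<close> and the rounding of the message sets.
\<close>

lemma code_in_region:
  fixes p1 :: "'x1::finite \<Rightarrow> 'y1::finite pmf" and p2 :: "'x1 \<Rightarrow> 'x2::finite \<Rightarrow> 'y2::finite pmf"
    and dec1 :: "'y1 list \<Rightarrow> nat \<times> nat" and dec2 :: "'y2 list \<Rightarrow> nat \<times> nat"
  assumes c1: "condition1 p2" and tau: "is_tau p2 \<tau>" and "n > 0"
    and R: "0 \<le> R1c" "0 \<le> R1p" "0 \<le> R2"
    and valid: "valid_encoders n R1c R1p R2 enc1 enc2"
  defines "e \<equiv> error_prob p1 p2 n R1c R1p R2 enc1 enc2 dec1 dec2"
  shows "((1 - e) * R1c - 3 / n, (1 - e) * R1p - 3 / n, (1 - e) * R2 - 3 / n) \<in> region p1 (\<lambda>x. p2 x v) \<tau>"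
proof -
  define K where "K = p1"
  define L where "L = (\<lambda>x. p2 x v)"
  define MC where "MC = messages n R1c"
  define MP where "MP = messages n R1p"
  define M2 where "M2 = messages n R2"
  define C where "C = pmf_of_set MC"
  define Q where "Q = pmf_of_set MP"
  define D where "D = pmf_of_set M2"
  have M [simp]: "finite MC" "finite MP" "finite M2" "MC \<noteq> {}" "MP \<noteq> {}" "M2 \<noteq> {}"
    using R by (auto simp: MC_def MP_def M2_def card_messages_bounds)
  have sets: "set_pmf C = MC" "set_pmf Q = MP" "set_pmf D = M2"
    by (simp_all add: C_def Q_def D_def)
  have fin [simp]: "fin C" "fin Q" "fin D" by (simp_all add: sets)
  \<comment> \<open>The law of X1^n given W1c = c; the randomness left is the private
    message.\<close>
  define X where "X c = map_pmf (enc1 c) Q" for c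
  have lenX: "set_pmf (X c) \<subseteq> {xs. length xs = n}" if "c \<in> MC" for c
    using valid that by (auto simp: X_def sets valid_encoders_def MC_def MP_def)
  have len2: "length (enc2 k) = n" if "k \<in> M2" for k
    using valid that by (auto simp: valid_encoders_def M2_def)
  have finX: "fin (X c)" for c by (simp add: X_def)

  have err: "e = E C (\<lambda>c. E Q (\<lambda>w. E D (\<lambda>k. E (dmc p1 (enc1 c w)) (\<lambda>y1. E (dmc2 p2 (enc1 c w) (enc2 k))
      (\<lambda>y2. indicator {(y1, y2). dec1 y1 \<noteq> (c, w) \<or> dec2 y2 \<noteq> (c, k)} (y1, y2))))))"
    unfolding e_def error_prob_def transmission_def C_def Q_def D_def MC_def MP_def M2_def
    by (simp add: prob_bind indicator_def)
  have fin_out: "fin (dmc p1 xs)" "fin (dmc2 p2 xs vs)" for xs vs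
    by (auto intro!: fin_dmc simp: dmc2_def)
  \<comment> \<open>The error event of one receiver is part of the event counted by
    \<open>e\<close>; the message and the output that it does not involve integrate out.\<close>
  have err1: "E C (\<lambda>c. E Q (\<lambda>w. measure_pmf.prob (dmc p1 (enc1 c w)) {y. dec1 y \<noteq> (c, w)})) \<le> e"
  proof -
    have "E C (\<lambda>c. E Q (\<lambda>w. measure_pmf.prob (dmc p1 (enc1 c w)) {y. dec1 y \<noteq> (c, w)})) =
      E C (\<lambda>c. E Q (\<lambda>w. E D (\<lambda>k. E (dmc p1 (enc1 c w)) (\<lambda>y1. E (dmc2 p2 (enc1 c w) (enc2 k))
      (\<lambda>y2. indicator {y. dec1 y \<noteq> (c, w)} y1)))))"
      by simp
    also have "\<dots> \<le> e"
      unfolding err by (intro E_mono fin fin_out) (auto simp: indicator_def)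
    finally show ?thesis .
  qed
  have err2: "E C (\<lambda>c. E Q (\<lambda>w. E D (\<lambda>k. measure_pmf.prob (dmc2 p2 (enc1 c w) (enc2 k)) {y. dec2 y \<noteq> (c, k)}))) \<le> e"
  proof -
    have "E C (\<lambda>c. E Q (\<lambda>w. E D (\<lambda>k. measure_pmf.prob (dmc2 p2 (enc1 c w) (enc2 k)) {y. dec2 y \<noteq> (c, k)}))) =
      E C (\<lambda>c. E Q (\<lambda>w. E D (\<lambda>k. E (dmc p1 (enc1 c w)) (\<lambda>y1. E (dmc2 p2 (enc1 c w) (enc2 k))
      (\<lambda>y2. indicator {y. dec2 y \<noteq> (c, k)} y2)))))"
      by simp
    also have "\<dots> \<le> e"
      unfolding err by (intro E_mono fin fin_out) (auto simp: indicator_def)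
    finally show ?thesis .
  qed
  have e1: "e \<le> 1" unfolding e_def error_prob_def by simp

  \<comment> \<open>The single-letter point is taken for each common message separately and averaged
    afterwards: entropies given W1c are averages over c, and the hull is convex.\<close>
  have "\<forall>c\<in>MC. \<exists>g z. g \<ge> 0 \<and> z \<in> ent_hull K L \<and> real n *\<^sub>R z =
      ((\<chi> x. E (X c) (\<lambda>xs. real (count_list xs x))), H (X c \<bind> dmc K) - g, H (X c \<bind> dmc L) - g)"
    using single_letter_pair[OF finX lenX] by blast
  then obtain g z where g: "\<And>c. c \<in> MC \<Longrightarrow> g c \<ge> 0" and z: "\<And>c. c \<in> MC \<Longrightarrow> z c \<in> ent_hull K L"
    and nz: "\<And>c. c \<in> MC \<Longrightarrow> real n *\<^sub>R z c =
      ((\<chi> x. E (X c) (\<lambda>xs. real (count_list xs x))), H (X c \<bind> dmc K) - g c, H (X c \<bind> dmc L) - g c)"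
    by metis
  define XB where "XB = C \<bind> X"
  have lenXB: "set_pmf XB \<subseteq> {xs. length xs = n}"
    using lenX by (auto simp: XB_def sets)
  have EXB: "E XB f = E C (\<lambda>c. E (X c) f)" for f
    by (simp add: XB_def E_bind finX)
  define zb where "zb = (\<Sum>c\<in>set_pmf C. pmf C c *\<^sub>R z c)"
  have zb: "zb \<in> ent_hull K L"
    unfolding zb_def using z by (intro mixture_in_hull) (auto simp: sets)
  obtain vv a b where zb_eq: "zb = (vv, a, b)" by (cases zb) auto
  have nzb: "real n *\<^sub>R zb = (\<Sum>c\<in>set_pmf C. pmf C c *\<^sub>R
      ((\<chi> x. E (X c) (\<lambda>xs. real (count_list xs x))), H (X c \<bind> dmc K) - g c, H (X c \<bind> dmc L) - g c))"
    unfolding zb_def scaleR_sum_right by (intro sum.cong refl) (simp add: nz[symmetric] sets)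
  define HK where "HK = E C (\<lambda>c. H (X c \<bind> dmc K))"
  define HL where "HL = E C (\<lambda>c. H (X c \<bind> dmc L))"
  define G where "G = E C g"
  have nv: "real n *\<^sub>R vv = (\<chi> x. E XB (\<lambda>xs. real (count_list xs x)))"
    using arg_cong[OF nzb, of fst]
    by (simp add: zb_eq fst_sum EXB finX E_eq_sum vec_eq_iff sum_component)
  have na: "real n * a = HK - G"
    using arg_cong[OF nzb, of "fst \<circ> snd"]
    by (simp add: zb_eq fst_sum snd_sum HK_def G_def E_eq_sum sum_subtractf right_diff_distrib)
  have nb: "real n * b = HL - G"
    using arg_cong[OF nzb, of "snd \<circ> snd"]
    by (simp add: zb_eq fst_sum snd_sum HL_def G_def E_eq_sum sum_subtractf right_diff_distrib)
  have "G \<ge> 0" unfolding G_def using g by (intro integral_nonneg_AE) (auto simp: AE_measure_pmf_iff sets)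
  \<comment> \<open>H(Y1^n|X1^n) depends on the codewords only through their expected letter counts,
    so it is n times a linear function of the mean letter law.\<close>
  have noise: "E C (\<lambda>c. E Q (\<lambda>w. H (dmc K (enc1 c w)))) = real n * noise_ent K vv"
  proof -
    have "E C (\<lambda>c. E Q (\<lambda>w. H (dmc K (enc1 c w)))) = E XB (\<lambda>xs. H (dmc K xs))"
      by (simp add: XB_def X_def E_bind)
    also have "\<dots> = E XB (\<lambda>xs. \<Sum>x\<in>UNIV. real (count_list xs x) * H (K x))"
      by (intro E_cong) (simp add: H_dmc sum_list_eq_count)
    also have "\<dots> = (\<Sum>x\<in>UNIV. E XB (\<lambda>xs. real (count_list xs x)) * H (K x))"
      using finX by (subst E_sum) (auto simp: XB_def)
    also have "\<dots> = (\<Sum>x\<in>UNIV. (real n *\<^sub>R vv) $ x * H (K x))"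
      unfolding nv by simp
    also have "\<dots> = real n * noise_ent K vv"
      by (simp add: noise_ent_def sum_distrib_left mult_ac)
    finally show ?thesis .
  qed

  \<comment> \<open>Condition 1 at block length n, valid for any law of X1^n and so in particular
    given W1c = c.\<close>
  have swap_c1: "H (p \<bind> (\<lambda>xs. dmc2 p2 xs (enc2 k))) = H (p \<bind> dmc L)"
    if "set_pmf p \<subseteq> {xs. length xs = n}" "k \<in> M2" for p k
  proof -
    have "H (p \<bind> (\<lambda>xs. dmc2 p2 xs (enc2 k))) = H (p \<bind> (\<lambda>xs. dmc2 p2 xs (replicate n v)))"
      using that len2 by (intro condition1_H[OF c1 \<open>n > 0\<close>]) auto
    also have "p \<bind> (\<lambda>xs. dmc2 p2 xs (replicate n v)) = p \<bind> dmc L"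
      using that by (intro bind_pmf_cong refl) (auto simp: dmc2_replicate L_def)
    finally show ?thesis .
  qed
  have log0: "0 \<le> log 2 (real (card MC))" "0 \<le> log 2 (real (card MP))" "0 \<le> log 2 (real (card M2))"
    by (auto intro!: zero_le_log_cancel_iff[THEN iffD2] simp: Suc_le_eq card_gt_0_iff)
  \<comment> \<open>Fano for W1p from Y1^n with W1c given.\<close>
  have F1: "(1 - e) * log 2 (card MP) - 1 \<le> HK - real n * noise_ent K vv"
  proof -
    have "(1 - measure_pmf.expectation Q (\<lambda>w. measure_pmf.prob (dmc K (enc1 c w)) {y. snd (dec1 y) \<noteq> w})) * log 2 (card MP) - 1
        \<le> H (X c \<bind> dmc K) - E Q (\<lambda>w. H (dmc K (enc1 c w)))" for c
      using fano[of MP "\<lambda>w. dmc K (enc1 c w)" "\<lambda>y. snd (dec1 y)"] fin_out(1)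
      by (simp add: X_def bind_map_pmf Q_def K_def)
    then have "E C (\<lambda>c. (1 - E Q (\<lambda>w. measure_pmf.prob (dmc K (enc1 c w)) {y. snd (dec1 y) \<noteq> w})) * log 2 (card MP) - 1)
        \<le> E C (\<lambda>c. H (X c \<bind> dmc K) - E Q (\<lambda>w. H (dmc K (enc1 c w))))"
      by (intro E_mono) auto
    also have "\<dots> = HK - real n * noise_ent K vv"
      by (simp add: E_diff HK_def noise)
    finally have "(1 - E C (\<lambda>c. E Q (\<lambda>w. measure_pmf.prob (dmc K (enc1 c w)) {y. snd (dec1 y) \<noteq> w}))) * log 2 (card MP) - 1
        \<le> HK - real n * noise_ent K vv"
      by (simp add: E_diff)
    moreover have "E C (\<lambda>c. E Q (\<lambda>w. measure_pmf.prob (dmc K (enc1 c w)) {y. snd (dec1 y) \<noteq> w})) \<le> e"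
      by (rule order_trans[OF _ err1], unfold K_def, intro E_mono fin measure_pmf.finite_measure_mono) auto
    ultimately show ?thesis
      using mult_right_mono[OF _ log0(2), of "1 - e"] by (smt (verit))
  qed
  \<comment> \<open>Fano for (W1c, W1p) from Y1^n. The output entropy is unconditional here, so
    \<open>block_entropy_le\<close> bounds it and no slack appears.\<close>
  have F2: "(1 - e) * (log 2 (card MC) + log 2 (card MP)) - 1 \<le> real n * out_ent K vv - real n * noise_ent K vv"
  proof -
    have pp: "pmf_of_set (MC \<times> MP) = joint C (\<lambda>_. Q)"
      by (simp add: pmf_of_set_Times C_def Q_def joint_def pair_pmf_def map_pmf_def)
    have i1: "(1 - E C (\<lambda>c. E Q (\<lambda>w. measure_pmf.prob (dmc K (enc1 c w)) {y. dec1 y \<noteq> (c, w)}))) * log 2 (card (MC \<times> MP)) - 1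
        \<le> H (joint C (\<lambda>_. Q) \<bind> (\<lambda>(c, w). dmc K (enc1 c w))) - E C (\<lambda>c. E Q (\<lambda>w. H (dmc K (enc1 c w))))"
      using fano[of "MC \<times> MP" "\<lambda>(c, w). dmc K (enc1 c w)" dec1] fin_out(1)
      unfolding pp by (simp add: E_joint case_prod_unfold K_def)
    have i2: "joint C (\<lambda>_. Q) \<bind> (\<lambda>(c, w). dmc K (enc1 c w)) = XB \<bind> dmc K"
      by (simp add: joint_def XB_def X_def bind_assoc_pmf bind_map_pmf)
    have i3: "H (XB \<bind> dmc K) \<le> real n * out_ent K vv"
      by (rule block_entropy_le[OF \<open>n > 0\<close> lenXB nv])
    have i4: "log 2 (card (MC \<times> MP)) = log 2 (card MC) + log 2 (card MP)"
      by (simp add: card_cartesian_product log_mult_pos card_gt_0_iff)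
    show ?thesis
      using i1 mult_right_mono[of "1 - e" "1 - E C (\<lambda>c. E Q (\<lambda>w. measure_pmf.prob (dmc K (enc1 c w)) {y. dec1 y \<noteq> (c, w)}))"
          "log 2 (card MC) + log 2 (card MP)"] log0 err1[folded K_def] i3
      unfolding i2 i4 noise by (smt (verit))
  qed
  \<comment> \<open>Fano for W1c from Y2^n with the word of Transmitter 2 known. For each k
    Condition 1 replaces that word in both entropies, after which the bound no longer depends on
    k.\<close>
  have F3: "(1 - e) * log 2 (card MC) - 1 \<le> real n * out_ent L vv - HL"
  proof -
    let ?P = "\<lambda>k c. X c \<bind> (\<lambda>xs. dmc2 p2 xs (enc2 k))"
    have "(1 - E C (\<lambda>c. measure_pmf.prob (?P k c) {y. fst (dec2 y) \<noteq> c})) * log 2 (card MC) - 1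
        \<le> real n * out_ent L vv - HL" if k: "k \<in> M2" for k
    proof -
      have i0: "(1 - E C (\<lambda>c. measure_pmf.prob (?P k c) {y. fst (dec2 y) \<noteq> c})) * log 2 (card MC) - 1
          \<le> H (C \<bind> ?P k) - E C (\<lambda>c. H (?P k c))"
        unfolding C_def using finX fin_out by (intro fano) auto
      have i1: "C \<bind> ?P k = XB \<bind> (\<lambda>xs. dmc2 p2 xs (enc2 k))"
        by (simp add: XB_def bind_assoc_pmf)
      have i2: "H (XB \<bind> (\<lambda>xs. dmc2 p2 xs (enc2 k))) = H (XB \<bind> dmc L)" by (rule swap_c1[OF lenXB k])
      have i3: "H (XB \<bind> dmc L) \<le> real n * out_ent L vv"
        by (rule block_entropy_le[OF \<open>n > 0\<close> lenXB nv])
      have i4: "E C (\<lambda>c. H (?P k c)) = HL"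
        unfolding HL_def by (intro E_cong swap_c1[OF lenX k]) (simp add: sets)
      show ?thesis using i0 i3 unfolding i1 i2 i4 by linarith
    qed
    then have "E D (\<lambda>k. (1 - E C (\<lambda>c. measure_pmf.prob (?P k c) {y. fst (dec2 y) \<noteq> c})) * log 2 (card MC) - 1)
        \<le> E D (\<lambda>k. real n * out_ent L vv - HL)"
      by (intro E_mono) (auto simp: sets)
    then have "(1 - E D (\<lambda>k. E C (\<lambda>c. measure_pmf.prob (?P k c) {y. fst (dec2 y) \<noteq> c}))) * log 2 (card MC) - 1
        \<le> real n * out_ent L vv - HL"
      by (simp add: E_diff)
    moreover have "E D (\<lambda>k. E C (\<lambda>c. measure_pmf.prob (?P k c) {y. fst (dec2 y) \<noteq> c})) \<le> e"
    proof -
      have "E D (\<lambda>k. E C (\<lambda>c. measure_pmf.prob (?P k c) {y. fst (dec2 y) \<noteq> c})) =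
          E C (\<lambda>c. E D (\<lambda>k. E Q (\<lambda>w. measure_pmf.prob (dmc2 p2 (enc1 c w) (enc2 k)) {y. fst (dec2 y) \<noteq> c})))"
        by (subst E_swap) (simp_all add: prob_bind X_def)
      also have "\<dots> = E C (\<lambda>c. E Q (\<lambda>w. E D (\<lambda>k. measure_pmf.prob (dmc2 p2 (enc1 c w) (enc2 k)) {y. fst (dec2 y) \<noteq> c})))"
        by (intro E_cong E_swap fin)
      also have "\<dots> \<le> e"
        by (rule order_trans[OF _ err2], intro E_mono fin measure_pmf.finite_measure_mono) auto
      finally show ?thesis .
    qed
    ultimately show ?thesis
      using mult_right_mono[OF _ log0(1), of "1 - e"] by (smt (verit))
  qed
  \<comment> \<open>Fano for (W1c, W2) from Y2^n. Given both messages the entropy is again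
    \<open>HL\<close> by Condition 1, while the total output entropy is at most n \<tau>.\<close>
  have F4: "(1 - e) * (log 2 (card M2) + log 2 (card MC)) - 1 \<le> real n * \<tau> - HL"
  proof -
    let ?P = "\<lambda>(c, k). X c \<bind> (\<lambda>xs. dmc2 p2 xs (enc2 k))"
    have pp: "pmf_of_set (MC \<times> M2) = joint C (\<lambda>_. D)"
      by (simp add: pmf_of_set_Times C_def D_def joint_def pair_pmf_def map_pmf_def)
    have i0: "(1 - E (joint C (\<lambda>_. D)) (\<lambda>m. measure_pmf.prob (?P m) {y. dec2 y \<noteq> m})) * log 2 (card (MC \<times> M2)) - 1
        \<le> H (joint C (\<lambda>_. D) \<bind> ?P) - E (joint C (\<lambda>_. D)) (\<lambda>m. H (?P m))"
      unfolding pp[symmetric] using finX fin_out by (intro fano) auto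
    have i1: "joint C (\<lambda>_. D) \<bind> ?P = XB \<bind> (\<lambda>xs. map_pmf enc2 D \<bind> (\<lambda>vs. dmc2 p2 xs vs))"
      by (simp add: joint_def XB_def bind_assoc_pmf bind_map_pmf)
         (intro bind_pmf_cong refl bind_commute_pmf)
    have i2: "H (XB \<bind> (\<lambda>xs. map_pmf enc2 D \<bind> (\<lambda>vs. dmc2 p2 xs vs))) \<le> real n * \<tau>"
      by (rule block_entropy_le_tau[OF tau lenXB]) (use len2 in \<open>auto simp: sets\<close>)
    have i3: "E (joint C (\<lambda>_. D)) (\<lambda>m. H (?P m)) = HL"
      proof -
      have "E (joint C (\<lambda>_. D)) (\<lambda>m. H (?P m)) =
          E C (\<lambda>c. E D (\<lambda>k. H (X c \<bind> (\<lambda>xs. dmc2 p2 xs (enc2 k)))))"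
        by (simp add: E_joint)
      also have "\<dots> = E C (\<lambda>c. E D (\<lambda>k. H (X c \<bind> dmc L)))"
        by (intro E_cong swap_c1 lenX) (simp_all add: sets)
      finally show ?thesis by (simp add: HL_def)
    qed
    have i4: "log 2 (card (MC \<times> M2)) = log 2 (card M2) + log 2 (card MC)"
      by (simp add: card_cartesian_product log_mult_pos card_gt_0_iff)
    have "(1 - E (joint C (\<lambda>_. D)) (\<lambda>m. measure_pmf.prob (?P m) {y. dec2 y \<noteq> m})) *
        (log 2 (card M2) + log 2 (card MC)) - 1 \<le> real n * \<tau> - HL"
      using i0 i2 unfolding i1 i3 i4 by linarith
    moreover have "E (joint C (\<lambda>_. D)) (\<lambda>m. measure_pmf.prob (?P m) {y. dec2 y \<noteq> m}) \<le> e"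
    proof -
      have "E (joint C (\<lambda>_. D)) (\<lambda>m. measure_pmf.prob (?P m) {y. dec2 y \<noteq> m}) =
          E C (\<lambda>c. E D (\<lambda>k. E Q (\<lambda>w. measure_pmf.prob (dmc2 p2 (enc1 c w) (enc2 k)) {y. dec2 y \<noteq> (c, k)})))"
        by (simp add: E_joint prob_bind X_def)
      also have "\<dots> = E C (\<lambda>c. E Q (\<lambda>w. E D (\<lambda>k. measure_pmf.prob (dmc2 p2 (enc1 c w) (enc2 k)) {y. dec2 y \<noteq> (c, k)})))"
        by (intro E_cong E_swap fin)
      finally show ?thesis using err2 by simp
    qed
    ultimately show ?thesis
      using mult_right_mono[of "1 - e" _ "log 2 (card M2) + log 2 (card MC)"] log0 by (smt (verit))
  qed

  have rate: "(1 - e) * (real n * r) - 1 \<le> (1 - e) * log 2 (card (messages n r))" if "r \<ge> 0" for r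
  proof -
    have "(1 - e) * (real n * r - 1) \<le> (1 - e) * log 2 (card (messages n r))"
      using e1 card_messages_bounds(3)[OF that] by (intro mult_left_mono) auto
    moreover have "0 \<le> e" unfolding e_def error_prob_def by simp
    ultimately show ?thesis by (simp add: algebra_simps)
  qed
  have scaled: "s \<le> t" if "real n * s \<le> real n * t" for s t
    using that \<open>n > 0\<close> by simp
  have ns: "real n * ((1 - e) * r - 3 / n) = (1 - e) * (real n * r) - 3" for r
    using \<open>n > 0\<close> by (simp add: field_simps)
  note rates = rate[OF R(1), folded MC_def] rate[OF R(2), folded MP_def] rate[OF R(3), folded M2_def]
  \<comment> \<open>Since n a = HK - G and n b = HL - G, the choice \<gamma> = G/n restores both
    block entropies at once: it is added to a, and subtracted together with b.\<close>
  have "feasible K L \<tau> ((1 - e) * R1c - 3 / n, (1 - e) * R1p - 3 / n, (1 - e) * R2 - 3 / n) zb (G / n)"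
    unfolding feasible_def zb_eq prod.case
  proof (intro conjI; rule scaled)
    show "real n * ((1 - e) * R1p - 3 / real n) \<le> real n * (a - noise_ent K vv + G / real n)"
      using F1 rates na \<open>n > 0\<close> unfolding ns by (simp add: algebra_simps)
    show "real n * ((1 - e) * R1c - 3 / real n + ((1 - e) * R1p - 3 / real n)) \<le> real n * (out_ent K vv - noise_ent K vv)"
      using F2 rates unfolding distrib_left[of "real n" "(1 - e) * R1c - 3 / real n"] ns
        right_diff_distrib[of "real n" "out_ent K vv"] distrib_left[of "1 - e"] by linarith
    show "real n * ((1 - e) * R1c - 3 / real n) \<le> real n * (out_ent L vv - b - G / real n)"
      using F3 rates nb \<open>n > 0\<close> unfolding ns by (simp add: algebra_simps)
    show "real n * ((1 - e) * R2 - 3 / real n + ((1 - e) * R1c - 3 / real n)) \<le> real n * (\<tau> - b - G / real n)"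
      using F4 rates nb \<open>n > 0\<close> unfolding distrib_left[of "real n" "(1 - e) * R2 - 3 / real n"] ns distrib_left[of "1 - e"]
      by (simp add: right_diff_distrib)
  qed
  then show ?thesis
    unfolding region_def K_def L_def using zb \<open>G \<ge> 0\<close> unfolding K_def L_def by (auto intro!: bexI[of _ zb] exI[of _ "G / n"])
qed

text \<open>The diminished rates of \<open>code_in_region\<close> tend to the rates of the code
  sequence, and the region is closed.\<close>

lemma achievable_subset_region:
  fixes p1 :: "'x1::finite \<Rightarrow> 'y1::finite pmf" and p2 :: "'x1 \<Rightarrow> 'x2::finite \<Rightarrow> 'y2::finite pmf"
  assumes "condition1 p2" "is_tau p2 \<tau>"
  shows "achievable p1 p2 \<subseteq> region p1 (\<lambda>x. p2 x v) \<tau>"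
proof
  fix R assume "R \<in> achievable p1 p2"
  then obtain R1c R1p R2 enc1 enc2 dec1 dec2 where R: "R = (R1c, R1p, R2)" "0 \<le> R1c" "0 \<le> R1p" "0 \<le> R2"
    and valid: "\<And>n. valid_encoders n R1c R1p R2 (enc1 n) (enc2 n)"
    and lim: "(\<lambda>n. error_prob p1 p2 n R1c R1p R2 (enc1 n) (enc2 n) (dec1 n) (dec2 n)) \<longlonglongrightarrow> 0"
    unfolding achievable_def by blast
  define e where "e n = error_prob p1 p2 n R1c R1p R2 (enc1 n) (enc2 n) (dec1 n) (dec2 n)" for n
  have e: "e \<longlonglongrightarrow> 0" using lim by (simp add: e_def[abs_def])
  have 3: "(\<lambda>n. 3 / real n) \<longlonglongrightarrow> 0" by real_asymp
  have "(\<lambda>n. ((1 - e n) * R1c - 3 / n, (1 - e n) * R1p - 3 / n, (1 - e n) * R2 - 3 / n))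
      \<longlonglongrightarrow> ((1 - 0) * R1c - 0, (1 - 0) * R1p - 0, (1 - 0) * R2 - 0)"
    by (intro tendsto_intros e 3)
  then have "(\<lambda>n. ((1 - e n) * R1c - 3 / n, (1 - e n) * R1p - 3 / n, (1 - e n) * R2 - 3 / n)) \<longlonglongrightarrow> R"
    by (simp add: R(1))
  moreover have "\<forall>\<^sub>F n in sequentially. ((1 - e n) * R1c - 3 / n, (1 - e n) * R1p - 3 / n, (1 - e n) * R2 - 3 / n)
      \<in> region p1 (\<lambda>x. p2 x v) \<tau>"
    using eventually_gt_at_top[of 0]
    by eventually_elim (unfold e_def, intro code_in_region assms R(2-4) valid)
  ultimately show "R \<in> region p1 (\<lambda>x. p2 x v) \<tau>"
    by (rule Lim_in_closed_set[OF closed_region _ trivial_limit_sequentially, rotated])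
qed

section \<open>Likelihood ratio tests\<close>

text \<open>A memoryless channel used n times on the one letter of type \<open>unit\<close>, so that
  every lemma on \<open>dmc\<close> covers independent sampling too.\<close>

abbreviation iid :: "nat \<Rightarrow> 'a pmf \<Rightarrow> 'a list pmf" where
  "iid n p \<equiv> dmc (\<lambda>_. p) (replicate n ())"

lemma fin_iid: "fin p \<Longrightarrow> fin (iid n p)"
  by (rule fin_dmc)

lemma length_iid: "xs \<in> set_pmf (iid n p) \<Longrightarrow> length xs = n"
  by (drule length_dmc) simp

lemma set_iid: "xs \<in> set_pmf (iid n p) \<Longrightarrow> set xs \<subseteq> set_pmf p"
  by (induction n arbitrary: xs) (simp, fastforce simp: dmc_Cons)

lemma E_prod_iid: "fin p \<Longrightarrow> E (iid n p) (\<lambda>ys. \<Prod>y\<leftarrow>ys. f y) = E p f ^ n"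
  by (induction n) (simp_all add: dmc_Cons E_bind fin_dmc)

lemma E_sum_iid: "fin p \<Longrightarrow> E (iid n p) (\<lambda>ys. \<Sum>y\<leftarrow>ys. f y) = real n * E p f"
  by (simp add: E_sum_dmc sum_list_replicate)

text \<open>The cross terms vanish by independence and zero mean.\<close>

lemma E_square_sum_iid:
  assumes "fin p" "E p f = 0"
  shows "E (iid n p) (\<lambda>ys. (\<Sum>y\<leftarrow>ys. f y)\<^sup>2) = real n * E p (\<lambda>y. (f y)\<^sup>2)"
proof (induction n)
  case (Suc n)
  have [simp]: "fin (iid n p)" using assms by (rule_tac fin_iid)
  have "E (iid (Suc n) p) (\<lambda>ys. (\<Sum>y\<leftarrow>ys. f y)\<^sup>2) =
      E p (\<lambda>y. E (iid n p) (\<lambda>ys. (f y)\<^sup>2 + 2 * f y * (\<Sum>y\<leftarrow>ys. f y) + (\<Sum>y\<leftarrow>ys. f y)\<^sup>2))"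
    using assms by (simp add: dmc_Cons E_bind power2_sum algebra_simps)
  also have "\<dots> = E p (\<lambda>y. (f y)\<^sup>2 + real n * E p (\<lambda>y. (f y)\<^sup>2))"
    by (intro E_cong) (simp add: E_add E_sum_iid assms Suc)
  finally show ?case using assms by (simp add: E_add algebra_simps)
qed simp

text \<open>Chebyshev's inequality for the lower tail.\<close>

lemma weak_law:
  assumes "fin p" "r < E p f"
  shows "(\<lambda>n. measure_pmf.prob (iid n p) {ys. (\<Sum>y\<leftarrow>ys. f y) < real n * r}) \<longlonglongrightarrow> 0"
proof -
  define m where "m = E p f"
  define V where "V = E p (\<lambda>y. (f y - m)\<^sup>2)"
  have sub: "(\<Sum>y\<leftarrow>ys. f y - m) = (\<Sum>y\<leftarrow>ys. f y) - real (length ys) * m" for ys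
    by (induction ys) (auto simp: algebra_simps)
  have bound: "measure_pmf.prob (iid n p) {ys. (\<Sum>y\<leftarrow>ys. f y) < real n * r} \<le> V / (m - r)\<^sup>2 / real n" if "n > 0" for n
  proof -
    let ?A = "{ys. (\<Sum>y\<leftarrow>ys. f y) < real n * r}"
    have mr: "m - r > 0" using assms by (simp add: m_def)
    have "measure_pmf.prob (iid n p) ?A = E (iid n p) (indicator ?A)" by simp
    also have "\<dots> \<le> E (iid n p) (\<lambda>ys. (\<Sum>y\<leftarrow>ys. f y - m)\<^sup>2 / (real n * (m - r))\<^sup>2)"
    proof (rule E_mono[OF fin_iid[OF assms(1)]])
      fix ys assume "ys \<in> set_pmf (iid n p)"
      then have len: "length ys = n" by (rule length_iid)
      show "indicator ?A ys \<le> (\<Sum>y\<leftarrow>ys. f y - m)\<^sup>2 / (real n * (m - r))\<^sup>2"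
      proof (cases "ys \<in> ?A")
        case True
        then have "real n * (m - r) \<le> \<bar>\<Sum>y\<leftarrow>ys. f y - m\<bar>"
          unfolding sub len by (simp add: algebra_simps)
        then have "(real n * (m - r))\<^sup>2 \<le> (\<Sum>y\<leftarrow>ys. f y - m)\<^sup>2"
          using mr by (metis abs_le_square_iff abs_of_nonneg less_eq_real_def mult_nonneg_nonneg of_nat_0_le_iff)
        then show ?thesis using True mr \<open>n > 0\<close> by (simp add: field_simps)
      qed simp
    qed
    also have "\<dots> = real n * V / (real n * (m - r))\<^sup>2"
      using assms(1) unfolding V_def by (simp add: E_square_sum_iid E_diff m_def)
    also have "\<dots> = V / (m - r)\<^sup>2 / real n"
      using \<open>n > 0\<close> by (simp add: power2_eq_square)
    finally show ?thesis .
  qed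
  have lim: "(\<lambda>n. V / (m - r)\<^sup>2 / real n) \<longlonglongrightarrow> 0"
    by (rule lim_const_over_n)
  show ?thesis
    by (rule tendsto_sandwich[OF _ _ tendsto_const lim])
       (use bound in \<open>auto intro!: eventually_mono[OF eventually_gt_at_top[of 0]]\<close>)
qed

text \<open>The test accepts when the product of the values of \<open>L\<close> reaches 2^(n r).
  Under \<open>Q\<close> Markov's inequality applies, the product having mean at most 1; under
  \<open>P\<close> the mean of log L exceeds r, so the weak law yields acceptance. This takes the
  place of joint typicality.\<close>

lemma likelihood_ratio_test:
  assumes fin: "fin P" "fin Q" and L0: "\<And>z. 0 \<le> L z" and L1: "E Q L \<le> 1"
    and pos: "\<And>z. z \<in> set_pmf P \<Longrightarrow> 0 < L z" and r: "r < E P (\<lambda>z. log 2 (L z))"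
  shows "\<exists>T. (\<forall>n. measure_pmf.prob (iid n Q) (T n) \<le> 2 powr - (real n * r)) \<and>
    (\<lambda>n. measure_pmf.prob (iid n P) (- T n)) \<longlonglongrightarrow> 0"
proof (intro exI conjI allI)
  define T where "T n = {zs. 2 powr (real n * r) \<le> (\<Prod>z\<leftarrow>zs. L z)}" for n
  have prod0: "0 \<le> (\<Prod>z\<leftarrow>zs. L z)" for zs
    using L0 by (induction zs) auto
  show "measure_pmf.prob (iid n Q) (T n) \<le> 2 powr - (real n * r)" for n
  proof -
    have "measure_pmf.prob (iid n Q) (T n) = E (iid n Q) (indicator (T n))" by simp
    also have "\<dots> \<le> E (iid n Q) (\<lambda>zs. 2 powr - (real n * r) * (\<Prod>z\<leftarrow>zs. L z))"
    proof (intro E_mono fin_iid fin)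
      show "indicator (T n) zs \<le> 2 powr - (real n * r) * (\<Prod>z\<leftarrow>zs. L z)" for zs
        using prod0[of zs] by (auto simp: T_def indicator_def powr_minus field_simps)
    qed
    also have "\<dots> = 2 powr - (real n * r) * E Q L ^ n"
      using fin by (simp add: E_prod_iid)
    also have "\<dots> \<le> 2 powr - (real n * r) * 1"
      using L0 L1 by (intro mult_left_mono power_le_one integral_nonneg_AE) auto
    finally show ?thesis by simp
  qed
  have "measure_pmf.prob (iid n P) (- T n) \<le>
      measure_pmf.prob (iid n P) {zs. (\<Sum>z\<leftarrow>zs. log 2 (L z)) < real n * r}" for n
  proof -
    have "zs \<in> {zs. (\<Sum>z\<leftarrow>zs. log 2 (L z)) < real n * r}" if "zs \<in> - T n" "zs \<in> set_pmf (iid n P)" for zs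
    proof -
      have "\<forall>z\<in>set zs. 0 < L z" using set_iid[OF that(2)] pos by auto
      then have "0 < (\<Prod>z\<leftarrow>zs. L z) \<and> log 2 (\<Prod>z\<leftarrow>zs. L z) = (\<Sum>z\<leftarrow>zs. log 2 (L z))"
        by (induction zs) (auto simp: log_mult_pos)
      moreover have "(\<Prod>z\<leftarrow>zs. L z) < 2 powr (real n * r)" using that(1) by (simp add: T_def)
      ultimately show ?thesis
        by (metis less_powr_iff log_less_iff mem_Collect_eq one_less_numeral_iff semiring_norm(76))
    qed
    then have "measure_pmf.prob (iid n P) (- T n \<inter> set_pmf (iid n P)) \<le>
      measure_pmf.prob (iid n P) {zs. (\<Sum>z\<leftarrow>zs. log 2 (L z)) < real n * r}"
      by (intro measure_pmf.finite_measure_mono) auto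
    then show ?thesis by (simp add: measure_Int_set_pmf)
  qed
  then show "(\<lambda>n. measure_pmf.prob (iid n P) (- T n)) \<longlonglongrightarrow> 0"
    by (intro tendsto_sandwich[OF _ _ tendsto_const weak_law[OF fin(1) r]]) auto
qed

text \<open>Here \<open>b\<close> is a letter of a candidate codeword, \<open>S b\<close> the law of
  the output if that candidate was sent and \<open>Q b\<close> its law if another one was. The
  threshold, the mean of log (S/Q), is written as cross entropy minus entropy because for all five
  choices of \<open>Q\<close> made later the cross entropy averages to the entropy of an output
  mixture.\<close>

lemma channel_test:
  fixes S Q :: "'b \<Rightarrow> 'y::finite pmf"
  assumes fin: "fin p" and supp: "\<And>b. b \<in> set_pmf p \<Longrightarrow> set_pmf (S b) \<subseteq> set_pmf (Q b)"
    and r: "r < E p (\<lambda>b. E (S b) (\<lambda>y. - log 2 (pmf (Q b) y))) - E p (\<lambda>b. H (S b))"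
  shows "\<exists>T. (\<forall>n. measure_pmf.prob (iid n (joint p Q)) (T n) \<le> 2 powr - (real n * r)) \<and>
    (\<lambda>n. measure_pmf.prob (iid n (joint p S)) (- T n)) \<longlonglongrightarrow> 0"
proof (rule likelihood_ratio_test[where L = "\<lambda>(b, y). pmf (S b) y / pmf (Q b) y"])
  show "fin (joint p S)" "fin (joint p Q)" using fin by (auto intro: fin_joint)
  show "E (joint p Q) (\<lambda>(b, y). pmf (S b) y / pmf (Q b) y) \<le> 1"
  proof -
    have "E (Q b) (\<lambda>y. pmf (S b) y / pmf (Q b) y) \<le> 1" for b
    proof -
      have "E (Q b) (\<lambda>y. pmf (S b) y / pmf (Q b) y) = (\<Sum>y\<in>set_pmf (Q b). pmf (S b) y)"
        by (simp add: E_eq_sum set_pmf_iff)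
      also have "\<dots> \<le> 1" by (simp flip: measure_measure_pmf_finite)
      finally show ?thesis .
    qed
    then have "E p (\<lambda>b. E (Q b) (\<lambda>y. pmf (S b) y / pmf (Q b) y)) \<le> E p (\<lambda>_. 1)"
      by (intro E_mono fin)
    then show ?thesis using fin by (simp add: E_joint)
  qed
  show "r < E (joint p S) (\<lambda>z. log 2 (case z of (b, y) \<Rightarrow> pmf (S b) y / pmf (Q b) y))"
  proof -
    have "E (joint p S) (\<lambda>z. log 2 (case z of (b, y) \<Rightarrow> pmf (S b) y / pmf (Q b) y)) =
        E p (\<lambda>b. E (S b) (\<lambda>y. log 2 (pmf (S b) y / pmf (Q b) y)))"
      using fin by (simp add: E_joint)
    also have "\<dots> = E p (\<lambda>b. E (S b) (\<lambda>y. - log 2 (pmf (Q b) y) - - log 2 (pmf (S b) y)))"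
    proof (intro E_cong)
      fix b y assume "b \<in> set_pmf p" "y \<in> set_pmf (S b)"
      then have "0 < pmf (S b) y" "0 < pmf (Q b) y" using supp by (auto intro!: pmf_positive)
      then show "log 2 (pmf (S b) y / pmf (Q b) y) = - log 2 (pmf (Q b) y) - - log 2 (pmf (S b) y)"
        by (simp add: log_divide_pos)
    qed
    also have "\<dots> = E p (\<lambda>b. E (S b) (\<lambda>y. - log 2 (pmf (Q b) y)) - H (S b))"
      unfolding H_def by (intro E_cong E_diff) simp
    also have "\<dots> = E p (\<lambda>b. E (S b) (\<lambda>y. - log 2 (pmf (Q b) y))) - E p (\<lambda>b. H (S b))"
      by (rule E_diff[OF fin])
    finally show ?thesis using r by simp
  qed
qed (use supp in \<open>auto simp: set_joint intro!: divide_pos_pos pmf_positive\<close>)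

section \<open>Random superposition codes\<close>

lemma E_Pi1:
  assumes "finite A" "i \<in> A"
  shows "E (Pi_pmf A d p) (\<lambda>f. G (f i)) = E (p i) G"
proof -
  have "E (Pi_pmf A d p) (\<lambda>f. G (f i)) = E (map_pmf (\<lambda>f. f i) (Pi_pmf A d p)) G"
    by (rule integral_map_pmf[symmetric])
  then show ?thesis by (simp only: Pi_pmf_component[OF assms(1)] assms(2) if_True)
qed

text \<open>Pairwise independence of codewords: a union bound compares the sent codeword with one
  wrong codeword at a time.\<close>

lemma E_Pi2:
  assumes "finite A" "i \<in> A" "i' \<in> A" "i \<noteq> i'" "\<And>j. j \<in> A \<Longrightarrow> fin (p j)"
  shows "E (Pi_pmf A d p) (\<lambda>f. G (f i) (f i')) = E (p i) (\<lambda>a. E (p i') (\<lambda>b. G a b))"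
proof -
  have A: "A = insert i (A - {i})" using assms by auto
  have fin: "fin (Pi_pmf (A - {i}) d p)"
    using assms by (intro finite_subset[OF set_Pi_pmf_subset']) auto
  have "E (Pi_pmf A d p) (\<lambda>f. G (f i) (f i')) =
      E (p i \<bind> (\<lambda>y. map_pmf (\<lambda>f. f(i := y)) (Pi_pmf (A - {i}) d p))) (\<lambda>f. G (f i) (f i'))"
    by (subst A, subst Pi_pmf_insert') (use assms in \<open>simp_all add: map_pmf_def\<close>)
  also have "\<dots> = E (p i) (\<lambda>a. E (Pi_pmf (A - {i}) d p) (\<lambda>f. G a (f i')))"
    using assms fin by (subst E_bind) auto
  also have "\<dots> = E (p i) (\<lambda>a. E (p i') (\<lambda>b. G a b))"
    using assms by (intro E_cong E_Pi1) auto
  finally show ?thesis .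
qed

lemma fin_Pi: "finite A \<Longrightarrow> (\<And>j. j \<in> A \<Longrightarrow> fin (p j)) \<Longrightarrow> fin (Pi_pmf A d p)"
  by (rule finite_subset[OF set_Pi_pmf_subset'], assumption, rule finite_PiE_dflt) simp_all

lemma ex_le_expectation:
  assumes "fin p" "E p f \<le> b"
  shows "\<exists>x\<in>set_pmf p. f x \<le> b"
proof (rule ccontr)
  assume "\<not> ?thesis"
  then have less: "\<And>x. x \<in> set_pmf p \<Longrightarrow> b < f x" by force
  have "(\<Sum>x\<in>set_pmf p. pmf p x * b) < (\<Sum>x\<in>set_pmf p. pmf p x * f x)"
    using assms(1) less set_pmf_not_empty[of p]
    by (intro sum_strict_mono) (auto simp: pmf_positive)
  then have "b < E p f"
    using assms(1) by (simp add: E_eq_sum sum_pmf_eq_1 flip: sum_distrib_right)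
  with assms show False by simp
qed

text \<open>When no message or several messages pass the test the value is an arbitrary choice; the
  bound below counts every such case as an error.\<close>

definition unique_decoder :: "'m set \<Rightarrow> ('m \<Rightarrow> 'y \<Rightarrow> bool) \<Rightarrow> 'y \<Rightarrow> 'm" where
  "unique_decoder M T y = (SOME m. m \<in> M \<and> T m y)"

lemma prob_unique_decoder:
  assumes "finite M" "m \<in> M"
  shows "measure_pmf.prob q {y. unique_decoder M T y \<noteq> m} \<le>
    measure_pmf.prob q {y. \<not> T m y} + (\<Sum>m'\<in>M - {m}. measure_pmf.prob q {y. T m' y})"
proof -
  have "{y. unique_decoder M T y \<noteq> m} \<subseteq> {y. \<not> T m y} \<union> (\<Union>m'\<in>M - {m}. {y. T m' y})"
  proof (intro subsetI, rule ccontr)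
    fix y assume y: "y \<in> {y. unique_decoder M T y \<noteq> m}"
      and "y \<notin> {y. \<not> T m y} \<union> (\<Union>m'\<in>M - {m}. {y. T m' y})"
    then have "T m y" and only: "\<And>m'. m' \<in> M \<and> T m' y \<Longrightarrow> m' = m" by auto
    from \<open>T m y\<close> have "unique_decoder M T y = m"
      unfolding unique_decoder_def using assms(2) only by (intro some_equality) blast+
    with y show False by simp
  qed
  then have "measure_pmf.prob q {y. unique_decoder M T y \<noteq> m} \<le>
      measure_pmf.prob q ({y. \<not> T m y} \<union> (\<Union>m'\<in>M - {m}. {y. T m' y}))"
    by (intro measure_pmf.finite_measure_mono) auto
  also have "\<dots> \<le> measure_pmf.prob q {y. \<not> T m y} + measure_pmf.prob q (\<Union>m'\<in>M - {m}. {y. T m' y})"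
    by (intro measure_subadditive) auto
  also have "measure_pmf.prob q (\<Union>m'\<in>M - {m}. {y. T m' y}) \<le> (\<Sum>m'\<in>M - {m}. measure_pmf.prob q {y. T m' y})"
    using assms by (intro measure_pmf.finite_measure_subadditive_finite) auto
  finally show ?thesis by simp
qed

lemma prob_joint: "measure_pmf.prob (joint p K) A = E p (\<lambda>x. measure_pmf.prob (K x) {y. (x, y) \<in> A})"
  unfolding joint_def by (simp add: prob_bind vimage_def)

lemma card_remove_real:
  assumes "finite A" "a \<in> A"
  shows "real (card (A - {a})) = real (card A) - 1"
  using card.remove[OF assms] by simp

text \<open>The random coding bound for abstract alphabets, later used with words as letters. Each
  index in \<open>C\<close> gets an independent cloud centre, with satellites independent given the
  centre; Receiver 2 tests only the centre together with the word of Transmitter 2. After the two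
  terms for rejecting the truth, the summands of \<open>bound\<close> belong to a wrong satellite in
  the right cloud, a wrong cloud at Receiver 1, a wrong cloud with the right word of Transmitter 2,
  the right cloud with a wrong word, and both wrong. The message law \<open>\<mu>\<close> is
  arbitrary since splitting a private message need not give uniform indices. The support clauses
  later yield the word lengths.\<close>

lemma superposition_code:
  fixes PU :: "'u pmf" and PX :: "'u \<Rightarrow> 'x pmf" and PV :: "'v pmf"
    and K1 :: "'x \<Rightarrow> 'y pmf" and K2 :: "'x \<Rightarrow> 'v \<Rightarrow> 'z pmf"
    and C :: "'i set" and S :: "'j set" and D :: "'k set"
    and T1 :: "(('u \<times> 'x) \<times> 'y) set" and T2 :: "(('u \<times> 'v) \<times> 'z) set"
  assumes fin: "fin PU" "\<And>u. u \<in> set_pmf PU \<Longrightarrow> fin (PX u)" "fin PV"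
    and finite: "finite C" "finite S" "finite D" and \<mu>: "set_pmf \<mu> \<subseteq> C \<times> S \<times> D"
  defines "B1 \<equiv> joint PU PX" and "B2 \<equiv> joint PU (\<lambda>_. PV)"
    and "S1 \<equiv> (\<lambda>(u, x). K1 x)" and "S2 \<equiv> (\<lambda>(u, v). PX u \<bind> (\<lambda>x. K2 x v))"
  defines "bound \<equiv>
      measure_pmf.prob (joint B1 S1) (- T1) + measure_pmf.prob (joint B2 S2) (- T2) +
      (real (card S) - 1) * measure_pmf.prob (joint B1 (\<lambda>(u, x). PX u \<bind> K1)) T1 +
      (real (card C) - 1) * real (card S) * measure_pmf.prob (joint B1 (\<lambda>_. B1 \<bind> S1)) T1 +
      (real (card C) - 1) * measure_pmf.prob (joint B2 (\<lambda>(u, v). PU \<bind> (\<lambda>u. S2 (u, v)))) T2 +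
      (real (card D) - 1) * measure_pmf.prob (joint B2 (\<lambda>(u, v). PV \<bind> (\<lambda>v. S2 (u, v)))) T2 +
      (real (card C) - 1) * (real (card D) - 1) * measure_pmf.prob (joint B2 (\<lambda>_. B2 \<bind> S2)) T2"
  shows "\<exists>x v d1 d2. (\<forall>i\<in>C. \<forall>j\<in>S. x i j \<in> set_pmf (PU \<bind> PX)) \<and> (\<forall>k\<in>D. v k \<in> set_pmf PV) \<and>
    E \<mu> (\<lambda>(i, j, k). measure_pmf.prob (K1 (x i j)) {y. d1 y \<noteq> (i, j)} +
      measure_pmf.prob (K2 (x i j) (v k)) {z. d2 z \<noteq> (i, k)}) \<le> bound"
proof -
  \<comment> \<open>The law of one cloud, its centre with all its satellites. In \<open>F\<close>
    the clouds are drawn independently.\<close>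
  define \<Lambda> where "\<Lambda> = joint PU (\<lambda>u. Pi_pmf S undefined (\<lambda>_. PX u))"
  define F where "F = Pi_pmf C undefined (\<lambda>_. \<Lambda>)"
  define G where "G = Pi_pmf D undefined (\<lambda>_. PV)"
  have fin\<Lambda>: "fin \<Lambda>" unfolding \<Lambda>_def by (intro fin_joint fin_Pi fin finite)
  have finF: "fin F" unfolding F_def by (intro fin_Pi fin\<Lambda> finite)
  have finG: "fin G" unfolding G_def by (intro fin_Pi fin finite)
  have E\<Lambda>: "E \<Lambda> g = E PU (\<lambda>u. E (Pi_pmf S undefined (\<lambda>_. PX u)) (\<lambda>h. g (u, h)))" for g
    unfolding \<Lambda>_def by (intro E_joint fin fin_Pi finite)
  have E\<Lambda>0: "E \<Lambda> (\<lambda>a. g (fst a)) = E PU g" for g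
    unfolding E\<Lambda> by simp
  have E\<Lambda>1: "E \<Lambda> (\<lambda>a. g (fst a) (snd a j)) = E PU (\<lambda>u. E (PX u) (g u))" if "j \<in> S" for g j
    unfolding E\<Lambda> using that finite by (simp add: E_Pi1)
  have E\<Lambda>2: "E \<Lambda> (\<lambda>a. g (fst a) (snd a j) (snd a j')) = E PU (\<lambda>u. E (PX u) (\<lambda>x. E (PX u) (g u x)))"
    if "j \<in> S" "j' \<in> S" "j \<noteq> j'" for g j j'
    unfolding E\<Lambda> using that finite fin by (intro E_cong) (simp add: E_Pi2)
  have EF1: "E F (\<lambda>f. g (f i)) = E \<Lambda> g" if "i \<in> C" for g i
    unfolding F_def using that finite by (simp add: E_Pi1)
  have EF2: "E F (\<lambda>f. g (f i) (f i')) = E \<Lambda> (\<lambda>a. E \<Lambda> (g a))" if "i \<in> C" "i' \<in> C" "i \<noteq> i'" for g i i'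
    unfolding F_def using that finite fin\<Lambda> by (simp add: E_Pi2)
  have EG1: "E G (\<lambda>e. g (e k)) = E PV g" if "k \<in> D" for g k
    unfolding G_def using that finite by (simp add: E_Pi1)
  have EG2: "E G (\<lambda>e. g (e k) (e k')) = E PV (\<lambda>a. E PV (g a))" if "k \<in> D" "k' \<in> D" "k \<noteq> k'" for g k k'
    unfolding G_def using that finite fin by (simp add: E_Pi2)

  define t1 where "t1 f = (\<lambda>(i, j) y. ((fst (f i), snd (f i) j), y) \<in> T1)" for f :: "'i \<Rightarrow> 'u \<times> ('j \<Rightarrow> 'x)"
  define t2 where "t2 f e = (\<lambda>(i, k) z. ((fst (f i), e k), z) \<in> T2)" for f :: "'i \<Rightarrow> 'u \<times> ('j \<Rightarrow> 'x)" and e :: "'k \<Rightarrow> 'v"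
  define e1 where "e1 f = (\<lambda>(i, j). measure_pmf.prob (K1 (snd (f i) j)) {y. unique_decoder (C \<times> S) (t1 f) y \<noteq> (i, j)})" for f
  define e2 where "e2 f e = (\<lambda>(i, j, k). measure_pmf.prob (K2 (snd (f i) j) (e k)) {z. unique_decoder (C \<times> D) (t2 f e) z \<noteq> (i, k)})" for f e

  let ?\<alpha>0 = "measure_pmf.prob (joint B1 S1) (- T1)"
  let ?\<alpha>1 = "measure_pmf.prob (joint B1 (\<lambda>(u, x). PX u \<bind> K1)) T1"
  let ?\<alpha>2 = "measure_pmf.prob (joint B1 (\<lambda>_. B1 \<bind> S1)) T1"
  let ?\<beta>0 = "measure_pmf.prob (joint B2 S2) (- T2)"
  let ?\<beta>1 = "measure_pmf.prob (joint B2 (\<lambda>(u, v). PU \<bind> (\<lambda>u. S2 (u, v)))) T2"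
  let ?\<beta>2 = "measure_pmf.prob (joint B2 (\<lambda>(u, v). PV \<bind> (\<lambda>v. S2 (u, v)))) T2"
  let ?\<beta>3 = "measure_pmf.prob (joint B2 (\<lambda>_. B2 \<bind> S2)) T2"
  have EB1: "E B1 g = E PU (\<lambda>u. E (PX u) (\<lambda>x. g (u, x)))" for g
    unfolding B1_def by (intro E_joint fin)
  have EB2: "E B2 g = E PU (\<lambda>u. E PV (\<lambda>v. g (u, v)))" for g
    unfolding B2_def by (intro E_joint fin)
  have err1: "E F (\<lambda>f. e1 f (i, j)) \<le> ?\<alpha>0 + (real (card S) - 1) * ?\<alpha>1 + (real (card C) - 1) * real (card S) * ?\<alpha>2"
    if i: "i \<in> C" and j: "j \<in> S" for i j
  proof -
    let ?p = "\<lambda>f m. measure_pmf.prob (K1 (snd (f i) j)) {y. t1 f m y}"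
    have split: "C \<times> S - {(i, j)} = (Pair i ` (S - {j})) \<union> (C - {i}) \<times> S" using i j by auto
    have "E F (\<lambda>f. e1 f (i, j)) \<le> E F (\<lambda>f. measure_pmf.prob (K1 (snd (f i) j)) {y. \<not> t1 f (i, j) y} +
        (\<Sum>m\<in>C \<times> S - {(i, j)}. ?p f m))"
      unfolding e1_def prod.case using i j finite
      by (intro E_mono finF prob_unique_decoder) auto
    also have "\<dots> = E F (\<lambda>f. measure_pmf.prob (K1 (snd (f i) j)) {y. \<not> t1 f (i, j) y}) +
        (\<Sum>m\<in>C \<times> S - {(i, j)}. E F (\<lambda>f. ?p f m))"
      using finF by (simp add: E_add E_sum)
    also have "(\<Sum>m\<in>C \<times> S - {(i, j)}. E F (\<lambda>f. ?p f m)) =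
        (\<Sum>j'\<in>S - {j}. E F (\<lambda>f. ?p f (i, j'))) + (\<Sum>m\<in>(C - {i}) \<times> S. E F (\<lambda>f. ?p f m))"
      unfolding split using finite
      by (subst sum.union_disjoint) (auto simp: sum.reindex inj_on_def)
    also have "(\<Sum>j'\<in>S - {j}. E F (\<lambda>f. ?p f (i, j'))) = (\<Sum>j'\<in>S - {j}. ?\<alpha>1)"
    proof (rule sum.cong[OF refl])
      fix j' assume j': "j' \<in> S - {j}"
      have "E F (\<lambda>f. ?p f (i, j')) = E \<Lambda> (\<lambda>a. measure_pmf.prob (K1 (snd a j)) {y. ((fst a, snd a j'), y) \<in> T1})"
        unfolding t1_def prod.case using EF1[OF i] .
      also have "\<dots> = E PU (\<lambda>u. E (PX u) (\<lambda>x. E (PX u) (\<lambda>x'. measure_pmf.prob (K1 x) {y. ((u, x'), y) \<in> T1})))"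
        using j' j by (subst E\<Lambda>2) auto
      \<comment> \<open>Given the centre, sent and wrong satellite are independent, so averaging
        over the sent one leaves an output that depends on the tested pair only through u.\<close>
      also have "\<dots> = E PU (\<lambda>u. E (PX u) (\<lambda>x'. E (PX u) (\<lambda>x. measure_pmf.prob (K1 x) {y. ((u, x'), y) \<in> T1})))"
        by (intro E_cong E_swap fin)
      also have "\<dots> = ?\<alpha>1" by (simp add: prob_joint EB1 prob_bind)
      finally show "E F (\<lambda>f. ?p f (i, j')) = ?\<alpha>1" .
    qed
    also have "(\<Sum>m\<in>(C - {i}) \<times> S. E F (\<lambda>f. ?p f m)) = (\<Sum>m\<in>(C - {i}) \<times> S. ?\<alpha>2)"
    proof (rule sum.cong[OF refl])
      fix m assume m: "m \<in> (C - {i}) \<times> S"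
      obtain i' j' where m': "m = (i', j')" by (cases m) auto
      \<comment> \<open>Different clouds are independent, so the output is independent of the whole
        tested pair and has its unconditional law.\<close>
      have "E F (\<lambda>f. ?p f m) = E \<Lambda> (\<lambda>a. E \<Lambda> (\<lambda>b. measure_pmf.prob (K1 (snd a j)) {y. ((fst b, snd b j'), y) \<in> T1}))"
        unfolding t1_def m' prod.case using EF2[OF i, of i'] m m' by auto
      also have "\<dots> = E \<Lambda> (\<lambda>b. E \<Lambda> (\<lambda>a. measure_pmf.prob (K1 (snd a j)) {y. ((fst b, snd b j'), y) \<in> T1}))"
        by (intro E_swap fin\<Lambda>)
      also have "\<dots> = E \<Lambda> (\<lambda>b. measure_pmf.prob (B1 \<bind> S1) {y. ((fst b, snd b j'), y) \<in> T1})"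
        using E\<Lambda>1[OF j, of "\<lambda>u x. measure_pmf.prob (K1 x) {y. ((fst b, snd b j'), y) \<in> T1}" for b]
        by (simp add: prob_bind EB1 S1_def)
      also have "\<dots> = ?\<alpha>2"
        using E\<Lambda>1[of j' "\<lambda>u x. measure_pmf.prob (B1 \<bind> S1) {y. ((u, x), y) \<in> T1}"] m m'
        by (simp add: prob_joint EB1)
      finally show "E F (\<lambda>f. ?p f m) = ?\<alpha>2" .
    qed
    also have "E F (\<lambda>f. measure_pmf.prob (K1 (snd (f i) j)) {y. \<not> t1 f (i, j) y}) = ?\<alpha>0"
    proof -
      have "E F (\<lambda>f. measure_pmf.prob (K1 (snd (f i) j)) {y. \<not> t1 f (i, j) y}) =
          E \<Lambda> (\<lambda>a. measure_pmf.prob (K1 (snd a j)) {y. ((fst a, snd a j), y) \<notin> T1})"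
        unfolding t1_def prod.case using EF1[OF i] .
      also have "\<dots> = ?\<alpha>0"
        using E\<Lambda>1[OF j, of "\<lambda>u x. measure_pmf.prob (K1 x) {y. ((u, x), y) \<notin> T1}"]
        by (simp add: prob_joint EB1 S1_def)
      finally show ?thesis .
    qed
    finally show ?thesis
      by (simp add: card_remove_real[OF finite(1) i] card_remove_real[OF finite(2) j] card_cartesian_product
          mult.assoc del: card_Diff_insert card_Diff_singleton)
  qed

  have err2: "E F (\<lambda>f. E G (\<lambda>e. e2 f e (i, j, k))) \<le> ?\<beta>0 + (real (card C) - 1) * ?\<beta>1 + (real (card D) - 1) * ?\<beta>2 +
      (real (card C) - 1) * (real (card D) - 1) * ?\<beta>3"
    if i: "i \<in> C" and j: "j \<in> S" and k: "k \<in> D" for i j k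
  proof -
    let ?p = "\<lambda>f e m. measure_pmf.prob (K2 (snd (f i) j) (e k)) {z. t2 f e m z}"
    let ?q = "\<lambda>x v u v'. measure_pmf.prob (K2 x v) {z. ((u, v'), z) \<in> T2}"
    \<comment> \<open>Wrong pairs are sorted by which component is wrong, because the output depends
      on the tested pair differently in each case.\<close>
    have split: "C \<times> D - {(i, k)} = (\<lambda>i'. (i', k)) ` (C - {i}) \<union> Pair i ` (D - {k}) \<union> (C - {i}) \<times> (D - {k})"
      using i k by auto
    have "E F (\<lambda>f. E G (\<lambda>e. e2 f e (i, j, k))) \<le>
        E F (\<lambda>f. E G (\<lambda>e. measure_pmf.prob (K2 (snd (f i) j) (e k)) {z. \<not> t2 f e (i, k) z} +
        (\<Sum>m\<in>C \<times> D - {(i, k)}. ?p f e m)))"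
      unfolding e2_def prod.case using i k finite
      by (intro E_mono finF finG prob_unique_decoder) auto
    also have "\<dots> = E F (\<lambda>f. E G (\<lambda>e. measure_pmf.prob (K2 (snd (f i) j) (e k)) {z. \<not> t2 f e (i, k) z})) +
        (\<Sum>m\<in>C \<times> D - {(i, k)}. E F (\<lambda>f. E G (\<lambda>e. ?p f e m)))"
      using finF finG by (simp add: E_add E_sum)
    also have "(\<Sum>m\<in>C \<times> D - {(i, k)}. E F (\<lambda>f. E G (\<lambda>e. ?p f e m))) =
        (\<Sum>i'\<in>C - {i}. E F (\<lambda>f. E G (\<lambda>e. ?p f e (i', k)))) +
        (\<Sum>k'\<in>D - {k}. E F (\<lambda>f. E G (\<lambda>e. ?p f e (i, k')))) +
        (\<Sum>m\<in>(C - {i}) \<times> (D - {k}). E F (\<lambda>f. E G (\<lambda>e. ?p f e m)))"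
      unfolding split using finite
      by (subst sum.union_disjoint, auto, subst sum.union_disjoint) (auto simp: sum.reindex inj_on_def)
    also have "(\<Sum>i'\<in>C - {i}. E F (\<lambda>f. E G (\<lambda>e. ?p f e (i', k)))) = (\<Sum>i'\<in>C - {i}. ?\<beta>1)"
    proof (rule sum.cong[OF refl])
      fix i' assume i': "i' \<in> C - {i}"
      have "E F (\<lambda>f. E G (\<lambda>e. ?p f e (i', k))) = E F (\<lambda>f. E PV (\<lambda>v. ?q (snd (f i) j) v (fst (f i')) v))"
        unfolding t2_def prod.case using EG1[OF k] by (intro E_cong)
      also have "\<dots> = E \<Lambda> (\<lambda>a. E \<Lambda> (\<lambda>b. E PV (\<lambda>v. ?q (snd a j) v (fst b) v)))"
        using EF2[OF i, of i'] i' by auto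
      also have "\<dots> = E PU (\<lambda>u. E (PX u) (\<lambda>x. E PU (\<lambda>u'. E PV (\<lambda>v. ?q x v u' v))))"
        by (simp add: E\<Lambda>0[of "\<lambda>u'. E PV (\<lambda>v. ?q (snd a j) v u' v)" for a]
            E\<Lambda>1[OF j, of "\<lambda>u x. E PU (\<lambda>u'. E PV (\<lambda>v. ?q x v u' v))"])
      also have "\<dots> = E B1 (\<lambda>b. E B2 (\<lambda>(u', v). ?q (snd b) v u' v))"
        by (simp add: EB1 EB2)
      also have "\<dots> = E B2 (\<lambda>(u', v). E B1 (\<lambda>b. ?q (snd b) v u' v))"
        by (subst E_swap) (use fin in \<open>auto simp: B1_def B2_def fin_joint case_prod_unfold\<close>)
      also have "\<dots> = ?\<beta>1"
        by (simp add: prob_joint prob_bind EB1 EB2 S2_def case_prod_unfold)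
      finally show "E F (\<lambda>f. E G (\<lambda>e. ?p f e (i', k))) = ?\<beta>1" .
    qed
    also have "(\<Sum>k'\<in>D - {k}. E F (\<lambda>f. E G (\<lambda>e. ?p f e (i, k')))) = (\<Sum>k'\<in>D - {k}. ?\<beta>2)"
    proof (rule sum.cong[OF refl])
      fix k' assume k': "k' \<in> D - {k}"
      have "E F (\<lambda>f. E G (\<lambda>e. ?p f e (i, k'))) = E F (\<lambda>f. E PV (\<lambda>v. E PV (\<lambda>v'. ?q (snd (f i) j) v (fst (f i)) v')))"
        unfolding t2_def prod.case using k' by (intro E_cong EG2 k) auto
      also have "\<dots> = E PU (\<lambda>u. E (PX u) (\<lambda>x. E PV (\<lambda>v. E PV (\<lambda>v'. ?q x v u v'))))"
        using EF1[OF i, of "\<lambda>a. E PV (\<lambda>v. E PV (\<lambda>v'. ?q (snd a j) v (fst a) v'))"]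
          E\<Lambda>1[OF j, of "\<lambda>u x. E PV (\<lambda>v. E PV (\<lambda>v'. ?q x v u v'))"] by simp
      \<comment> \<open>From here the tested word v' is moved outward past everything that was sent,
        so that for a fixed tested pair (u, v') the inner averages form the output law given
        u.\<close>
      also have "\<dots> = E PU (\<lambda>u. E (PX u) (\<lambda>x. E PV (\<lambda>v'. E PV (\<lambda>v. ?q x v u v'))))"
        by (intro E_cong E_swap fin)
      also have "\<dots> = E PU (\<lambda>u. E PV (\<lambda>v'. E (PX u) (\<lambda>x. E PV (\<lambda>v. ?q x v u v'))))"
        by (intro E_cong E_swap fin)
      also have "\<dots> = E PU (\<lambda>u. E PV (\<lambda>v'. E PV (\<lambda>v. E (PX u) (\<lambda>x. ?q x v u v'))))"
        by (intro E_cong E_swap fin)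
      also have "\<dots> = ?\<beta>2"
        by (simp add: prob_joint prob_bind EB2 S2_def)
      finally show "E F (\<lambda>f. E G (\<lambda>e. ?p f e (i, k'))) = ?\<beta>2" .
    qed
    also have "(\<Sum>m\<in>(C - {i}) \<times> (D - {k}). E F (\<lambda>f. E G (\<lambda>e. ?p f e m))) = (\<Sum>m\<in>(C - {i}) \<times> (D - {k}). ?\<beta>3)"
    proof (rule sum.cong[OF refl])
      fix m assume m: "m \<in> (C - {i}) \<times> (D - {k})"
      obtain i' k' where m': "m = (i', k')" by (cases m) auto
      have "E F (\<lambda>f. E G (\<lambda>e. ?p f e m)) = E F (\<lambda>f. E PV (\<lambda>v. E PV (\<lambda>v'. ?q (snd (f i) j) v (fst (f i')) v')))"
        unfolding t2_def m' prod.case using m m' by (intro E_cong EG2 k) auto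
      also have "\<dots> = E \<Lambda> (\<lambda>a. E \<Lambda> (\<lambda>b. E PV (\<lambda>v. E PV (\<lambda>v'. ?q (snd a j) v (fst b) v'))))"
        using EF2[OF i, of i'] m m' by auto
      also have "\<dots> = E PU (\<lambda>u. E (PX u) (\<lambda>x. E PU (\<lambda>u'. E PV (\<lambda>v. E PV (\<lambda>v'. ?q x v u' v')))))"
        by (simp add: E\<Lambda>0[of "\<lambda>u'. E PV (\<lambda>v. E PV (\<lambda>v'. ?q (snd a j) v u' v'))" for a]
            E\<Lambda>1[OF j, of "\<lambda>u x. E PU (\<lambda>u'. E PV (\<lambda>v. E PV (\<lambda>v'. ?q x v u' v')))"])
      also have "\<dots> = E PU (\<lambda>u. E (PX u) (\<lambda>x. E PV (\<lambda>v. E B2 (\<lambda>(u', v'). ?q x v u' v'))))"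
        unfolding EB2 prod.case by (intro E_cong E_swap fin)
      also have "\<dots> = E PU (\<lambda>u. E PV (\<lambda>v. E (PX u) (\<lambda>x. E B2 (\<lambda>(u', v'). ?q x v u' v'))))"
        by (intro E_cong E_swap fin)
      also have "\<dots> = E B2 (\<lambda>(u, v). E (PX u) (\<lambda>x. E B2 (\<lambda>(u', v'). ?q x v u' v')))"
        by (simp add: EB2)
      also have "\<dots> = E B2 (\<lambda>(u, v). E B2 (\<lambda>(u', v'). E (PX u) (\<lambda>x. ?q x v u' v')))"
      proof (intro E_cong, clarify)
        fix u v assume "(u, v) \<in> set_pmf B2"
        then have "fin (PX u)" using fin by (auto simp: B2_def set_joint)
        moreover have "fin B2" unfolding B2_def by (intro fin_joint fin)
        ultimately show "E (PX u) (\<lambda>x. E B2 (\<lambda>(u', v'). ?q x v u' v')) =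
            E B2 (\<lambda>(u', v'). E (PX u) (\<lambda>x. ?q x v u' v'))"
          by (subst E_swap) (simp_all add: case_prod_unfold)
      qed
      also have "\<dots> = E B2 (\<lambda>b. E B2 (\<lambda>b'. measure_pmf.prob (S2 b) {z. (b', z) \<in> T2}))"
        by (simp add: S2_def prob_bind case_prod_unfold)
      also have "\<dots> = E B2 (\<lambda>b'. E B2 (\<lambda>b. measure_pmf.prob (S2 b) {z. (b', z) \<in> T2}))"
        using fin by (intro E_swap) (auto simp: B2_def intro!: fin_joint)
      also have "\<dots> = ?\<beta>3"
        by (simp add: prob_joint prob_bind)
      finally show "E F (\<lambda>f. E G (\<lambda>e. ?p f e m)) = ?\<beta>3" .
    qed
    also have "E F (\<lambda>f. E G (\<lambda>e. measure_pmf.prob (K2 (snd (f i) j) (e k)) {z. \<not> t2 f e (i, k) z})) = ?\<beta>0"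
    proof -
      let ?q = "\<lambda>x v u. measure_pmf.prob (K2 x v) {z. ((u, v), z) \<notin> T2}"
      have "E F (\<lambda>f. E G (\<lambda>e. measure_pmf.prob (K2 (snd (f i) j) (e k)) {z. \<not> t2 f e (i, k) z})) =
          E F (\<lambda>f. E PV (\<lambda>v. ?q (snd (f i) j) v (fst (f i))))"
        unfolding t2_def prod.case using EG1[OF k] by (intro E_cong)
      also have "\<dots> = E PU (\<lambda>u. E (PX u) (\<lambda>x. E PV (\<lambda>v. ?q x v u)))"
        using EF1[OF i, of "\<lambda>a. E PV (\<lambda>v. ?q (snd a j) v (fst a))"]
          E\<Lambda>1[OF j, of "\<lambda>u x. E PV (\<lambda>v. ?q x v u)"] by simp
      also have "\<dots> = E PU (\<lambda>u. E PV (\<lambda>v. E (PX u) (\<lambda>x. ?q x v u)))"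
        by (intro E_cong E_swap fin)
      also have "\<dots> = ?\<beta>0"
        by (simp add: prob_joint prob_bind EB2 S2_def)
      finally show ?thesis .
    qed
    finally show ?thesis
      by (simp add: card_remove_real[OF finite(1) i] card_remove_real[OF finite(3) k] card_cartesian_product
          mult.assoc add.assoc del: card_Diff_insert card_Diff_singleton)
  qed

  have fin\<mu>: "fin \<mu>" using \<mu> finite by (meson finite_SigmaI finite_subset)
  have avg: "E (pair_pmf F G) (\<lambda>(f, e). E \<mu> (\<lambda>(i, j, k). e1 f (i, j) + e2 f e (i, j, k))) \<le> bound"
  proof -
    have pair: "E (pair_pmf F G) g = E F (\<lambda>f. E G (\<lambda>e. g (f, e)))" for g
      using finF finG by (simp add: pair_pmf_def E_bind)
    have "E (pair_pmf F G) (\<lambda>(f, e). E \<mu> (\<lambda>(i, j, k). e1 f (i, j) + e2 f e (i, j, k))) =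
        E \<mu> (\<lambda>m. E (pair_pmf F G) (\<lambda>(f, e). case m of (i, j, k) \<Rightarrow> e1 f (i, j) + e2 f e (i, j, k)))"
      using E_swap[of "pair_pmf F G" \<mu>] finF finG fin\<mu> by (simp add: case_prod_unfold)
    also have "\<dots> \<le> E \<mu> (\<lambda>_. bound)"
    proof (intro E_mono fin\<mu>)
      fix m assume "m \<in> set_pmf \<mu>"
      with \<mu> obtain i j k where m: "m = (i, j, k)" "i \<in> C" "j \<in> S" "k \<in> D" by auto
      have "E (pair_pmf F G) (\<lambda>(f, e). case m of (i, j, k) \<Rightarrow> e1 f (i, j) + e2 f e (i, j, k)) =
          E F (\<lambda>f. e1 f (i, j)) + E F (\<lambda>f. E G (\<lambda>e. e2 f e (i, j, k)))"
        using finF finG by (simp add: pair m E_add)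
      then show "E (pair_pmf F G) (\<lambda>(f, e). case m of (i, j, k) \<Rightarrow> e1 f (i, j) + e2 f e (i, j, k)) \<le> bound"
        using err1[OF m(2,3)] err2[OF m(2-4)] unfolding bound_def by linarith
    qed
    finally show ?thesis by simp
  qed
  \<comment> \<open>Some codebook in the support is no worse than the average.\<close>
  have "\<exists>z\<in>set_pmf (pair_pmf F G). (case z of (f, e) \<Rightarrow> E \<mu> (\<lambda>(i, j, k). e1 f (i, j) + e2 f e (i, j, k))) \<le> bound"
    by (rule ex_le_expectation[OF _ avg]) (simp add: finF finG)
  then obtain f e where fe: "f \<in> set_pmf F" "e \<in> set_pmf G"
    and le: "E \<mu> (\<lambda>(i, j, k). e1 f (i, j) + e2 f e (i, j, k)) \<le> bound"
    by auto
  show ?thesis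
  proof (intro exI conjI ballI)
    show "E \<mu> (\<lambda>(i, j, k). measure_pmf.prob (K1 (snd (f i) j)) {y. unique_decoder (C \<times> S) (t1 f) y \<noteq> (i, j)} +
      measure_pmf.prob (K2 (snd (f i) j) (e k)) {z. unique_decoder (C \<times> D) (t2 f e) z \<noteq> (i, k)}) \<le> bound"
      using le by (simp add: e1_def e2_def)
    fix i j assume ij: "i \<in> C" "j \<in> S"
    then have "f i \<in> set_pmf \<Lambda>"
      using fe(1) finite unfolding F_def by (auto simp: set_Pi_pmf PiE_dflt_def)
    then show "snd (f i) j \<in> set_pmf (PU \<bind> PX)"
      using ij finite unfolding \<Lambda>_def by (cases "f i") (force simp: set_joint set_Pi_pmf PiE_dflt_def)
  next
    fix k assume "k \<in> D"
    then show "e k \<in> set_pmf PV"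
      using fe(2) finite unfolding G_def by (auto simp: set_Pi_pmf PiE_dflt_def)
  qed
qed

section \<open>Achievability\<close>

lemma dmc_const: "length xs = length ys \<Longrightarrow> dmc (\<lambda>_. p) xs = dmc (\<lambda>_. p) ys"
  by (induction xs ys rule: list_induct2) (simp_all add: dmc_Cons)

lemma joint_cong: "p = q \<Longrightarrow> (\<And>x. x \<in> set_pmf q \<Longrightarrow> K x = L x) \<Longrightarrow> joint p K = joint q L"
  unfolding joint_def by (intro bind_pmf_cong) auto

text \<open>If the zipped codewords are independent letters and the block channel acts letterwise on
  them, the triple of words read as one word of triples is i.i.d.; the likelihood tests live on such
  words. The channel hypothesis is asked on the support, where lengths agree.\<close>

lemma prob_zip_joint:
  assumes B: "map_pmf (\<lambda>(us, xs). zip us xs) B = iid n b"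
    and S: "\<And>us xs. (us, xs) \<in> set_pmf B \<Longrightarrow> Sn (us, xs) = dmc S (zip us xs)"
  shows "measure_pmf.prob (joint B Sn) {((us, xs), ys). zip (zip us xs) ys \<in> T} =
    measure_pmf.prob (iid n (joint b S)) T"
proof -
  have "iid n (joint b S) = map_pmf (\<lambda>(bs, ys). zip bs ys) (joint (map_pmf (\<lambda>(us, xs). zip us xs) B) (dmc S))"
    unfolding B by (rule map_zip_jp_dmc[symmetric])
  also have "joint (map_pmf (\<lambda>(us, xs). zip us xs) B) (dmc S) =
      map_pmf (\<lambda>((us, xs), ys). (zip us xs, ys)) (joint B (\<lambda>(us, xs). dmc S (zip us xs)))"
    by (simp add: joint_def bind_map_pmf map_bind_pmf map_pmf_comp case_prod_unfold)
  also have "joint B (\<lambda>(us, xs). dmc S (zip us xs)) = joint B Sn"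
    using S by (intro joint_cong) auto
  finally show ?thesis
    by (auto simp: vimage_def case_prod_unfold intro!: arg_cong[where f="measure_pmf.prob (joint B Sn)"])
qed

lemma bind_zip_iid:
  assumes B: "map_pmf (\<lambda>(us, xs). zip us xs) B = iid n b"
    and S: "\<And>us xs. (us, xs) \<in> set_pmf B \<Longrightarrow> Sn (us, xs) = dmc S (zip us xs)"
  shows "B \<bind> Sn = iid n (b \<bind> S)"
proof -
  have "B \<bind> Sn = B \<bind> (\<lambda>(us, xs). dmc S (zip us xs))"
    using S by (intro bind_pmf_cong) auto
  also have "\<dots> = map_pmf (\<lambda>(us, xs). zip us xs) B \<bind> dmc S"
    by (simp add: bind_map_pmf case_prod_unfold)
  also have "\<dots> = iid n (b \<bind> S)"
    unfolding B by (rule dmc_bind)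
  finally show ?thesis .
qed

lemma dmc_zip_fst: "length us = length xs \<Longrightarrow> dmc (\<lambda>(u, x). K u) (zip us xs) = dmc K us"
  using dmc_map[of K fst "zip us xs"] by (simp add: case_prod_unfold)

lemma dmc_zip_snd: "length us = length xs \<Longrightarrow> dmc (\<lambda>(u, x). K x) (zip us xs) = dmc K xs"
  using dmc_map[of K snd "zip us xs"] by (simp add: case_prod_unfold)

text \<open>The output law when the first tested word is unrelated to the one sent: averaging over
  an independent first word leaves a memoryless channel that ignores the first letter.\<close>

lemma iid_bind_zip1:
  assumes "length us = n" "length vs = n"
  shows "iid n p \<bind> (\<lambda>us'. dmc S (zip us' vs)) = dmc (\<lambda>(u, v). p \<bind> (\<lambda>u'. S (u', v))) (zip us vs)"
  using assms by (subst dmc_bind_zip) (simp_all add: dmc_zip_snd)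

lemma iid_bind_zip2:
  assumes "length us = n" "length vs = n"
  shows "iid n p \<bind> (\<lambda>vs'. dmc S (zip us vs')) = dmc (\<lambda>(u, v). p \<bind> (\<lambda>v'. S (u, v'))) (zip us vs)"
proof -
  have "iid n p \<bind> (\<lambda>vs'. dmc S (zip us vs')) = iid n p \<bind> (\<lambda>vs'. dmc (\<lambda>z. S (prod.swap z)) (zip vs' us))"
  proof (intro bind_pmf_cong refl)
    fix vs' :: "'d list"
    have "dmc S (zip us vs') = dmc S (map prod.swap (zip vs' us))"
      by (subst zip_commute) (auto intro!: arg_cong[where f="dmc S"])
    then show "dmc S (zip us vs') = dmc (\<lambda>z. S (prod.swap z)) (zip vs' us)"
      by (simp add: dmc_map)
  qed
  also have "\<dots> = dmc (\<lambda>(v, u). p \<bind> (\<lambda>v'. S (u, v'))) (zip vs us)"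
    using assms by (subst iid_bind_zip1[where us = vs]) simp_all
  also have "\<dots> = dmc (\<lambda>(u, v). p \<bind> (\<lambda>v'. S (u, v'))) (zip us vs)"
    using assms by (simp add: dmc_zip_fst dmc_zip_snd)
  finally show ?thesis .
qed

lemma prob_not_Int_le: "measure_pmf.prob p (- (A \<inter> B)) \<le> measure_pmf.prob p (- A) + measure_pmf.prob p (- B)"
  unfolding Compl_Int by (intro measure_subadditive) auto

text \<open>Each receiver accepts a candidate only if all its tests do: \<open>Ta\<close> and
  \<open>Tb\<close> at Receiver 1; \<open>Tc\<close>, \<open>Td\<close> and \<open>Te\<close> at
  Receiver 2. The truth is rejected only if one of them fails, and each kind of wrong candidate is
  bounded through the single test built for that kind.\<close>

lemma n_letter_code:
  fixes p1 :: "'x1::finite \<Rightarrow> 'y1::finite pmf" and p2 :: "'x1 \<Rightarrow> 'x2::finite \<Rightarrow> 'y2::finite pmf"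
    and pW :: "'w pmf" and pX :: "'w \<Rightarrow> 'x1 pmf" and pV :: "'x2 pmf"
    and C :: "'i set" and J :: "'j set" and D :: "'k set"
  assumes fin: "fin pW" and finite: "finite C" "finite J" "finite D" and ne: "C \<noteq> {}" "J \<noteq> {}" "D \<noteq> {}"
    and \<mu>: "set_pmf \<mu> \<subseteq> C \<times> J \<times> D"
  defines "B1 \<equiv> joint pW pX" and "B2 \<equiv> joint pW (\<lambda>_. pV)"
    and "S1 \<equiv> (\<lambda>(w, x). p1 x)" and "S2 \<equiv> (\<lambda>(w, v). pX w \<bind> (\<lambda>x. p2 x v))"
  shows "\<exists>x v d1 d2. (\<forall>i\<in>C. \<forall>j\<in>J. length (x i j) = n) \<and> (\<forall>k\<in>D. length (v k) = n) \<and>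
    E \<mu> (\<lambda>(i, j, k). measure_pmf.prob (dmc p1 (x i j)) {y. d1 y \<noteq> (i, j)} +
      measure_pmf.prob (dmc2 p2 (x i j) (v k)) {z. d2 z \<noteq> (i, k)}) \<le>
      (measure_pmf.prob (iid n (joint B1 S1)) (- Ta) + measure_pmf.prob (iid n (joint B1 S1)) (- Tb)) +
      (measure_pmf.prob (iid n (joint B2 S2)) (- Tc) + (measure_pmf.prob (iid n (joint B2 S2)) (- Td) +
        measure_pmf.prob (iid n (joint B2 S2)) (- Te))) +
      (real (card J) - 1) * measure_pmf.prob (iid n (joint B1 (\<lambda>(w, x). pX w \<bind> p1))) Ta +
      (real (card C) - 1) * real (card J) * measure_pmf.prob (iid n (joint B1 (\<lambda>_. B1 \<bind> S1))) Tb +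
      (real (card C) - 1) * measure_pmf.prob (iid n (joint B2 (\<lambda>(w, v). pW \<bind> (\<lambda>w. S2 (w, v))))) Tc +
      (real (card D) - 1) * measure_pmf.prob (iid n (joint B2 (\<lambda>(w, v). pV \<bind> (\<lambda>v. S2 (w, v))))) Td +
      (real (card C) - 1) * (real (card D) - 1) * measure_pmf.prob (iid n (joint B2 (\<lambda>_. B2 \<bind> S2))) Te"
proof -
  define B1n where "B1n = joint (iid n pW) (dmc pX)"
  define B2n where "B2n = joint (iid n pW) (\<lambda>_. iid n pV)"
  define S1n where "S1n = (\<lambda>(us :: 'w list, xs). dmc p1 xs)"
  define S2n where "S2n = (\<lambda>(us, vs). dmc pX us \<bind> (\<lambda>xs. dmc2 p2 xs vs))"
  define T1 where "T1 = {((us, xs), ys). zip (zip us xs) ys \<in> Ta \<inter> Tb}"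
  define T2 where "T2 = {((us, vs), zs). zip (zip us vs) zs \<in> Tc \<inter> (Td \<inter> Te)}"
  have len1: "length us = n \<and> length xs = n" if "(us, xs) \<in> set_pmf B1n" for us xs
    using that by (auto simp: B1n_def set_joint dest!: length_dmc)
  have len2: "length us = n \<and> length vs = n" if "(us, vs) \<in> set_pmf B2n" for us vs
    using that by (auto simp: B2n_def set_joint dest!: length_dmc)
  have B1n: "map_pmf (\<lambda>(us, xs). zip us xs) B1n = iid n B1"
    unfolding B1n_def B1_def by (rule map_zip_jp_dmc)
  have B2n: "map_pmf (\<lambda>(us, xs). zip us xs) B2n = iid n B2"
  proof -
    have "B2n = joint (iid n pW) (dmc (\<lambda>_. pV))"
      unfolding B2n_def by (intro joint_cong refl dmc_const) (simp add: length_iid)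
    then show ?thesis unfolding B2_def by (simp add: map_zip_jp_dmc)
  qed
  have S1n: "S1n (us, xs) = dmc S1 (zip us xs)" if "(us, xs) \<in> set_pmf B1n" for us xs
    using len1[OF that] unfolding S1n_def S1_def by (simp add: dmc_zip_snd)
  have S2n: "S2n (us, vs) = dmc S2 (zip us vs)" if "length us = n" "length vs = n" for us vs
    using that unfolding S2n_def S2_def prod.case dmc2_def by (subst dmc_bind_zip) simp_all
  note prob1 = prob_zip_joint[OF B1n] and prob2 = prob_zip_joint[OF B2n]
  have compl: "- {((us, xs), ys). zip (zip us xs) ys \<in> T} = {((us, xs), ys). zip (zip us xs) ys \<in> - T}"
    for T :: "(('p \<times> 'q) \<times> 'r) list set" by auto
  have finn: "fin (iid n pW)" "\<And>us. fin (dmc pX us)" "fin (iid n pV)"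
    using fin by (auto intro!: fin_dmc)
  have "\<exists>x v d1 d2. (\<forall>i\<in>C. \<forall>j\<in>J. x i j \<in> set_pmf (iid n pW \<bind> dmc pX)) \<and> (\<forall>k\<in>D. v k \<in> set_pmf (iid n pV)) \<and>
    E \<mu> (\<lambda>(i, j, k). measure_pmf.prob (dmc p1 (x i j)) {y. d1 y \<noteq> (i, j)} +
      measure_pmf.prob (dmc2 p2 (x i j) (v k)) {z. d2 z \<noteq> (i, k)}) \<le>
      measure_pmf.prob (joint B1n S1n) (- T1) + measure_pmf.prob (joint B2n S2n) (- T2) +
      (real (card J) - 1) * measure_pmf.prob (joint B1n (\<lambda>(us, xs). dmc pX us \<bind> dmc p1)) T1 +
      (real (card C) - 1) * real (card J) * measure_pmf.prob (joint B1n (\<lambda>_. B1n \<bind> S1n)) T1 +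
      (real (card C) - 1) * measure_pmf.prob (joint B2n (\<lambda>(us, vs). iid n pW \<bind> (\<lambda>us. S2n (us, vs)))) T2 +
      (real (card D) - 1) * measure_pmf.prob (joint B2n (\<lambda>(us, vs). iid n pV \<bind> (\<lambda>vs. S2n (us, vs)))) T2 +
      (real (card C) - 1) * (real (card D) - 1) * measure_pmf.prob (joint B2n (\<lambda>_. B2n \<bind> S2n)) T2"
    unfolding B1n_def B2n_def S1n_def S2n_def by (rule superposition_code[OF finn finite \<mu>])
  then obtain x v d1 d2 where code: "\<forall>i\<in>C. \<forall>j\<in>J. x i j \<in> set_pmf (iid n pW \<bind> dmc pX)" "\<forall>k\<in>D. v k \<in> set_pmf (iid n pV)"
    "E \<mu> (\<lambda>(i, j, k). measure_pmf.prob (dmc p1 (x i j)) {y. d1 y \<noteq> (i, j)} +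
      measure_pmf.prob (dmc2 p2 (x i j) (v k)) {z. d2 z \<noteq> (i, k)}) \<le>
      measure_pmf.prob (joint B1n S1n) (- T1) + measure_pmf.prob (joint B2n S2n) (- T2) +
      (real (card J) - 1) * measure_pmf.prob (joint B1n (\<lambda>(us, xs). dmc pX us \<bind> dmc p1)) T1 +
      (real (card C) - 1) * real (card J) * measure_pmf.prob (joint B1n (\<lambda>_. B1n \<bind> S1n)) T1 +
      (real (card C) - 1) * measure_pmf.prob (joint B2n (\<lambda>(us, vs). iid n pW \<bind> (\<lambda>us. S2n (us, vs)))) T2 +
      (real (card D) - 1) * measure_pmf.prob (joint B2n (\<lambda>(us, vs). iid n pV \<bind> (\<lambda>vs. S2n (us, vs)))) T2 +
      (real (card C) - 1) * (real (card D) - 1) * measure_pmf.prob (joint B2n (\<lambda>_. B2n \<bind> S2n)) T2"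
    by blast
  have b0: "measure_pmf.prob (joint B1n S1n) (- T1) \<le>
      measure_pmf.prob (iid n (joint B1 S1)) (- Ta) + measure_pmf.prob (iid n (joint B1 S1)) (- Tb)"
    unfolding T1_def compl using prob1[of S1n S1 "- (Ta \<inter> Tb)"] S1n prob_not_Int_le by metis
  have b1: "measure_pmf.prob (joint B2n S2n) (- T2) \<le> measure_pmf.prob (iid n (joint B2 S2)) (- Tc) +
      (measure_pmf.prob (iid n (joint B2 S2)) (- Td) + measure_pmf.prob (iid n (joint B2 S2)) (- Te))"
  proof -
    have "measure_pmf.prob (joint B2n S2n) (- T2) = measure_pmf.prob (iid n (joint B2 S2)) (- (Tc \<inter> (Td \<inter> Te)))"
      unfolding T2_def compl by (rule prob2) (use S2n len2 in blast)
    also have "\<dots> \<le> measure_pmf.prob (iid n (joint B2 S2)) (- Tc) + measure_pmf.prob (iid n (joint B2 S2)) (- (Td \<inter> Te))"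
      by (rule prob_not_Int_le)
    also have "measure_pmf.prob (iid n (joint B2 S2)) (- (Td \<inter> Te)) \<le>
        measure_pmf.prob (iid n (joint B2 S2)) (- Td) + measure_pmf.prob (iid n (joint B2 S2)) (- Te)"
      by (rule prob_not_Int_le)
    finally show ?thesis by simp
  qed
  have mono1: "measure_pmf.prob (joint B1n Q) T1 \<le> measure_pmf.prob (iid n (joint B1 q)) T"
    if "Ta \<inter> Tb \<subseteq> T" "\<And>us xs. (us, xs) \<in> set_pmf B1n \<Longrightarrow> Q (us, xs) = dmc q (zip us xs)" for Q q T
  proof -
    have "measure_pmf.prob (joint B1n Q) T1 = measure_pmf.prob (iid n (joint B1 q)) (Ta \<inter> Tb)"
      unfolding T1_def by (rule prob1) (rule that(2))
    also have "\<dots> \<le> measure_pmf.prob (iid n (joint B1 q)) T"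
      using that(1) by (intro measure_pmf.finite_measure_mono) auto
    finally show ?thesis .
  qed
  have mono2: "measure_pmf.prob (joint B2n Q) T2 \<le> measure_pmf.prob (iid n (joint B2 q)) T"
    if "Tc \<inter> (Td \<inter> Te) \<subseteq> T" "\<And>us xs. (us, xs) \<in> set_pmf B2n \<Longrightarrow> Q (us, xs) = dmc q (zip us xs)" for Q q T
  proof -
    have "measure_pmf.prob (joint B2n Q) T2 = measure_pmf.prob (iid n (joint B2 q)) (Tc \<inter> (Td \<inter> Te))"
      unfolding T2_def by (rule prob2) (rule that(2))
    also have "\<dots> \<le> measure_pmf.prob (iid n (joint B2 q)) T"
      using that(1) by (intro measure_pmf.finite_measure_mono) auto
    finally show ?thesis .
  qed
  have ba: "measure_pmf.prob (joint B1n (\<lambda>(us, xs). dmc pX us \<bind> dmc p1)) T1 \<le>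
      measure_pmf.prob (iid n (joint B1 (\<lambda>(w, x). pX w \<bind> p1))) Ta"
    by (rule mono1) (use len1 in \<open>auto simp: dmc_bind dmc_zip_fst\<close>)
  have bb: "measure_pmf.prob (joint B1n (\<lambda>_. B1n \<bind> S1n)) T1 \<le>
      measure_pmf.prob (iid n (joint B1 (\<lambda>_. B1 \<bind> S1))) Tb"
  proof (rule mono1)
    have eq: "B1n \<bind> S1n = iid n (B1 \<bind> S1)"
      by (rule bind_zip_iid[OF B1n]) (rule S1n)
    show "B1n \<bind> S1n = dmc (\<lambda>_. B1 \<bind> S1) (zip us xs)" if "(us, xs) \<in> set_pmf B1n" for us xs
      unfolding eq using len1[OF that] by (intro dmc_const) simp
  qed auto
  have bc: "measure_pmf.prob (joint B2n (\<lambda>(us, vs). iid n pW \<bind> (\<lambda>us. S2n (us, vs)))) T2 \<le>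
      measure_pmf.prob (iid n (joint B2 (\<lambda>(w, v). pW \<bind> (\<lambda>w. S2 (w, v))))) Tc"
  proof (rule mono2)
    fix us vs assume "(us, vs) \<in> set_pmf B2n"
    then have len: "length us = n" "length vs = n" using len2 by auto
    have "iid n pW \<bind> (\<lambda>us. S2n (us, vs)) = iid n pW \<bind> (\<lambda>us. dmc S2 (zip us vs))"
      using len by (intro bind_pmf_cong refl S2n) (auto dest: length_iid)
    also have "\<dots> = dmc (\<lambda>(w, v). pW \<bind> (\<lambda>w. S2 (w, v))) (zip us vs)"
      by (rule iid_bind_zip1[OF len])
    finally show "(case (us, vs) of (us, vs) \<Rightarrow> iid n pW \<bind> (\<lambda>us. S2n (us, vs))) =
        dmc (\<lambda>(w, v). pW \<bind> (\<lambda>w. S2 (w, v))) (zip us vs)" by simp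
  qed auto
  have bd: "measure_pmf.prob (joint B2n (\<lambda>(us, vs). iid n pV \<bind> (\<lambda>vs. S2n (us, vs)))) T2 \<le>
      measure_pmf.prob (iid n (joint B2 (\<lambda>(w, v). pV \<bind> (\<lambda>v. S2 (w, v))))) Td"
  proof (rule mono2)
    fix us vs assume "(us, vs) \<in> set_pmf B2n"
    then have len: "length us = n" "length vs = n" using len2 by auto
    have "iid n pV \<bind> (\<lambda>vs. S2n (us, vs)) = iid n pV \<bind> (\<lambda>vs. dmc S2 (zip us vs))"
      using len by (intro bind_pmf_cong refl S2n) (auto dest: length_iid)
    also have "\<dots> = dmc (\<lambda>(w, v). pV \<bind> (\<lambda>v. S2 (w, v))) (zip us vs)"
      by (rule iid_bind_zip2[OF len])
    finally show "(case (us, vs) of (us, vs) \<Rightarrow> iid n pV \<bind> (\<lambda>vs. S2n (us, vs))) =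
        dmc (\<lambda>(w, v). pV \<bind> (\<lambda>v. S2 (w, v))) (zip us vs)" by simp
  qed auto
  have be: "measure_pmf.prob (joint B2n (\<lambda>_. B2n \<bind> S2n)) T2 \<le>
      measure_pmf.prob (iid n (joint B2 (\<lambda>_. B2 \<bind> S2))) Te"
  proof (rule mono2)
    have eq: "B2n \<bind> S2n = iid n (B2 \<bind> S2)"
      by (rule bind_zip_iid[OF B2n]) (use S2n len2 in blast)
    show "B2n \<bind> S2n = dmc (\<lambda>_. B2 \<bind> S2) (zip us xs)" if "(us, xs) \<in> set_pmf B2n" for us xs
      unfolding eq using len2[OF that] by (intro dmc_const) simp
  qed auto
  have card: "1 \<le> real (card C)" "1 \<le> real (card J)" "1 \<le> real (card D)"
    using ne finite by (auto simp: Suc_le_eq card_gt_0_iff)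
  show ?thesis
  proof (intro exI conjI)
    show "\<forall>i\<in>C. \<forall>j\<in>J. length (x i j) = n"
      using code(1) by simp (metis length_dmc length_iid)
    show "\<forall>k\<in>D. length (v k) = n"
      using code(2) by (auto dest!: length_dmc)
    show "E \<mu> (\<lambda>(i, j, k). measure_pmf.prob (dmc p1 (x i j)) {y. d1 y \<noteq> (i, j)} +
      measure_pmf.prob (dmc2 p2 (x i j) (v k)) {z. d2 z \<noteq> (i, k)}) \<le>
      (measure_pmf.prob (iid n (joint B1 S1)) (- Ta) + measure_pmf.prob (iid n (joint B1 S1)) (- Tb)) +
      (measure_pmf.prob (iid n (joint B2 S2)) (- Tc) + (measure_pmf.prob (iid n (joint B2 S2)) (- Td) +
        measure_pmf.prob (iid n (joint B2 S2)) (- Te))) +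
      (real (card J) - 1) * measure_pmf.prob (iid n (joint B1 (\<lambda>(w, x). pX w \<bind> p1))) Ta +
      (real (card C) - 1) * real (card J) * measure_pmf.prob (iid n (joint B1 (\<lambda>_. B1 \<bind> S1))) Tb +
      (real (card C) - 1) * measure_pmf.prob (iid n (joint B2 (\<lambda>(w, v). pW \<bind> (\<lambda>w. S2 (w, v))))) Tc +
      (real (card D) - 1) * measure_pmf.prob (iid n (joint B2 (\<lambda>(w, v). pV \<bind> (\<lambda>v. S2 (w, v))))) Td +
      (real (card C) - 1) * (real (card D) - 1) * measure_pmf.prob (iid n (joint B2 (\<lambda>_. B2 \<bind> S2))) Te"
      by (rule order_trans[OF code(3)], intro add_mono mult_left_mono b0 b1 ba bb bc bd be)
         (use card in auto)
  qed
qed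

text \<open>Here \<open>N\<close> counts the wrong candidates of one kind, \<rho> is their rate and
  d the threshold of the test; an exponent strictly between \<rho> and d defeats the union bound. At
  \<rho> = 0 the number d may be zero, but then there are no wrong candidates and any r < d will
  do.\<close>

lemma exponent_decay:
  fixes N :: "nat \<Rightarrow> real"
  assumes N: "\<And>n. 0 \<le> N n" "\<And>n. N n \<le> c * 2 powr (real n * \<rho>)"
    and zero: "\<rho> = 0 \<Longrightarrow> (\<forall>n. N n = 0)" and \<rho>: "0 \<le> \<rho>" "\<rho> > 0 \<Longrightarrow> \<rho> < d"
  shows "\<exists>r<d. \<forall>a. (\<forall>n. 0 \<le> a n \<and> a n \<le> 2 powr - (real n * r)) \<longrightarrow> (\<lambda>n. N n * a n) \<longlonglongrightarrow> 0"
proof (cases "\<rho> = 0")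
  case True
  then show ?thesis using zero by (intro exI[of _ "d - 1"]) auto
next
  case False
  then have less: "\<rho> < d" using \<rho> by simp
  define r where "r = (\<rho> + d) / 2"
  have decay: "(\<lambda>n. 2 powr - (real n * \<delta>)) \<longlonglongrightarrow> 0" if "0 < \<delta>" for \<delta> :: real
    using that by real_asymp
  have lim: "(\<lambda>n. c * 2 powr - (real n * (r - \<rho>))) \<longlonglongrightarrow> 0"
    using less by (intro tendsto_mult_right_zero decay) (simp add: r_def)
  have "(\<lambda>n. N n * a n) \<longlonglongrightarrow> 0" if a: "\<forall>n. 0 \<le> a n \<and> a n \<le> 2 powr - (real n * r)" for a
  proof (rule tendsto_sandwich[OF _ _ tendsto_const lim])
    have "N n * a n \<le> c * 2 powr - (real n * (r - \<rho>))" for n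
    proof -
      have "N n * a n \<le> (c * 2 powr (real n * \<rho>)) * 2 powr - (real n * r)"
        using N a by (intro mult_mono) (auto intro: order_trans)
      also have "\<dots> = c * 2 powr - (real n * (r - \<rho>))"
        by (simp add: powr_add[symmetric] algebra_simps)
      finally show ?thesis .
    qed
    then show "\<forall>\<^sub>F n in sequentially. N n * a n \<le> c * 2 powr - (real n * (r - \<rho>))" by simp
  qed (use N a in auto)
  then show ?thesis using less by (intro exI[of _ r]) (auto simp: r_def)
qed

text \<open>Rounding up makes the product of the two index ranges of a split private message at
  least 2^(n R1p), so every message finds its place. At rate 0 the range has exactly one
  element.\<close>

definition ceil_pow :: "nat \<Rightarrow> real \<Rightarrow> nat" where
  "ceil_pow n r = nat \<lceil>2 powr (real n * r)\<rceil>"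

lemma ceil_pow_bounds:
  assumes "r \<ge> 0"
  shows "2 powr (real n * r) \<le> real (ceil_pow n r)" "real (ceil_pow n r) - 1 \<le> 2 powr (real n * r)"
    "real (ceil_pow n r) \<le> 2 * 2 powr (real n * r)" "1 \<le> ceil_pow n r"
proof -
  have 1: "1 \<le> 2 powr (real n * r)" using assms by (simp add: ge_one_powr_ge_zero)
  then have "0 \<le> \<lceil>2 powr (real n * r)\<rceil>" by linarith
  then have real: "real (ceil_pow n r) = of_int \<lceil>2 powr (real n * r)\<rceil>" by (simp add: ceil_pow_def)
  show "2 powr (real n * r) \<le> real (ceil_pow n r)" unfolding real by linarith
  then show "1 \<le> ceil_pow n r" using 1 by linarith
  show "real (ceil_pow n r) - 1 \<le> 2 powr (real n * r)" unfolding real by linarith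
  with 1 show "real (ceil_pow n r) \<le> 2 * 2 powr (real n * r)" by linarith
qed

lemma ceil_pow_0 [simp]: "ceil_pow n 0 = 1"
  by (simp add: ceil_pow_def)

text \<open>The union bound over the two receivers; afterwards each term involves only one of the
  two outputs.\<close>

lemma error_prob_le:
  assumes R: "0 \<le> R1c" "0 \<le> R1p" "0 \<le> R2"
  shows "error_prob p1 p2 n R1c R1p R2 enc1 enc2 dec1 dec2 \<le>
    E (pmf_of_set (messages n R1c)) (\<lambda>c. E (pmf_of_set (messages n R1p)) (\<lambda>w. E (pmf_of_set (messages n R2)) (\<lambda>k.
      measure_pmf.prob (dmc p1 (enc1 c w)) {y. dec1 y \<noteq> (c, w)} +
      measure_pmf.prob (dmc2 p2 (enc1 c w) (enc2 k)) {z. dec2 z \<noteq> (c, k)})))"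
proof -
  have fin: "fin (pmf_of_set (messages n r))" if "0 \<le> r" for r
    using card_messages_bounds(1)[OF that] by simp
  have fin_out: "fin (dmc p1 xs)" "fin (dmc2 p2 xs vs)" for xs vs
    by (auto intro!: fin_dmc simp: dmc2_def)
  have "error_prob p1 p2 n R1c R1p R2 enc1 enc2 dec1 dec2 =
    E (pmf_of_set (messages n R1c)) (\<lambda>c. E (pmf_of_set (messages n R1p)) (\<lambda>w. E (pmf_of_set (messages n R2)) (\<lambda>k.
      E (dmc p1 (enc1 c w)) (\<lambda>y. E (dmc2 p2 (enc1 c w) (enc2 k)) (\<lambda>z.
        indicator {(y, z). dec1 y \<noteq> (c, w) \<or> dec2 z \<noteq> (c, k)} (y, z))))))"
    unfolding error_prob_def transmission_def by (simp add: prob_bind indicator_def)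
  also have "\<dots> \<le> E (pmf_of_set (messages n R1c)) (\<lambda>c. E (pmf_of_set (messages n R1p)) (\<lambda>w. E (pmf_of_set (messages n R2)) (\<lambda>k.
      E (dmc p1 (enc1 c w)) (\<lambda>y. E (dmc2 p2 (enc1 c w) (enc2 k)) (\<lambda>z.
        indicator {y. dec1 y \<noteq> (c, w)} y + indicator {z. dec2 z \<noteq> (c, k)} z)))))"
    by (intro E_mono fin fin_out R) (auto simp: indicator_def)
  also have "\<dots> = E (pmf_of_set (messages n R1c)) (\<lambda>c. E (pmf_of_set (messages n R1p)) (\<lambda>w. E (pmf_of_set (messages n R2)) (\<lambda>k.
      measure_pmf.prob (dmc p1 (enc1 c w)) {y. dec1 y \<noteq> (c, w)} +
      measure_pmf.prob (dmc2 p2 (enc1 c w) (enc2 k)) {z. dec2 z \<noteq> (c, k)})))"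
    by (simp add: E_add fin_out)
  finally show ?thesis .
qed

text \<open>
  Transmitter 1 splits its private message into a part of rate \<open>\<gamma>\<close>, carried by the cloud centre
  together with the common message, and a part of rate \<open>R1p - \<gamma>\<close> carried by the satellite.
\<close>

lemma split_private_message:
  assumes R: "0 \<le> R1c" "0 \<le> R1p" "0 \<le> R2" and \<gamma>: "0 \<le> \<gamma>" "\<gamma> \<le> R1p"
    and code: "\<And>\<mu>. set_pmf \<mu> \<subseteq> (messages n R1c \<times> {..<ceil_pow n \<gamma>}) \<times> {..<ceil_pow n (R1p - \<gamma>)} \<times> messages n R2 \<Longrightarrow>
      \<exists>x v d1 d2. (\<forall>i\<in>messages n R1c \<times> {..<ceil_pow n \<gamma>}. \<forall>j\<in>{..<ceil_pow n (R1p - \<gamma>)}. length (x i j) = n) \<and>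
        (\<forall>k\<in>messages n R2. length (v k) = n) \<and>
        E \<mu> (\<lambda>(i, j, k). measure_pmf.prob (dmc p1 (x i j)) {y. d1 y \<noteq> (i, j)} +
          measure_pmf.prob (dmc2 p2 (x i j) (v k)) {z. d2 z \<noteq> (i, k)}) \<le> b"
  shows "\<exists>enc1 enc2 dec1 dec2. valid_encoders n R1c R1p R2 enc1 enc2 \<and>
    error_prob p1 p2 n R1c R1p R2 enc1 enc2 dec1 dec2 \<le> b"
proof -
  define A where "A = ceil_pow n \<gamma>"
  define B where "B = ceil_pow n (R1p - \<gamma>)"
  \<comment> \<open>Messages start at 1, so it is m - 1 that is divided by \<open>B\<close>: the
    quotient goes to the cloud, the remainder to the satellite.\<close>
  define a where "a m = (m - 1) div B" for m :: nat
  define bb where "bb m = (m - 1) mod B" for m :: nat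
  have AB: "1 \<le> A" "1 \<le> B" using ceil_pow_bounds \<gamma> by (auto simp: A_def B_def)
  have range: "a m < A" "bb m < B" "a m * B + bb m + 1 = m" if "m \<in> messages n R1p" for m
  proof -
    have "real m \<le> 2 powr (real n * \<gamma>) * 2 powr (real n * (R1p - \<gamma>))"
      using that by (simp add: messages_def powr_add[symmetric] algebra_simps)
    also have "\<dots> \<le> real A * real B"
      using ceil_pow_bounds(1) \<gamma> by (intro mult_mono) (auto simp: A_def B_def)
    finally have "m \<le> A * B" by (simp flip: of_nat_mult)
    moreover have "1 \<le> m" using that by (simp add: messages_def)
    ultimately have "m - 1 < A * B" by linarith
    then show "a m < A" unfolding a_def by (rule less_mult_imp_div_less)
    show "bb m < B" unfolding bb_def using AB by simp
    show "a m * B + bb m + 1 = m" unfolding a_def bb_def using \<open>1 \<le> m\<close> by simp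
  qed
  define U where "U r = pmf_of_set (messages n r)" for r
  have U: "set_pmf (U r) = messages n r" if "0 \<le> r" for r
    using card_messages_bounds(1)[OF that] by (simp add: U_def)
  then have finU: "fin (U r)" if "0 \<le> r" for r using that by simp
  \<comment> \<open>The indices induced by uniform messages; they need not fill the index
    grid.\<close>
  define \<mu> where "\<mu> = U R1c \<bind> (\<lambda>c. U R1p \<bind> (\<lambda>w. map_pmf (\<lambda>k. ((c, a w), bb w, k)) (U R2)))"
  have \<mu>: "set_pmf \<mu> \<subseteq> (messages n R1c \<times> {..<A}) \<times> {..<B} \<times> messages n R2"
    using range U R by (auto simp: \<mu>_def)
  obtain x v d1 d2 where len: "\<forall>i\<in>messages n R1c \<times> {..<A}. \<forall>j\<in>{..<B}. length (x i j) = n" "\<forall>k\<in>messages n R2. length (v k) = n"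
    and err: "E \<mu> (\<lambda>(i, j, k). measure_pmf.prob (dmc p1 (x i j)) {y. d1 y \<noteq> (i, j)} +
          measure_pmf.prob (dmc2 p2 (x i j) (v k)) {z. d2 z \<noteq> (i, k)}) \<le> b"
    using code[OF \<mu>[unfolded A_def B_def]] unfolding A_def B_def by blast
  define enc1 where "enc1 c w = x (c, a w) (bb w)" for c w
  \<comment> \<open>Receiver 1 reassembles the private message, adding back the 1; Receiver 2
    decodes the private part of the cloud index as well and discards it.\<close>
  define dec1 where "dec1 y = (case d1 y of ((c, i), j) \<Rightarrow> (c, i * B + j + 1))" for y
  define dec2 where "dec2 z = (case d2 z of ((c, i), k) \<Rightarrow> (c, k))" for z
  have "valid_encoders n R1c R1p R2 enc1 v"
    using len range by (simp add: valid_encoders_def enc1_def)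
  moreover have "error_prob p1 p2 n R1c R1p R2 enc1 v dec1 dec2 \<le> b"
  proof -
    have "error_prob p1 p2 n R1c R1p R2 enc1 v dec1 dec2 \<le>
      E (U R1c) (\<lambda>c. E (U R1p) (\<lambda>w. E (U R2) (\<lambda>k.
        measure_pmf.prob (dmc p1 (enc1 c w)) {y. dec1 y \<noteq> (c, w)} +
        measure_pmf.prob (dmc2 p2 (enc1 c w) (v k)) {z. dec2 z \<noteq> (c, k)})))"
      unfolding U_def by (rule error_prob_le[OF R])
    also have "\<dots> \<le> E (U R1c) (\<lambda>c. E (U R1p) (\<lambda>w. E (U R2) (\<lambda>k.
        measure_pmf.prob (dmc p1 (enc1 c w)) {y. d1 y \<noteq> ((c, a w), bb w)} +
        measure_pmf.prob (dmc2 p2 (enc1 c w) (v k)) {z. d2 z \<noteq> ((c, a w), k)})))"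
    proof (intro E_mono finU R add_mono measure_pmf.finite_measure_mono)
      fix c w assume "w \<in> set_pmf (U R1p)"
      then have "a w * B + bb w + 1 = w" using range(3) U R by simp
      then show "{y. dec1 y \<noteq> (c, w)} \<subseteq> {y. d1 y \<noteq> ((c, a w), bb w)}"
        by (auto simp: dec1_def)
    qed (auto simp: dec2_def)
    also have "\<dots> = E \<mu> (\<lambda>(i, j, k). measure_pmf.prob (dmc p1 (x i j)) {y. d1 y \<noteq> (i, j)} +
          measure_pmf.prob (dmc2 p2 (x i j) (v k)) {z. d2 z \<noteq> (i, k)})"
      using finU R by (simp add: \<mu>_def E_bind enc1_def)
    finally show ?thesis using err by simp
  qed
  ultimately show ?thesis by blast
qed

text \<open>Each bound is asked for only when the rate on its left is positive, because at rate zero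
  the right-hand side may vanish too. The last one serves two error kinds, a wrong W2 alone and a
  wrong W2 together with a wrong cloud, since Condition 2 gives both tests the same
  threshold.\<close>

lemma achievable_if_strict:
  fixes p1 :: "'x1::finite \<Rightarrow> 'y1::finite pmf" and p2 :: "'x1 \<Rightarrow> 'x2::finite \<Rightarrow> 'y2::finite pmf"
    and pW :: "'w pmf" and pX :: "'w \<Rightarrow> 'x1 pmf" and v :: 'x2
  assumes c1: "condition1 p2" and c2: "condition2 p2 \<tau> pV" and finW: "fin pW"
    and R: "0 \<le> R1c" "0 \<le> R1p" "0 \<le> R2" and \<gamma>: "0 \<le> \<gamma>" "\<gamma> \<le> R1p"
  defines "L \<equiv> (\<lambda>x. p2 x v)"
  assumes r1: "R1p - \<gamma> > 0 \<Longrightarrow> R1p - \<gamma> < E pW (\<lambda>w. H (pX w \<bind> p1)) - E (pW \<bind> pX) (\<lambda>x. H (p1 x))"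
    and r2: "R1c + R1p > 0 \<Longrightarrow> R1c + R1p < H (pW \<bind> pX \<bind> p1) - E (pW \<bind> pX) (\<lambda>x. H (p1 x))"
    and r3: "R1c + \<gamma> > 0 \<Longrightarrow> R1c + \<gamma> < H (pW \<bind> pX \<bind> L) - E pW (\<lambda>w. H (pX w \<bind> L))"
    and r4: "R2 + R1c + \<gamma> > 0 \<Longrightarrow> R2 + R1c + \<gamma> < \<tau> - E pW (\<lambda>w. H (pX w \<bind> L))"
  shows "(R1c, R1p, R2) \<in> achievable p1 p2"
proof -
  define B1 where "B1 = joint pW pX"
  define B2 where "B2 = joint pW (\<lambda>_. pV)"
  define S1 where "S1 = (\<lambda>(w :: 'w, x). p1 x)"
  define S2 where "S2 = (\<lambda>(w, v). pX w \<bind> (\<lambda>x. p2 x v))"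
  have finB: "fin B1" "fin B2" using finW by (auto simp: B1_def B2_def set_joint)
  have L: "H (q \<bind> (\<lambda>x. p2 x u)) = H (q \<bind> L)" for q u
    unfolding L_def by (rule condition1_single[OF c1])
  have tau: "H (q \<bind> (\<lambda>x. pV \<bind> (\<lambda>v. p2 x v))) = \<tau>" for q
    using c2 by (simp add: condition2_def output2_def ent_eq_H)
  have E1: "E B1 f = E pW (\<lambda>w. E (pX w) (\<lambda>x. f (w, x)))" for f
    unfolding B1_def using finW by (simp add: E_joint)
  have E2: "E B2 f = E pW (\<lambda>w. E pV (\<lambda>v. f (w, v)))" for f
    unfolding B2_def using finW by (simp add: E_joint)
  have HS1: "E B1 (\<lambda>b. H (S1 b)) = E (pW \<bind> pX) (\<lambda>x. H (p1 x))"
    using finW by (simp add: E1 S1_def E_bind)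
  have HS2: "E B2 (\<lambda>b. H (S2 b)) = E pW (\<lambda>w. H (pX w \<bind> L))"
    by (simp add: E2 S2_def L)
  \<comment> \<open>With the mixture as the guess the averaged cross entropy is the entropy of the
    mixture; this evaluates the thresholds of all five tests.\<close>
  have const: "E B (\<lambda>b. E (S b) (\<lambda>y. - log 2 (pmf (B \<bind> S) y))) = H (B \<bind> S)"
    if "fin B" for B :: "'p pmf" and S :: "'p \<Rightarrow> 'q::finite pmf"
    unfolding H_def using that by (subst E_bind) auto
  have xa: "E B1 (\<lambda>b. E (S1 b) (\<lambda>y. - log 2 (pmf (case b of (w, x) \<Rightarrow> pX w \<bind> p1) y))) =
      E pW (\<lambda>w. H (pX w \<bind> p1))"
    unfolding E1 S1_def prod.case by (intro E_cong const) simp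
  have xb: "E B1 (\<lambda>b. E (S1 b) (\<lambda>y. - log 2 (pmf (B1 \<bind> S1) y))) = H (pW \<bind> pX \<bind> p1)"
  proof -
    have "B1 \<bind> S1 = pW \<bind> pX \<bind> p1"
      by (simp add: B1_def S1_def joint_def bind_assoc_pmf bind_map_pmf)
    then show ?thesis using const[OF finB(1), of S1] by simp
  qed
  \<comment> \<open>The mixture over W may be a different law for each letter of Transmitter 2, but
    by Condition 1 its entropy is the same.\<close>
  have xc: "E B2 (\<lambda>b. E (S2 b) (\<lambda>y. - log 2 (pmf (case b of (w, v) \<Rightarrow> pW \<bind> (\<lambda>w. S2 (w, v))) y))) =
      H (pW \<bind> pX \<bind> L)"
  proof -
    have "E B2 (\<lambda>b. E (S2 b) (\<lambda>y. - log 2 (pmf (case b of (w, v) \<Rightarrow> pW \<bind> (\<lambda>w. S2 (w, v))) y))) =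
        E pV (\<lambda>v. E pW (\<lambda>w. E (S2 (w, v)) (\<lambda>y. - log 2 (pmf (pW \<bind> (\<lambda>w. S2 (w, v))) y))))"
      unfolding E2 prod.case by (rule E_swap) (use finW in auto)
    also have "\<dots> = E pV (\<lambda>v. H (pW \<bind> (\<lambda>w. S2 (w, v))))"
      by (intro E_cong const finW)
    also have "\<dots> = H (pW \<bind> pX \<bind> L)"
      using L[of "pW \<bind> pX"] by (simp add: S2_def bind_assoc_pmf)
    finally show ?thesis .
  qed
  have xd: "E B2 (\<lambda>b. E (S2 b) (\<lambda>y. - log 2 (pmf (case b of (w, v) \<Rightarrow> pV \<bind> (\<lambda>v. S2 (w, v))) y))) = \<tau>"
  proof -
    have "E B2 (\<lambda>b. E (S2 b) (\<lambda>y. - log 2 (pmf (case b of (w, v) \<Rightarrow> pV \<bind> (\<lambda>v. S2 (w, v))) y))) =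
        E pW (\<lambda>w. H (pV \<bind> (\<lambda>v. S2 (w, v))))"
      unfolding E2 prod.case by (intro E_cong const) simp
    \<comment> \<open>Condition 2 is applied to the conditional input law \<open>pX w\<close>: given
      W = w the output entropy is still \<tau>.\<close>
    also have "\<dots> = E pW (\<lambda>w. \<tau>)"
      unfolding S2_def prod.case by (subst bind_commute_pmf) (simp add: tau)
    finally show ?thesis by simp
  qed
  have xe: "E B2 (\<lambda>b. E (S2 b) (\<lambda>y. - log 2 (pmf (B2 \<bind> S2) y))) = \<tau>"
  proof -
    have "B2 \<bind> S2 = pW \<bind> (\<lambda>w. pX w \<bind> (\<lambda>x. pV \<bind> (\<lambda>v. p2 x v)))"
      by (simp add: B2_def S2_def joint_def bind_assoc_pmf bind_map_pmf)
         (intro bind_pmf_cong refl bind_commute_pmf)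
    also have "H \<dots> = \<tau>"
      using tau[of "pW \<bind> pX"] by (simp add: bind_assoc_pmf)
    finally show ?thesis using const[OF finB(2), of S2] by simp
  qed

  define MC where "MC n = messages n R1c" for n
  define M2 where "M2 n = messages n R2" for n
  define A where "A n = ceil_pow n \<gamma>" for n
  define B where "B n = ceil_pow n (R1p - \<gamma>)" for n
  have M: "1 \<le> real (card (MC n))" "1 \<le> real (card (M2 n))"
    "real (card (MC n)) \<le> 2 powr (real n * R1c)" "real (card (M2 n)) \<le> 2 powr (real n * R2)" for n
    using R card_messages_bounds by (auto simp: MC_def M2_def Suc_le_eq card_gt_0_iff)
  have AB: "1 \<le> real (A n)" "1 \<le> real (B n)" "real (A n) \<le> 2 * 2 powr (real n * \<gamma>)"
    "real (B n) \<le> 2 * 2 powr (real n * (R1p - \<gamma>))" "real (B n) - 1 \<le> 2 powr (real n * (R1p - \<gamma>))" for n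
    using ceil_pow_bounds[OF \<gamma>(1), of n] ceil_pow_bounds[of "R1p - \<gamma>" n] \<gamma> by (auto simp: A_def B_def)
  \<comment> \<open>The number of cloud centres: common messages times cloud parts of the private
    message, at rate R1c + \<gamma>.\<close>
  define NC where "NC n = real (card (MC n)) * real (A n)" for n
  have NC: "1 \<le> NC n" "NC n \<le> 2 * 2 powr (real n * (R1c + \<gamma>))" for n
  proof -
    show "1 \<le> NC n" using mult_mono[of 1 "real (card (MC n))" 1 "real (A n)"] M AB by (simp add: NC_def)
    have "NC n \<le> 2 powr (real n * R1c) * (2 * 2 powr (real n * \<gamma>))"
      unfolding NC_def using M AB by (intro mult_mono) auto
    then show "NC n \<le> 2 * 2 powr (real n * (R1c + \<gamma>))"
      by (simp add: powr_add distrib_left)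
  qed
  have NC0: "NC n = 1" if "R1c = 0" "\<gamma> = 0" for n
    using M(1,3)[of n] that by (simp add: NC_def A_def)
  have M20: "card (M2 n) = 1" if "R2 = 0" for n
    using M(2,4)[of n] that by simp

  \<comment> \<open>For each kind of wrong codeword an exponent is fixed that lies strictly below
    the threshold of its test and still outweighs the number of candidates.\<close>
  obtain ra where ra: "ra < E pW (\<lambda>w. H (pX w \<bind> p1)) - E (pW \<bind> pX) (\<lambda>x. H (p1 x))"
    and la: "\<And>a. (\<forall>n. 0 \<le> a n \<and> a n \<le> 2 powr - (real n * ra)) \<Longrightarrow> (\<lambda>n. (real (B n) - 1) * a n) \<longlonglongrightarrow> 0"
  proof -
    have "real (B n) - 1 \<le> 1 * 2 powr (real n * (R1p - \<gamma>))" "0 \<le> real (B n) - 1" for n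
      using AB[of n] by auto
    moreover have "\<forall>n. real (B n) - 1 = 0" if "R1p - \<gamma> = 0" using that by (simp add: B_def)
    ultimately have "\<exists>r<E pW (\<lambda>w. H (pX w \<bind> p1)) - E (pW \<bind> pX) (\<lambda>x. H (p1 x)). \<forall>a.
        (\<forall>n. 0 \<le> a n \<and> a n \<le> 2 powr - (real n * r)) \<longrightarrow> (\<lambda>n. (real (B n) - 1) * a n) \<longlonglongrightarrow> 0"
      using \<gamma> r1 by (intro exponent_decay[of "\<lambda>n. real (B n) - 1" 1 "R1p - \<gamma>"]) auto
    then show ?thesis using that by blast
  qed
  obtain rb where rb: "rb < H (pW \<bind> pX \<bind> p1) - E (pW \<bind> pX) (\<lambda>x. H (p1 x))"
    and lb: "\<And>a. (\<forall>n. 0 \<le> a n \<and> a n \<le> 2 powr - (real n * rb)) \<Longrightarrow> (\<lambda>n. (NC n - 1) * real (B n) * a n) \<longlonglongrightarrow> 0"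
  proof -
    have "(NC n - 1) * real (B n) \<le> 4 * 2 powr (real n * (R1c + R1p))" for n
    proof -
      have "(NC n - 1) * real (B n) \<le> (2 * 2 powr (real n * (R1c + \<gamma>))) * (2 * 2 powr (real n * (R1p - \<gamma>)))"
        using NC[of n] AB[of n] by (intro mult_mono) auto
      also have "\<dots> = 4 * 2 powr (real n * (R1c + R1p))"
        by (simp add: powr_add[symmetric] algebra_simps)
      finally show ?thesis .
    qed
    moreover have "0 \<le> (NC n - 1) * real (B n)" for n using NC[of n] by simp
    moreover have "\<forall>n. (NC n - 1) * real (B n) = 0" if "R1c + R1p = 0"
      using that R \<gamma> NC0 by simp
    ultimately have "\<exists>r<H (pW \<bind> pX \<bind> p1) - E (pW \<bind> pX) (\<lambda>x. H (p1 x)). \<forall>a.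
        (\<forall>n. 0 \<le> a n \<and> a n \<le> 2 powr - (real n * r)) \<longrightarrow> (\<lambda>n. (NC n - 1) * real (B n) * a n) \<longlonglongrightarrow> 0"
      using R \<gamma> r2 by (intro exponent_decay[of "\<lambda>n. (NC n - 1) * real (B n)" 4 "R1c + R1p"]) auto
    then show ?thesis using that by blast
  qed
  obtain rc where rc: "rc < H (pW \<bind> pX \<bind> L) - E pW (\<lambda>w. H (pX w \<bind> L))"
    and lc: "\<And>a. (\<forall>n. 0 \<le> a n \<and> a n \<le> 2 powr - (real n * rc)) \<Longrightarrow> (\<lambda>n. (NC n - 1) * a n) \<longlonglongrightarrow> 0"
  proof -
    have "NC n - 1 \<le> 2 * 2 powr (real n * (R1c + \<gamma>))" "0 \<le> NC n - 1" for n using NC[of n] by auto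
    moreover have "\<forall>n. NC n - 1 = 0" if "R1c + \<gamma> = 0" using that R \<gamma> NC0 by simp
    ultimately have "\<exists>r<H (pW \<bind> pX \<bind> L) - E pW (\<lambda>w. H (pX w \<bind> L)). \<forall>a.
        (\<forall>n. 0 \<le> a n \<and> a n \<le> 2 powr - (real n * r)) \<longrightarrow> (\<lambda>n. (NC n - 1) * a n) \<longlonglongrightarrow> 0"
      using R \<gamma> r3 by (intro exponent_decay[of "\<lambda>n. NC n - 1" 2 "R1c + \<gamma>"]) auto
    then show ?thesis using that by blast
  qed
  obtain rd where rd: "rd < \<tau> - E pW (\<lambda>w. H (pX w \<bind> L))"
    and ld: "\<And>a. (\<forall>n. 0 \<le> a n \<and> a n \<le> 2 powr - (real n * rd)) \<Longrightarrow> (\<lambda>n. (real (card (M2 n)) - 1) * a n) \<longlonglongrightarrow> 0"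
  proof -
    have "real (card (M2 n)) - 1 \<le> 1 * 2 powr (real n * R2)" "0 \<le> real (card (M2 n)) - 1" for n using M[of n] by auto
    moreover have "\<forall>n. real (card (M2 n)) - 1 = 0" if "R2 = 0" using that M20 by simp
    moreover have "R2 < \<tau> - E pW (\<lambda>w. H (pX w \<bind> L))" if "R2 > 0" using r4 that R \<gamma> by simp
    ultimately have "\<exists>r<\<tau> - E pW (\<lambda>w. H (pX w \<bind> L)). \<forall>a.
        (\<forall>n. 0 \<le> a n \<and> a n \<le> 2 powr - (real n * r)) \<longrightarrow> (\<lambda>n. (real (card (M2 n)) - 1) * a n) \<longlonglongrightarrow> 0"
      using R \<gamma>  by (intro exponent_decay[of "\<lambda>n. real (card (M2 n)) - 1" 1 "R2"]) auto
    then show ?thesis using that by blast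
  qed
  obtain re where re: "re < \<tau> - E pW (\<lambda>w. H (pX w \<bind> L))"
    and le: "\<And>a. (\<forall>n. 0 \<le> a n \<and> a n \<le> 2 powr - (real n * re)) \<Longrightarrow>
      (\<lambda>n. (NC n - 1) * (real (card (M2 n)) - 1) * a n) \<longlonglongrightarrow> 0"
  proof -
    have "(NC n - 1) * (real (card (M2 n)) - 1) \<le> 2 * 2 powr (real n * (R2 + R1c + \<gamma>))" for n
    proof -
      have "(NC n - 1) * (real (card (M2 n)) - 1) \<le> (2 * 2 powr (real n * (R1c + \<gamma>))) * 2 powr (real n * R2)"
        using NC[of n] M[of n] by (intro mult_mono) auto
      also have "\<dots> = 2 * 2 powr (real n * (R2 + R1c + \<gamma>))"
        by (simp add: powr_add[symmetric] algebra_simps)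
      finally show ?thesis .
    qed
    moreover have "0 \<le> (NC n - 1) * (real (card (M2 n)) - 1)" for n using NC[of n] M[of n] by simp
    moreover have "\<forall>n. (NC n - 1) * (real (card (M2 n)) - 1) = 0" if "R2 + R1c + \<gamma> = 0"
      using that R \<gamma> M20 by simp
    ultimately have "\<exists>r<\<tau> - E pW (\<lambda>w. H (pX w \<bind> L)). \<forall>a.
        (\<forall>n. 0 \<le> a n \<and> a n \<le> 2 powr - (real n * r)) \<longrightarrow> (\<lambda>n. (NC n - 1) * (real (card (M2 n)) - 1) * a n) \<longlonglongrightarrow> 0"
      using R \<gamma> r4 by (intro exponent_decay[of "\<lambda>n. (NC n - 1) * (real (card (M2 n)) - 1)" 2 "R2 + R1c + \<gamma>"]) auto
    then show ?thesis using that by blast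
  qed

  obtain Ta where Ta: "\<And>n. measure_pmf.prob (iid n (joint B1 (\<lambda>(w, x). pX w \<bind> p1))) (Ta n) \<le> 2 powr - (real n * ra)"
      "(\<lambda>n. measure_pmf.prob (iid n (joint B1 S1)) (- Ta n)) \<longlonglongrightarrow> 0"
  proof -
    have "\<exists>T. (\<forall>n. measure_pmf.prob (iid n (joint B1 (\<lambda>(w, x). pX w \<bind> p1))) (T n) \<le> 2 powr - (real n * ra)) \<and>
        (\<lambda>n. measure_pmf.prob (iid n (joint B1 S1)) (- T n)) \<longlonglongrightarrow> 0"
      by (rule channel_test[OF finB(1)], force simp: B1_def set_joint S1_def, unfold xa HS1, rule ra)
    then show ?thesis using that by blast
  qed
  obtain Tb where Tb: "\<And>n. measure_pmf.prob (iid n (joint B1 (\<lambda>_. B1 \<bind> S1))) (Tb n) \<le> 2 powr - (real n * rb)"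
      "(\<lambda>n. measure_pmf.prob (iid n (joint B1 S1)) (- Tb n)) \<longlonglongrightarrow> 0"
  proof -
    have "\<exists>T. (\<forall>n. measure_pmf.prob (iid n (joint B1 (\<lambda>_. B1 \<bind> S1))) (T n) \<le> 2 powr - (real n * rb)) \<and>
        (\<lambda>n. measure_pmf.prob (iid n (joint B1 S1)) (- T n)) \<longlonglongrightarrow> 0"
      by (rule channel_test[OF finB(1)], force simp: B1_def set_joint, unfold xb HS1, rule rb)
    then show ?thesis using that by blast
  qed
  obtain Tc where Tc: "\<And>n. measure_pmf.prob (iid n (joint B2 (\<lambda>(w, v). pW \<bind> (\<lambda>w. S2 (w, v))))) (Tc n) \<le> 2 powr - (real n * rc)"
      "(\<lambda>n. measure_pmf.prob (iid n (joint B2 S2)) (- Tc n)) \<longlonglongrightarrow> 0"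
  proof -
    have "\<exists>T. (\<forall>n. measure_pmf.prob (iid n (joint B2 (\<lambda>(w, v). pW \<bind> (\<lambda>w. S2 (w, v))))) (T n) \<le> 2 powr - (real n * rc)) \<and>
        (\<lambda>n. measure_pmf.prob (iid n (joint B2 S2)) (- T n)) \<longlonglongrightarrow> 0"
      by (rule channel_test[OF finB(2)], force simp: B2_def set_joint, unfold xc HS2, rule rc)
    then show ?thesis using that by blast
  qed
  obtain Td where Td: "\<And>n. measure_pmf.prob (iid n (joint B2 (\<lambda>(w, v). pV \<bind> (\<lambda>v. S2 (w, v))))) (Td n) \<le> 2 powr - (real n * rd)"
      "(\<lambda>n. measure_pmf.prob (iid n (joint B2 S2)) (- Td n)) \<longlonglongrightarrow> 0"
  proof -
    have "\<exists>T. (\<forall>n. measure_pmf.prob (iid n (joint B2 (\<lambda>(w, v). pV \<bind> (\<lambda>v. S2 (w, v))))) (T n) \<le> 2 powr - (real n * rd)) \<and>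
        (\<lambda>n. measure_pmf.prob (iid n (joint B2 S2)) (- T n)) \<longlonglongrightarrow> 0"
      by (rule channel_test[OF finB(2)], force simp: B2_def set_joint, unfold xd HS2, rule rd)
    then show ?thesis using that by blast
  qed
  obtain Te where Te: "\<And>n. measure_pmf.prob (iid n (joint B2 (\<lambda>_. B2 \<bind> S2))) (Te n) \<le> 2 powr - (real n * re)"
      "(\<lambda>n. measure_pmf.prob (iid n (joint B2 S2)) (- Te n)) \<longlonglongrightarrow> 0"
  proof -
    have "\<exists>T. (\<forall>n. measure_pmf.prob (iid n (joint B2 (\<lambda>_. B2 \<bind> S2))) (T n) \<le> 2 powr - (real n * re)) \<and>
        (\<lambda>n. measure_pmf.prob (iid n (joint B2 S2)) (- T n)) \<longlonglongrightarrow> 0"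
      by (rule channel_test[OF finB(2)], force simp: B2_def set_joint, unfold xe HS2, rule re)
    then show ?thesis using that by blast
  qed

  define err where "err n =
      (measure_pmf.prob (iid n (joint B1 S1)) (- Ta n) + measure_pmf.prob (iid n (joint B1 S1)) (- Tb n)) +
      (measure_pmf.prob (iid n (joint B2 S2)) (- Tc n) + (measure_pmf.prob (iid n (joint B2 S2)) (- Td n) +
        measure_pmf.prob (iid n (joint B2 S2)) (- Te n))) +
      (real (B n) - 1) * measure_pmf.prob (iid n (joint B1 (\<lambda>(w, x). pX w \<bind> p1))) (Ta n) +
      (NC n - 1) * real (B n) * measure_pmf.prob (iid n (joint B1 (\<lambda>_. B1 \<bind> S1))) (Tb n) +
      (NC n - 1) * measure_pmf.prob (iid n (joint B2 (\<lambda>(w, v). pW \<bind> (\<lambda>w. S2 (w, v))))) (Tc n) +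
      (real (card (M2 n)) - 1) * measure_pmf.prob (iid n (joint B2 (\<lambda>(w, v). pV \<bind> (\<lambda>v. S2 (w, v))))) (Td n) +
      (NC n - 1) * (real (card (M2 n)) - 1) * measure_pmf.prob (iid n (joint B2 (\<lambda>_. B2 \<bind> S2))) (Te n)" for n
  \<comment> \<open>The first five terms vanish because each test accepts the truth, the last five
    by the choice of exponents.\<close>
  have "err \<longlonglongrightarrow> (0 + 0) + (0 + (0 + 0)) + 0 + 0 + 0 + 0 + 0"
    unfolding err_def[abs_def]
    by (intro tendsto_add Ta(2) Tb(2) Tc(2) Td(2) Te(2) la lb lc ld le) (simp_all add: Ta Tb Tc Td Te)
  then have err: "err \<longlonglongrightarrow> 0" by simp

  have "\<exists>enc1 enc2 dec1 dec2. valid_encoders n R1c R1p R2 enc1 enc2 \<and>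
      error_prob p1 p2 n R1c R1p R2 enc1 enc2 dec1 dec2 \<le> err n" for n
  proof (rule split_private_message[OF R \<gamma>])
    fix \<mu> assume \<mu>: "set_pmf \<mu> \<subseteq> (messages n R1c \<times> {..<ceil_pow n \<gamma>}) \<times> {..<ceil_pow n (R1p - \<gamma>)} \<times> messages n R2"
    have ne: "messages n R1c \<times> {..<ceil_pow n \<gamma>} \<noteq> {}" "{..<ceil_pow n (R1p - \<gamma>)} \<noteq> {}" "messages n R2 \<noteq> {}"
      using AB(1,2)[of n] R card_messages_bounds(1) by (auto simp: A_def B_def lessThan_empty_iff)
    have card: "real (card (messages n R1c \<times> {..<ceil_pow n \<gamma>})) = NC n"
      "real (card {..<ceil_pow n (R1p - \<gamma>)}) = real (B n)" "real (card (messages n R2)) = real (card (M2 n))"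
      by (simp_all add: NC_def MC_def A_def B_def M2_def card_cartesian_product)
    show "\<exists>x v d1 d2. (\<forall>i\<in>messages n R1c \<times> {..<ceil_pow n \<gamma>}. \<forall>j\<in>{..<ceil_pow n (R1p - \<gamma>)}. length (x i j) = n) \<and>
        (\<forall>k\<in>messages n R2. length (v k) = n) \<and>
        E \<mu> (\<lambda>(i, j, k). measure_pmf.prob (dmc p1 (x i j)) {y. d1 y \<noteq> (i, j)} +
          measure_pmf.prob (dmc2 p2 (x i j) (v k)) {z. d2 z \<noteq> (i, k)}) \<le> err n"
      unfolding err_def B1_def B2_def S1_def S2_def card[symmetric]
      by (rule n_letter_code[OF finW _ _ _ ne \<mu>]) simp_all
  qed
  then obtain enc1 enc2 dec1 dec2 where code: "\<And>n. valid_encoders n R1c R1p R2 (enc1 n) (enc2 n)"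
    "\<And>n. error_prob p1 p2 n R1c R1p R2 (enc1 n) (enc2 n) (dec1 n) (dec2 n) \<le> err n"
    by metis
  have "(\<lambda>n. error_prob p1 p2 n R1c R1p R2 (enc1 n) (enc2 n) (dec1 n) (dec2 n)) \<longlonglongrightarrow> 0"
    using code(2) by (intro tendsto_sandwich[OF _ _ tendsto_const err] always_eventually allI)
      (simp_all add: error_prob_def)
  then show ?thesis
    unfolding achievable_def using R code(1) by blast
qed

theorem mainTheorem5:
  fixes p1 :: "'x1::finite \<Rightarrow> 'y1::finite pmf"
    and p2 :: "'x1 \<Rightarrow> 'x2::finite \<Rightarrow> 'y2::finite pmf"
    and \<tau> :: real
    and pstar :: "'x2 pmf"
  assumes "condition1 p2"
    and "condition2 p2 \<tau> pstar"
  shows "capacity_region p1 p2 =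
    {(R1c, R1p, R2). 0 \<le> R1c \<and> 0 \<le> R1p \<and> 0 \<le> R2 \<and>
      (\<exists>(pW :: nat pmf) (pX1 :: nat \<Rightarrow> 'x1 pmf) (\<gamma> :: real).
        finite (set_pmf pW) \<and> 0 \<le> \<gamma> \<and>
        (let P = joint_law pW pX1 pstar p1 p2;
             W = (\<lambda>(w, x1, x2, y1, y2). w);
             X1 = (\<lambda>(w, x1, x2, y1, y2). x1);
             X2 = (\<lambda>(w, x1, x2, y1, y2). x2);
             Y1 = (\<lambda>(w, x1, x2, y1, y2). y1);
             Y2 = (\<lambda>(w, x1, x2, y1, y2). y2)
         in R1p \<le> cond_mut_info P X1 Y1 W + \<gamma> \<and>
            R1c + R1p \<le> mut_info P X1 Y1 \<and>
            R1c \<le> cond_mut_info P W Y2 X2 - \<gamma> \<and>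
            R2 + R1c \<le> \<tau> - cond_ent P Y2 (\<lambda>\<omega>. (W \<omega>, X2 \<omega>)) - \<gamma>))}"
    (is "_ = ?R")
proof -
  \<comment> \<open>Any letter serves: by Condition 1 the entropies given X2 do not depend on
    it.\<close>
  define v :: 'x2 where "v = undefined"
  define L where "L = (\<lambda>x. p2 x v)"
  define nonneg :: "(real \<times> real \<times> real) set" where "nonneg = {0..} \<times> {0..} \<times> {0..}"
  have R: "?R = nonneg \<inter> {(R1c, R1p, R2). \<exists>(pW :: nat pmf) pX \<gamma>. fin pW \<and> 0 \<le> \<gamma> \<and>
      R1p \<le> E pW (\<lambda>w. H (pX w \<bind> p1)) - E (pW \<bind> pX) (\<lambda>x. H (p1 x)) + \<gamma> \<and>
      R1c + R1p \<le> H (pW \<bind> pX \<bind> p1) - E (pW \<bind> pX) (\<lambda>x. H (p1 x)) \<and>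
      R1c \<le> H (pW \<bind> pX \<bind> L) - E pW (\<lambda>w. H (pX w \<bind> L)) - \<gamma> \<and>
      R2 + R1c \<le> \<tau> - E pW (\<lambda>w. H (pX w \<bind> L)) - \<gamma>}" (is "_ = nonneg \<inter> ?R'")
    unfolding Let_def nonneg_def L_def
    by (auto simp: joint_law_info(1,2)[OF assms(1)] joint_law_info(3,4)[where v = v, OF assms(1)] cong: conj_cong)
  have R': "?R' = region p1 L \<tau>"
  proof (intro equalityI subsetI)
    fix Q assume "Q \<in> ?R'"
    then obtain R1c R1p R2 and pW :: "nat pmf" and pX \<gamma> where Q: "Q = (R1c, R1p, R2)" and fin: "fin pW" "0 \<le> \<gamma>"
      and ineq: "R1p \<le> E pW (\<lambda>w. H (pX w \<bind> p1)) - E (pW \<bind> pX) (\<lambda>x. H (p1 x)) + \<gamma>"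
        "R1c + R1p \<le> H (pW \<bind> pX \<bind> p1) - E (pW \<bind> pX) (\<lambda>x. H (p1 x))"
        "R1c \<le> H (pW \<bind> pX \<bind> L) - E pW (\<lambda>w. H (pX w \<bind> L)) - \<gamma>"
        "R2 + R1c \<le> \<tau> - E pW (\<lambda>w. H (pX w \<bind> L)) - \<gamma>"
      by auto
    let ?z = "(pvec (pW \<bind> pX), E pW (\<lambda>w. H (pX w \<bind> p1)), E pW (\<lambda>w. H (pX w \<bind> L)))"
    have "?z \<in> ent_hull p1 L" unfolding ent_hull_iff_mixture using fin by blast
    moreover have "feasible p1 L \<tau> Q ?z \<gamma>"
      using ineq by (simp add: Q feasible_def out_ent_pvec noise_ent_pvec)
    ultimately show "Q \<in> region p1 L \<tau>" unfolding region_def using fin by blast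
  next
    fix Q assume "Q \<in> region p1 L \<tau>"
    then obtain z \<gamma> where z: "z \<in> ent_hull p1 L" and \<gamma>: "0 \<le> \<gamma>" and feas: "feasible p1 L \<tau> Q z \<gamma>"
      unfolding region_def by blast
    obtain pW :: "nat pmf" and pX where "fin pW"
      and "z = (pvec (pW \<bind> pX), E pW (\<lambda>w. H (pX w \<bind> p1)), E pW (\<lambda>w. H (pX w \<bind> L)))"
      using z unfolding ent_hull_iff_mixture by blast
    moreover obtain R1c R1p R2 where "Q = (R1c, R1p, R2)" by (cases Q) auto
    ultimately show "Q \<in> ?R'"
      using feas \<gamma> unfolding feasible_def by (simp add: out_ent_pvec noise_ent_pvec) blast
  qed
  show ?thesis
  proof (intro equalityI)
    have "closed ?R"
      unfolding R R' nonneg_def by (intro closed_Int closed_Times closed_atLeast closed_region)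
    moreover have "achievable p1 p2 \<subseteq> ?R"
    proof -
      have "is_tau p2 \<tau>" using assms(2) by (simp add: condition2_def)
      then have "achievable p1 p2 \<subseteq> region p1 L \<tau>"
        unfolding L_def by (rule achievable_subset_region[OF assms(1)])
      moreover have "achievable p1 p2 \<subseteq> nonneg"
        unfolding achievable_def nonneg_def by clarsimp
      ultimately show ?thesis unfolding R R' by blast
    qed
    ultimately show "capacity_region p1 p2 \<subseteq> ?R"
      unfolding capacity_region_def by (rule closure_minimal[rotated])
  next
    show "?R \<subseteq> capacity_region p1 p2"
    proof
      fix Q assume "Q \<in> ?R"
      then obtain R1c R1p R2 and pW :: "nat pmf" and pX \<gamma> where Q: "Q = (R1c, R1p, R2)"
        and R0: "0 \<le> R1c" "0 \<le> R1p" "0 \<le> R2" and fin: "fin pW" and \<gamma>: "0 \<le> \<gamma>"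
        and ineq: "R1p \<le> E pW (\<lambda>w. H (pX w \<bind> p1)) - E (pW \<bind> pX) (\<lambda>x. H (p1 x)) + \<gamma>"
          "R1c + R1p \<le> H (pW \<bind> pX \<bind> p1) - E (pW \<bind> pX) (\<lambda>x. H (p1 x))"
          "R1c \<le> H (pW \<bind> pX \<bind> L) - E pW (\<lambda>w. H (pX w \<bind> L)) - \<gamma>"
          "R2 + R1c \<le> \<tau> - E pW (\<lambda>w. H (pX w \<bind> L)) - \<gamma>"
        unfolding R nonneg_def by auto
      \<comment> \<open>The part of the private message placed in the cloud. Lowering \<gamma> to g
        only relaxes the last two inequalities, and the first is called upon only when g =
        \<gamma>.\<close>
      define g where "g = min \<gamma> R1p"
      have g: "0 \<le> g" "g \<le> R1p" "g \<le> \<gamma>" using \<gamma> R0 by (auto simp: g_def)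
      have scale: "s * r < d" if "0 < s * r" "r \<le> d" "0 \<le> s" "s < 1" for s r d :: real
      proof -
        have "0 < r" using that by (simp add: zero_less_mult_iff)
        then have "s * r < 1 * r" using that(4) by (intro mult_strict_right_mono)
        then show ?thesis using that(2) by simp
      qed
      have ach: "(s * R1c, s * R1p, s * R2) \<in> achievable p1 p2" if s: "0 \<le> s" "s < 1" for s
      proof (rule achievable_if_strict[where \<gamma> = "s * g" and v = v, OF assms fin])
        note sc = scale[OF _ _ s]
        show "s * R1p - s * g < E pW (\<lambda>w. H (pX w \<bind> p1)) - E (pW \<bind> pX) (\<lambda>x. H (p1 x))" if "0 < s * R1p - s * g"
        proof -
          have "0 < s * (R1p - g)" using that by (simp add: right_diff_distrib)
          \<comment> \<open>A positive satellite rate means g < R1p, so the cap was not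
            active.\<close>
          moreover from this have "g = \<gamma>" by (auto simp: g_def min_def split: if_splits)
          ultimately show ?thesis using sc[of "R1p - g"] ineq(1) by (simp add: right_diff_distrib)
        qed
        show "s * R1c + s * R1p < H (pW \<bind> pX \<bind> p1) - E (pW \<bind> pX) (\<lambda>x. H (p1 x))" if "0 < s * R1c + s * R1p"
          using sc[of "R1c + R1p"] that ineq(2) by (simp add: distrib_left)
        show "s * R1c + s * g < H (pW \<bind> pX \<bind> (\<lambda>x. p2 x v)) - E pW (\<lambda>w. H (pX w \<bind> (\<lambda>x. p2 x v)))"
          if "0 < s * R1c + s * g"
          using sc[of "R1c + g"] that ineq(3) g by (simp add: distrib_left L_def)
        show "s * R2 + s * R1c + s * g < \<tau> - E pW (\<lambda>w. H (pX w \<bind> (\<lambda>x. p2 x v)))"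
          if "0 < s * R2 + s * R1c + s * g"
          using sc[of "R2 + R1c + g"] that ineq(4) g by (simp add: distrib_left L_def)
      qed (use s R0 g in \<open>auto intro: mult_left_mono\<close>)
      \<comment> \<open>The factors 1 - 1/(n+1) start at 0, stay below 1 and tend to 1, so the
        target is a limit of achievable triplets.\<close>
      have "\<forall>n. ((1 - 1 / real (Suc n)) * R1c, (1 - 1 / real (Suc n)) * R1p, (1 - 1 / real (Suc n)) * R2) \<in> achievable p1 p2"
        by (intro allI ach) simp_all
      moreover have "(\<lambda>n. ((1 - 1 / real (Suc n)) * R1c, (1 - 1 / real (Suc n)) * R1p, (1 - 1 / real (Suc n)) * R2))
          \<longlonglongrightarrow> ((1 - 0) * R1c, (1 - 0) * R1p, (1 - 0) * R2)"
        by (intro tendsto_intros LIMSEQ_Suc[OF lim_1_over_n])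
      ultimately show "Q \<in> capacity_region p1 p2"
        unfolding capacity_region_def closure_sequential Q by auto
    qed
  qed
qed

end
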